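(* Fix any pair of integer matrices $A$ of size $r\times q$ and $B$ of size $s\times q$. Then there is a polynomial time algorithm that, given any positive integer $n$ and any integer vectors $b=(b^0,b^1,\dots,b^n)$ and $c=(c^1,\dots,c^n)$, with $b^0\in\mathbb{Z}^s$, and $b^k\in\mathbb{Z}^r$ and $c^k\in\mathbb{Z}^q$ for $k=1,\dots,n$, solves the generalized $n$-fold integer programming problem $$\min\Big\{\sum_{k=1}^n c^k x^k\ :\ \sum_{k=1}^n Bx^k=b^0,\ \ Ax^k=b^k\ \text{and}\ x^k\in\mathbb{N}^q\ \text{for } k=1,\dots,n\Big\}.$$
   Context: $\mathbb{N}$ denotes the set of nonnegative integers, and $c^kx^k$ denotes the standard inner product. Solving an integer program means that the algorithm concludes with precisely one of the following correct outputs: it asserts that there is no feasible solution, or it asserts that the objective function is unbounded (below) on the feasible set, or it returns an optimal solution. The matrices $A,B$ (hence $r,s,q$) are fixed and not part of the input. The input size is $n$ (its value, not its bit length) plus the bit size of the integer vectors $b$ and $c$ (binary encoding); polynomial time means polynomial in this input size, where the polynomial may depend on $A,B$. *)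

theory Defs
  imports
    "Jordan_Normal_Form.Matrix"
    "HOL-Computational_Algebra.Polynomial"
    "HOL-Library.Log_Nat"
begin

section \<open>Machine model\<close>

text \<open>
  Algorithms are programs for a deterministic random access machine with logarithmic cost, in
  structured form: an integer memory, a read-only sequential input tape of integers, a write-only
  output tape of integers, and integer arithmetic in which every value that is produced or accessed,
  as well as every address, is charged its bit length. Every integer occurring in a run of cost
  \<open>t\<close> has at most \<open>t\<close> bits (unless it is still on the input tape), and at most \<open>t\<close> memory cells
  are touched, so that polynomial running time in this model is the same as polynomial running
  time on Turing machines.
\<close>

text \<open>Number of binary digits of the absolute value, plus one bit for the sign.\<close>

definition bit_size :: "int \<Rightarrow> nat" where
  "bit_size z = 1 + floorlog 2 (nat \<bar>z\<bar>)"

text \<open>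
  The memory consists of arrays of unbounded integers indexed by integers. A program mentions only
  finitely many of them by name.
\<close>

type_synonym mem = "string \<Rightarrow> int \<Rightarrow> int"

datatype aexp =
    Const int
  | Cell string aexp
  | Plus aexp aexp
  | Minus aexp aexp
  | Times aexp aexp
  | Quot aexp aexp

datatype bexp =
    Less aexp aexp
  | Not bexp
  | And bexp bexp

datatype com =
    Skip
  | Assign string aexp aexp
  | Read string aexp
  | Write aexp
  | Seq com com
  | Cond bexp com com
  | While bexp com

fun aval :: "aexp \<Rightarrow> mem \<Rightarrow> int" where
  "aval (Const z) m = z"
| "aval (Cell v e) m = m v (aval e m)"
| "aval (Plus e1 e2) m = aval e1 m + aval e2 m"
| "aval (Minus e1 e2) m = aval e1 m - aval e2 m"
| "aval (Times e1 e2) m = aval e1 m * aval e2 m"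
| "aval (Quot e1 e2) m = aval e1 m div aval e2 m"

fun bval :: "bexp \<Rightarrow> mem \<Rightarrow> bool" where
  "bval (Less e1 e2) m \<longleftrightarrow> aval e1 m < aval e2 m"
| "bval (Not b) m \<longleftrightarrow> \<not> bval b m"
| "bval (And b1 b2) m \<longleftrightarrow> bval b1 m \<and> bval b2 m"

text \<open>
  The cost of an expression is the total bit size of the values of all its subexpressions; in
  particular it includes the size of the addresses used and of the final value.
\<close>

fun acost :: "aexp \<Rightarrow> mem \<Rightarrow> nat" where
  "acost (Const z) m = bit_size z"
| "acost (Cell v e) m = acost e m + bit_size (m v (aval e m))"
| "acost (Plus e1 e2) m = acost e1 m + acost e2 m + bit_size (aval e1 m + aval e2 m)"
| "acost (Minus e1 e2) m = acost e1 m + acost e2 m + bit_size (aval e1 m - aval e2 m)"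
| "acost (Times e1 e2) m = acost e1 m + acost e2 m + bit_size (aval e1 m * aval e2 m)"
| "acost (Quot e1 e2) m = acost e1 m + acost e2 m + bit_size (aval e1 m div aval e2 m)"

fun bcost :: "bexp \<Rightarrow> mem \<Rightarrow> nat" where
  "bcost (Less e1 e2) m = 1 + acost e1 m + acost e2 m"
| "bcost (Not b) m = 1 + bcost b m"
| "bcost (And b1 b2) m = 1 + bcost b1 m + bcost b2 m"

text \<open>A configuration consists of the memory, the unread input, and the output written so far.\<close>

type_synonym config = "mem \<times> int list \<times> int list"

definition update :: "mem \<Rightarrow> string \<Rightarrow> int \<Rightarrow> int \<Rightarrow> mem" where
  "update m v i z = m(v := (m v)(i := z))"

text \<open>
  \<open>exec P \<sigma> t \<tau>\<close>: program \<open>P\<close> started in \<open>\<sigma>\<close> terminates in \<open>\<tau>\<close>, at total cost \<open>t\<close>. Reading beyond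
  the end of the input yields 0.
\<close>

inductive exec :: "com \<Rightarrow> config \<Rightarrow> nat \<Rightarrow> config \<Rightarrow> bool" where
  Skip: "exec Skip \<sigma> 1 \<sigma>"
| Assign: "exec (Assign v e1 e2) (m, xs, ys) (1 + acost e1 m + acost e2 m)
             (update m v (aval e1 m) (aval e2 m), xs, ys)"
| Read: "exec (Read v e) (m, x # xs, ys) (1 + acost e m + bit_size x)
             (update m v (aval e m) x, xs, ys)"
| ReadEnd: "exec (Read v e) (m, [], ys) (1 + acost e m + bit_size 0)
             (update m v (aval e m) 0, [], ys)"
| Write: "exec (Write e) (m, xs, ys) (1 + acost e m) (m, xs, ys @ [aval e m])"
| Seq: "exec P \<sigma> t \<rho> \<Longrightarrow> exec Q \<rho> u \<tau> \<Longrightarrow> exec (Seq P Q) \<sigma> (t + u) \<tau>"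
| CondTrue: "bval b (fst \<sigma>) \<Longrightarrow> exec P \<sigma> t \<tau> \<Longrightarrow>
             exec (Cond b P Q) \<sigma> (1 + bcost b (fst \<sigma>) + t) \<tau>"
| CondFalse: "\<not> bval b (fst \<sigma>) \<Longrightarrow> exec Q \<sigma> t \<tau> \<Longrightarrow>
             exec (Cond b P Q) \<sigma> (1 + bcost b (fst \<sigma>) + t) \<tau>"
| WhileFalse: "\<not> bval b (fst \<sigma>) \<Longrightarrow> exec (While b P) \<sigma> (1 + bcost b (fst \<sigma>)) \<sigma>"
| WhileTrue: "bval b (fst \<sigma>) \<Longrightarrow> exec P \<sigma> t \<rho> \<Longrightarrow> exec (While b P) \<rho> u \<tau> \<Longrightarrow>
             exec (While b P) \<sigma> (1 + bcost b (fst \<sigma>) + t + u) \<tau>"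

inductive_cases exec_SkipE: "exec Skip \<sigma> t \<tau>"
inductive_cases exec_AssignE: "exec (Assign v e1 e2) \<sigma> t \<tau>"
inductive_cases exec_ReadE: "exec (Read v e) \<sigma> t \<tau>"
inductive_cases exec_WriteE: "exec (Write e) \<sigma> t \<tau>"
inductive_cases exec_SeqE: "exec (Seq P Q) \<sigma> t \<tau>"
inductive_cases exec_CondE: "exec (Cond b P Q) \<sigma> t \<tau>"
inductive_cases exec_WhileE: "exec (While b P) \<sigma> t \<tau>"

lemma exec_deterministic:
  "exec P \<sigma> t \<tau> \<Longrightarrow> exec P \<sigma> t' \<tau>' \<Longrightarrow> t = t' \<and> \<tau> = \<tau>'"
proof (induction arbitrary: t' \<tau>' rule: exec.induct)
  case (Seq P \<sigma> t \<rho> Q u \<tau>)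
  from Seq.prems obtain t1 \<rho>1 u1 where
    "exec P \<sigma> t1 \<rho>1" "exec Q \<rho>1 u1 \<tau>'" "t' = t1 + u1"
    by (rule exec_SeqE)
  with Seq.IH show ?case by blast
next
  case (CondTrue b \<sigma> P t \<tau> Q)
  from CondTrue.prems show ?case
  proof (rule exec_CondE)
    fix t1
    assume "exec P \<sigma> t1 \<tau>'" "t' = Suc (bcost b (fst \<sigma>) + t1)"
    with CondTrue.IH show ?thesis by fastforce
  qed (use CondTrue.hyps in simp_all)
next
  case (CondFalse b \<sigma> Q t \<tau> P)
  from CondFalse.prems show ?case
  proof (rule exec_CondE)
    fix t1
    assume "exec Q \<sigma> t1 \<tau>'" "t' = Suc (bcost b (fst \<sigma>) + t1)"
    with CondFalse.IH show ?thesis by fastforce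
  qed (use CondFalse.hyps in simp_all)
next
  case (WhileFalse b \<sigma> P)
  from WhileFalse.prems show ?case
    by (rule exec_WhileE) (use WhileFalse.hyps in simp_all)
next
  case (WhileTrue b \<sigma> P t \<rho> u \<tau>)
  from WhileTrue.prems show ?case
  proof (rule exec_WhileE)
    fix t1 \<rho>1 u1
    assume "exec P \<sigma> t1 \<rho>1" "exec (While b P) \<rho>1 u1 \<tau>'"
      "t' = Suc (bcost b (fst \<sigma>) + t1 + u1)"
    with WhileTrue.IH show ?thesis by fastforce
  qed (use WhileTrue.hyps in simp_all)
next
  case (Skip \<sigma>)
  then show ?case by (rule exec_SkipE) simp
next
  case (Assign v e1 e2 m xs ys)
  then show ?case by (rule exec_AssignE) simp
next
  case (Read v e m x xs ys)
  then show ?case by (rule exec_ReadE) simp_all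
next
  case (ReadEnd v e m ys)
  then show ?case by (rule exec_ReadE) simp_all
next
  case (Write e m xs ys)
  then show ?case by (rule exec_WriteE) simp
qed

definition runs :: "com \<Rightarrow> int list \<Rightarrow> nat \<Rightarrow> int list \<Rightarrow> bool" where
  "runs P xs t ys \<longleftrightarrow> (\<exists>m xs'. exec P (\<lambda>_ _. 0, xs, []) t (m, xs', ys))"

section \<open>Generalized n-fold integer programming\<close>

text \<open>
  The right-hand sides are \<open>b 0, \<dots>, b n\<close>, the blocks of the objective are \<open>c 1, \<dots>, c n\<close>, and the
  blocks of a solution are \<open>x 1, \<dots>, x n\<close>; values at other indices are irrelevant.
\<close>

definition nfold_instance ::
  "nat \<Rightarrow> nat \<Rightarrow> nat \<Rightarrow> nat \<Rightarrow> (nat \<Rightarrow> int vec) \<Rightarrow> (nat \<Rightarrow> int vec) \<Rightarrow> bool" where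
  "nfold_instance r s q n b c \<longleftrightarrow> n \<ge> 1 \<and> b 0 \<in> carrier_vec s \<and>
     (\<forall>k\<in>{1..n}. b k \<in> carrier_vec r \<and> c k \<in> carrier_vec q)"

definition nfold_feasible ::
  "int mat \<Rightarrow> int mat \<Rightarrow> nat \<Rightarrow> (nat \<Rightarrow> int vec) \<Rightarrow> (nat \<Rightarrow> int vec) set" where
  "nfold_feasible A B n b = {x.
     finsum_vec TYPE(int) (dim_row B) (\<lambda>k. B *\<^sub>v x k) {1..n} = b 0 \<and>
     (\<forall>k\<in>{1..n}. A *\<^sub>v x k = b k \<and> x k \<in> carrier_vec (dim_col A) \<and>
       (\<forall>j<dim_col A. 0 \<le> x k $ j))}"

definition nfold_objective ::
  "nat \<Rightarrow> (nat \<Rightarrow> int vec) \<Rightarrow> (nat \<Rightarrow> int vec) \<Rightarrow> int" where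
  "nfold_objective n c x = (\<Sum>k=1..n. c k \<bullet> x k)"

datatype outcome = Infeasible | Unbounded | Optimal "nat \<Rightarrow> int vec"

fun correct_outcome ::
  "int mat \<Rightarrow> int mat \<Rightarrow> nat \<Rightarrow> (nat \<Rightarrow> int vec) \<Rightarrow> (nat \<Rightarrow> int vec) \<Rightarrow> outcome \<Rightarrow> bool" where
  "correct_outcome A B n b c Infeasible \<longleftrightarrow> nfold_feasible A B n b = {}"
| "correct_outcome A B n b c Unbounded \<longleftrightarrow>
     (\<forall>M. \<exists>x\<in>nfold_feasible A B n b. nfold_objective n c x < M)"
| "correct_outcome A B n b c (Optimal x) \<longleftrightarrow> x \<in> nfold_feasible A B n b \<and>
     (\<forall>y\<in>nfold_feasible A B n b. nfold_objective n c x \<le> nfold_objective n c y)"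

text \<open>
  Encodings: an instance is presented on the input tape as \<open>n\<close> followed by the entries of
  \<open>b 0, \<dots>, b n, c 1, \<dots>, c n\<close>. The output is a tag, followed in the optimal case by the
  entries of \<open>x 1, \<dots>, x n\<close>.
\<close>

definition blocks :: "(nat \<Rightarrow> int vec) \<Rightarrow> nat list \<Rightarrow> int list" where
  "blocks v ks = concat (map (\<lambda>k. list_of_vec (v k)) ks)"

definition encode_instance :: "nat \<Rightarrow> (nat \<Rightarrow> int vec) \<Rightarrow> (nat \<Rightarrow> int vec) \<Rightarrow> int list" where
  "encode_instance n b c = int n # blocks b [0..<Suc n] @ blocks c [1..<Suc n]"

fun encode_outcome :: "nat \<Rightarrow> outcome \<Rightarrow> int list" where
  "encode_outcome n Infeasible = [0]"
| "encode_outcome n Unbounded = [1]"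
| "encode_outcome n (Optimal x) = 2 # blocks x [1..<Suc n]"

text \<open>The number \<open>n\<close> of blocks enters the input size by its value, not by its bit size.\<close>

definition input_size :: "nat \<Rightarrow> (nat \<Rightarrow> int vec) \<Rightarrow> (nat \<Rightarrow> int vec) \<Rightarrow> nat" where
  "input_size n b c = n +
     sum_list (map bit_size (blocks b [0..<Suc n])) +
     sum_list (map bit_size (blocks c [1..<Suc n]))"

end

theory Submission
  imports Defs
begin

text \<open>
  Slack columns make a starting point available, and a large penalty on the slack, which outweighs
  the objective on every bounded kernel element, reduces feasibility and optimization to a single
  optimization problem of the same shape.

  By Dickson's lemma every element of the kernel of an n-fold system is a conformal sum of kernel
  elements whose 1-norm is bounded independently of n. Suppose that \<open>x\<close> is optimal among the
  feasible points congruent to it modulo \<open>2 \<lambda>\<close>. Among the points congruent to \<open>x\<close> modulo \<open>\<lambda>\<close>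
  there is then no need to use more than \<open>N = n Q\<close> such pieces, scaled by \<open>\<lambda>\<close>: of more than \<open>N\<close>
  pieces some nonempty subset has an even sum, by the pigeonhole principle applied to the parities
  of the subset sums, and this sum can be removed without loss. Hence an optimum modulo \<open>\<lambda>\<close> lies
  within \<open>\<lambda>\<close> times a box of size linear in n, and a dynamic program over the \<open>N\<close> coordinates,
  whose state consists of the partial row sums, finds it. Starting with a scale above all entries
  of the starting point and halving it down to 1 takes polynomially many rounds. Unboundedness
  amounts to an improving kernel element in the nonnegative orthant, which the same dynamic program
  detects at the origin.
\<close>

section \<open>Conformal decompositions of n-fold kernel elements\<close>

text \<open>The coordinates of a solution may be exponentially large in the input size, so they
  cannot be enumerated. What can be enumerated is the step \<open>g\<close> of a single round: its
  entries are at most \<open>K\<close>, which is linear in n and does not involve the scale. The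
  same \<open>K\<close> has to serve the unboundedness test and the penalty argument, where single
  pieces of norm at most \<open>G\<close> must fit into the box; this is the origin of
  \<open>kappa = G * (int Q + 1) + 1\<close> and \<open>K = kappa * int n\<close>. The constant
  \<open>G\<close> is obtained from Dickson's lemma without being computed; as it depends on the
  fixed matrices only, it may be a literal of the program text. The number m of rows is fixed as
  well, so all partial row sums can be packed into one integer whose absolute value is below a fixed
  power of a polynomial in n. The table of the dynamic program therefore has polynomial size,
  although the objective values stored in it may be exponentially large. Accordingly, all estimates
  fall into two classes: polynomial ones for step counts and exponential ones for values, whose bit
  length is again polynomial.\<close>

lemma dickson:
  fixes S :: "('a \<Rightarrow> nat) set"
  assumes "finite J"
  shows "\<exists>T\<subseteq>S. finite T \<and> (\<forall>y\<in>S. \<exists>t\<in>T. \<forall>j\<in>J. t j \<le> y j)"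
  using assms
proof (induction J arbitrary: S)
  case empty
  show ?case
  proof (cases "S = {}")
    case False
    then obtain y where "y \<in> S" by blast
    then show ?thesis by (intro exI[of _ "{y}"]) auto
  qed auto
next
  case (insert a J)
  obtain T0 where T0: "T0 \<subseteq> S" "finite T0" "\<forall>y\<in>S. \<exists>t\<in>T0. \<forall>j\<in>J. t j \<le> y j"
    using insert.IH[of S] by blast
  \<comment> \<open>\<open>T0\<close> dominates on \<open>J\<close> alone. Points with
    \<open>y a\<close> at least \<open>m\<close> are dominated at \<open>a\<close> as well, since
    \<open>m\<close> bounds every \<open>t a\<close>; the others lie in the finitely many slices
    \<open>y a = c\<close> with \<open>c < m\<close>, each of which has its own finite dominating
    set.\<close>
  define m where "m = (\<Sum>t\<in>T0. t a)"
  have "\<forall>c. \<exists>T. T \<subseteq> {y\<in>S. y a = c} \<and> finite T \<and>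
      (\<forall>y\<in>{y\<in>S. y a = c}. \<exists>t\<in>T. \<forall>j\<in>J. t j \<le> y j)"
    by (intro allI) (rule insert.IH)
  from choice[OF this] obtain T where T':
    "\<forall>c. T c \<subseteq> {y\<in>S. y a = c} \<and> finite (T c) \<and>
      (\<forall>y\<in>{y\<in>S. y a = c}. \<exists>t\<in>T c. \<forall>j\<in>J. t j \<le> y j)" by (rule exE)
  have T: "T c \<subseteq> {y\<in>S. y a = c}" "finite (T c)"
    "\<forall>y\<in>{y\<in>S. y a = c}. \<exists>t\<in>T c. \<forall>j\<in>J. t j \<le> y j" for c
    using T'[rule_format, of c] by simp_all
  show ?case
  proof (intro exI[of _ "T0 \<union> (\<Union>c<m. T c)"] conjI ballI)
    show "T0 \<union> (\<Union>c<m. T c) \<subseteq> S" using T0 T(1) by blast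
    show "finite (T0 \<union> (\<Union>c<m. T c))" using T0 T(2) by simp
    fix y assume y: "y \<in> S"
    show "\<exists>t\<in>T0 \<union> (\<Union>c<m. T c). \<forall>j\<in>insert a J. t j \<le> y j"
    proof (cases "y a < m")
      case True
      from T(3)[of "y a"] y obtain t where t: "t \<in> T (y a)" "\<forall>j\<in>J. t j \<le> y j" by blast
      moreover have "t a = y a" using T(1)[of "y a"] t by auto
      ultimately show ?thesis using True by (intro bexI[of _ t]) auto
    next
      case False
      from T0(3) y obtain t where t: "t \<in> T0" "\<forall>j\<in>J. t j \<le> y j" by blast
      have "t a \<le> m" unfolding m_def using t T0(2) by (intro member_le_sum) auto
      then show ?thesis using t False by (intro bexI[of _ t]) auto
    qed
  qed
qed

text \<open>The single equation says that each \<open>h j\<close> lies between 0 and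
  \<open>g j\<close>: it has the same sign and no larger absolute value.\<close>

definition conformal :: "'a set \<Rightarrow> ('a \<Rightarrow> int) \<Rightarrow> ('a \<Rightarrow> int) \<Rightarrow> bool" where
  "conformal J h g \<longleftrightarrow> (\<forall>j\<in>J. \<bar>g j\<bar> = \<bar>h j\<bar> + \<bar>g j - h j\<bar>)"

text \<open>Splitting each integer into its positive and negative part reduces conformality to the
  componentwise order of natural numbers.\<close>

lemma dickson_conformal:
  fixes S :: "('a \<Rightarrow> int) set"
  assumes "finite J"
  shows "\<exists>T\<subseteq>S. finite T \<and> (\<forall>y\<in>S. \<exists>t\<in>T. conformal J t y)"
proof -
  define \<phi> :: "('a \<Rightarrow> int) \<Rightarrow> 'a \<times> bool \<Rightarrow> nat"
    where "\<phi> y = (\<lambda>(j, p). if p then nat (y j) else nat (- y j))" for y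
  have "finite (J \<times> (UNIV :: bool set))" using assms by simp
  from dickson[OF this, of "\<phi> ` S"] obtain T where T: "T \<subseteq> \<phi> ` S" "finite T"
    "\<forall>y\<in>\<phi> ` S. \<exists>t\<in>T. \<forall>j\<in>J \<times> UNIV. t j \<le> y j" by blast
  then obtain T' where T': "T' \<subseteq> S" "finite T'" "T = \<phi> ` T'"
    by (meson finite_subset_image)
  have "conformal J t y" if "\<forall>j\<in>J \<times> UNIV. \<phi> t j \<le> \<phi> y j" for t y
    unfolding conformal_def
  proof
    fix j assume "j \<in> J"
    with that have "\<phi> t (j, True) \<le> \<phi> y (j, True)" "\<phi> t (j, False) \<le> \<phi> y (j, False)" by blast+
    then show "\<bar>y j\<bar> = \<bar>t j\<bar> + \<bar>y j - t j\<bar>" unfolding \<phi>_def by auto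
  qed
  then have "\<exists>t\<in>T'. conformal J t y" if "y \<in> S" for y using T(3) that T'(3) by blast
  then show ?thesis using T' by blast
qed

definition sols :: "'i set \<Rightarrow> 'a set \<Rightarrow> ('i \<Rightarrow> 'a \<Rightarrow> int) \<Rightarrow> ('a \<Rightarrow> int) set" where
  "sols I J D = {y. \<forall>i\<in>I. (\<Sum>j\<in>J. D i j * y j) = 0}"

lemma sols_diff: "y \<in> sols I J D \<Longrightarrow> h \<in> sols I J D \<Longrightarrow> (\<lambda>j. y j - h j) \<in> sols I J D"
  unfolding sols_def by (auto simp: right_diff_distrib sum_subtractf)

text \<open>Dickson's lemma provides finitely many nonzero solutions such that every nonzero
  solution has one of them conformally below it. Subtracting it lowers the 1-norm, so the process
  ends. The equation for absolute values records that the summands never cancel.\<close>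

lemma conformal_generators:
  assumes "finite J"
  obtains T where "finite T" "T \<subseteq> sols I J D" "\<And>t. t \<in> T \<Longrightarrow> \<exists>j\<in>J. t j \<noteq> 0"
    "\<And>y. y \<in> sols I J D \<Longrightarrow> \<exists>\<mu>::('a \<Rightarrow> int) \<Rightarrow> nat.
       \<forall>j\<in>J. y j = (\<Sum>t\<in>T. int (\<mu> t) * t j) \<and> \<bar>y j\<bar> = (\<Sum>t\<in>T. int (\<mu> t) * \<bar>t j\<bar>)"
proof -
  obtain T where T: "T \<subseteq> {y \<in> sols I J D. \<exists>j\<in>J. y j \<noteq> 0}" "finite T"
    "\<forall>y\<in>{y \<in> sols I J D. \<exists>j\<in>J. y j \<noteq> 0}. \<exists>t\<in>T. conformal J t y"
    using dickson_conformal[OF assms, of "{y \<in> sols I J D. \<exists>j\<in>J. y j \<noteq> 0}"] by blast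
  have gen: "\<exists>\<mu>::('a \<Rightarrow> int) \<Rightarrow> nat.
       \<forall>j\<in>J. y j = (\<Sum>t\<in>T. int (\<mu> t) * t j) \<and> \<bar>y j\<bar> = (\<Sum>t\<in>T. int (\<mu> t) * \<bar>t j\<bar>)"
    if "y \<in> sols I J D" for y
    using that
  proof (induction "nat (\<Sum>j\<in>J. \<bar>y j\<bar>)" arbitrary: y rule: less_induct)
    case less
    show ?case
    proof (cases "\<exists>j\<in>J. y j \<noteq> 0")
      case False
      then show ?thesis by (intro exI[of _ "\<lambda>_. 0"]) auto
    next
      case True
      with T(3) less.prems obtain t where t: "t \<in> T" "conformal J t y" by blast
      then have c: "\<forall>j\<in>J. \<bar>y j\<bar> = \<bar>t j\<bar> + \<bar>y j - t j\<bar>" by (simp add: conformal_def)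
      from t T(1) have ts: "t \<in> sols I J D" and "\<exists>j\<in>J. t j \<noteq> 0" by auto
      then obtain j where "j \<in> J" "t j \<noteq> 0" by blast
      then have "\<bar>t j\<bar> \<le> (\<Sum>j\<in>J. \<bar>t j\<bar>)" using assms by (intro member_le_sum) auto
      with \<open>t j \<noteq> 0\<close> have pos: "(\<Sum>j\<in>J. \<bar>t j\<bar>) > 0" by linarith
      have "(\<Sum>j\<in>J. \<bar>y j\<bar>) = (\<Sum>j\<in>J. \<bar>t j\<bar>) + (\<Sum>j\<in>J. \<bar>y j - t j\<bar>)"
        using c by (simp add: sum.distrib)
      moreover have "(\<Sum>j\<in>J. \<bar>y j - t j\<bar>) \<ge> 0" by (simp add: sum_nonneg)
      ultimately have "nat (\<Sum>j\<in>J. \<bar>y j - t j\<bar>) < nat (\<Sum>j\<in>J. \<bar>y j\<bar>)" using pos by linarith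
      from less.hyps[OF this sols_diff[OF less.prems ts]] obtain \<mu> :: "('a \<Rightarrow> int) \<Rightarrow> nat" where
        \<mu>: "\<forall>j\<in>J. y j - t j = (\<Sum>t\<in>T. int (\<mu> t) * t j) \<and>
          \<bar>y j - t j\<bar> = (\<Sum>t\<in>T. int (\<mu> t) * \<bar>t j\<bar>)" by blast
      define \<mu>' where "\<mu>' = \<mu>(t := \<mu> t + 1)"
      have *: "(\<Sum>u\<in>T. int (\<mu>' u) * f u) = (\<Sum>u\<in>T. int (\<mu> u) * f u) + f t" for f
        unfolding \<mu>'_def using T(2) t(1) by (simp add: sum.remove algebra_simps)
      show ?thesis
      proof (intro exI[of _ \<mu>'] ballI)
        fix j assume "j \<in> J"
        from bspec[OF \<mu> this] bspec[OF c this]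
        show "y j = (\<Sum>t\<in>T. int (\<mu>' t) * t j) \<and> \<bar>y j\<bar> = (\<Sum>t\<in>T. int (\<mu>' t) * \<bar>t j\<bar>)"
          unfolding * by linarith
      qed
    qed
  qed
  show ?thesis
  proof (rule that[OF T(2) _ _ gen])
    show "T \<subseteq> sols I J D" using T(1) by blast
    show "\<exists>j\<in>J. t j \<noteq> 0" if "t \<in> T" for t using T(1) that by blast
  qed
qed

text \<open>Greedy choice: the last index takes as much of \<open>h\<close> as it can.\<close>

lemma split_sum:
  fixes \<mu> :: "nat \<Rightarrow> nat"
  assumes "h \<le> (\<Sum>k<n. \<mu> k)"
  shows "\<exists>\<nu>. (\<forall>k<n. \<nu> k \<le> \<mu> k) \<and> (\<Sum>k<n. \<nu> k) = h"
  using assms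
proof (induction n arbitrary: h)
  case (Suc n)
  have "h - min h (\<mu> n) \<le> (\<Sum>k<n. \<mu> k)" using Suc.prems by simp
  from Suc.IH[OF this] obtain \<nu> where "\<forall>k<n. \<nu> k \<le> \<mu> k" "(\<Sum>k<n. \<nu> k) = h - min h (\<mu> n)" by blast
  then show ?case by (intro exI[of _ "\<nu>(n := min h (\<mu> n))"]) (auto simp: less_Suc_eq)
qed simp

lemma split_multiplicities:
  fixes \<mu> :: "nat \<Rightarrow> 'p \<Rightarrow> nat"
  assumes "\<forall>p\<in>T. h p \<le> (\<Sum>k<n. \<mu> k p)"
  shows "\<exists>\<nu>. (\<forall>k<n. \<forall>p\<in>T. \<nu> k p \<le> \<mu> k p) \<and> (\<forall>p\<in>T. (\<Sum>k<n. \<nu> k p) = h p)"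
proof -
  have "\<forall>p. \<exists>\<nu>. p \<in> T \<longrightarrow> (\<forall>k<n. \<nu> k \<le> \<mu> k p) \<and> (\<Sum>k<n. \<nu> k) = h p"
    using split_sum assms by metis
  then obtain \<nu> where "\<And>p. p \<in> T \<longrightarrow> (\<forall>k<n. \<nu> p k \<le> \<mu> k p) \<and> (\<Sum>k<n. \<nu> p k) = h p" by metis
  then show ?thesis by (intro exI[of _ "\<lambda>k p. \<nu> p k"]) auto
qed

text \<open>Finitely many nonzero solutions over the naturals lie below all others, and the sum of
  all their sizes serves as \<open>G\<close>. It depends on the equations only.\<close>

lemma hilbert_bound:
  assumes "finite J"
  shows "\<exists>G. \<forall>y::'a \<Rightarrow> nat. (\<lambda>j. int (y j)) \<in> sols I J D \<longrightarrow> (\<exists>j\<in>J. y j \<noteq> 0) \<longrightarrow>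
    (\<exists>h. (\<lambda>j. int (h j)) \<in> sols I J D \<and> (\<exists>j\<in>J. h j \<noteq> 0) \<and> (\<forall>j\<in>J. h j \<le> y j) \<and> (\<Sum>j\<in>J. h j) \<le> G)"
proof -
  obtain T where T: "T \<subseteq> {y::'a \<Rightarrow> nat. (\<lambda>j. int (y j)) \<in> sols I J D \<and> (\<exists>j\<in>J. y j \<noteq> 0)}" "finite T"
    "\<forall>y\<in>{y. (\<lambda>j. int (y j)) \<in> sols I J D \<and> (\<exists>j\<in>J. y j \<noteq> 0)}. \<exists>t\<in>T. \<forall>j\<in>J. t j \<le> y j"
    using dickson[OF assms, of "{y. (\<lambda>j. int (y j)) \<in> sols I J D \<and> (\<exists>j\<in>J. y j \<noteq> 0)}"] by blast
  have "(\<Sum>j\<in>J. t j) \<le> (\<Sum>t\<in>T. \<Sum>j\<in>J. t j)" if "t \<in> T" for t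
    using that T(2) by (intro member_le_sum) auto
  note le = this
  show ?thesis
  proof (rule exI[of _ "\<Sum>t\<in>T. \<Sum>j\<in>J. t j"], intro allI impI)
    fix y :: "'a \<Rightarrow> nat"
    assume "(\<lambda>j. int (y j)) \<in> sols I J D" "\<exists>j\<in>J. y j \<noteq> 0"
    then have "y \<in> {y. (\<lambda>j. int (y j)) \<in> sols I J D \<and> (\<exists>j\<in>J. y j \<noteq> 0)}" by simp
    from bspec[OF T(3) this] obtain t where t: "t \<in> T" "\<forall>j\<in>J. t j \<le> y j" by (rule bexE)
    from subsetD[OF T(1) t(1)] have "(\<lambda>j. int (t j)) \<in> sols I J D" "\<exists>j\<in>J. t j \<noteq> 0" by simp_all
    with t le[OF t(1)] show "\<exists>h. (\<lambda>j. int (h j)) \<in> sols I J D \<and> (\<exists>j\<in>J. h j \<noteq> 0) \<and>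
        (\<forall>j\<in>J. h j \<le> y j) \<and> (\<Sum>j\<in>J. h j) \<le> (\<Sum>t\<in>T. \<Sum>j\<in>J. t j)" by (intro exI[of _ t]) simp
  qed
qed

section \<open>Bounded conformal pieces of n-fold kernel elements\<close>

locale nfold_system =
  fixes d :: "nat \<Rightarrow> nat \<Rightarrow> int" and s m Q :: nat
  assumes s_le_m: "s \<le> m"
begin

text \<open>Rows below \<open>s\<close> link the blocks; the rows from \<open>s\<close> to \<open>m\<close> apply to each block.\<close>

definition ker :: "nat \<Rightarrow> (nat \<Rightarrow> nat \<Rightarrow> int) \<Rightarrow> bool" where
  "ker n g \<longleftrightarrow> (\<forall>k<n. \<forall>i\<in>{s..<m}. (\<Sum>j<Q. d i j * g k j) = 0) \<and>
     (\<forall>i<s. (\<Sum>k<n. \<Sum>j<Q. d i j * g k j) = 0)"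

definition nrm :: "nat \<Rightarrow> (nat \<Rightarrow> nat \<Rightarrow> int) \<Rightarrow> int" where
  "nrm n g = (\<Sum>k<n. \<Sum>j<Q. \<bar>g k j\<bar>)"

definition conf :: "nat \<Rightarrow> (nat \<Rightarrow> nat \<Rightarrow> int) \<Rightarrow> (nat \<Rightarrow> nat \<Rightarrow> int) \<Rightarrow> bool" where
  "conf n h g \<longleftrightarrow> (\<forall>k<n. \<forall>j<Q. \<bar>g k j\<bar> = \<bar>h k j\<bar> + \<bar>g k j - h k j\<bar>)"

text \<open>The blocks split conformally into finitely many types of pieces from the kernel of the block
  rows. The numbers of pieces of each type solve the linking equations over the naturals, and a
  minimal such solution below them, which is bounded, can be distributed over the blocks.\<close>

lemma graver_bound:
  "\<exists>G\<ge>0. \<forall>n g. ker n g \<longrightarrow> nrm n g > 0 \<longrightarrow>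
     (\<exists>h. ker n h \<and> conf n h g \<and> nrm n h > 0 \<and> nrm n h \<le> G)"
proof -
  obtain T where T: "finite T" "T \<subseteq> sols {s..<m} {..<Q} d" "\<And>t. t \<in> T \<Longrightarrow> \<exists>j\<in>{..<Q}. t j \<noteq> 0"
    "\<And>y. y \<in> sols {s..<m} {..<Q} d \<Longrightarrow> \<exists>\<mu>::(nat \<Rightarrow> int) \<Rightarrow> nat.
       \<forall>j\<in>{..<Q}. y j = (\<Sum>t\<in>T. int (\<mu> t) * t j) \<and> \<bar>y j\<bar> = (\<Sum>t\<in>T. int (\<mu> t) * \<bar>t j\<bar>)"
    by (rule conformal_generators[of "{..<Q}" "{s..<m}" d]) auto
  define D where "D i t = (\<Sum>j<Q. d i j * t j)" for i and t :: "nat \<Rightarrow> int"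
  obtain G' where G': "\<forall>y::(nat \<Rightarrow> int) \<Rightarrow> nat. (\<lambda>j. int (y j)) \<in> sols {..<s} T D \<longrightarrow> (\<exists>j\<in>T. y j \<noteq> 0) \<longrightarrow>
    (\<exists>h. (\<lambda>j. int (h j)) \<in> sols {..<s} T D \<and> (\<exists>j\<in>T. h j \<noteq> 0) \<and> (\<forall>j\<in>T. h j \<le> y j) \<and> (\<Sum>j\<in>T. h j) \<le> G')"
    using hilbert_bound[OF T(1), of "{..<s}" D] by blast
  define b where "b = (\<Sum>t\<in>T. \<Sum>j<Q. \<bar>t j\<bar>)"
  have b: "(\<Sum>j<Q. \<bar>t j\<bar>) \<le> b" if "t \<in> T" for t
    unfolding b_def using that T(1) by (intro member_le_sum) (auto intro: sum_nonneg)
  have b0: "b \<ge> 0" unfolding b_def by (auto intro!: sum_nonneg)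
  have "\<exists>h. ker n h \<and> conf n h g \<and> nrm n h > 0 \<and> nrm n h \<le> int G' * b"
    if g: "ker n g" "nrm n g > 0" for n g
  proof -
    have "\<forall>k. \<exists>\<mu>::(nat \<Rightarrow> int) \<Rightarrow> nat. k < n \<longrightarrow> (\<forall>j<Q. g k j = (\<Sum>t\<in>T. int (\<mu> t) * t j) \<and>
        \<bar>g k j\<bar> = (\<Sum>t\<in>T. int (\<mu> t) * \<bar>t j\<bar>))"
    proof
      fix k
      show "\<exists>\<mu>::(nat \<Rightarrow> int) \<Rightarrow> nat. k < n \<longrightarrow> (\<forall>j<Q. g k j = (\<Sum>t\<in>T. int (\<mu> t) * t j) \<and>
        \<bar>g k j\<bar> = (\<Sum>t\<in>T. int (\<mu> t) * \<bar>t j\<bar>))"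
      proof (cases "k < n")
        case True
        then have "g k \<in> sols {s..<m} {..<Q} d" using g by (auto simp: sols_def ker_def)
        from T(4)[OF this] show ?thesis by auto
      qed auto
    qed
    from choice[OF this] obtain \<mu> :: "nat \<Rightarrow> (nat \<Rightarrow> int) \<Rightarrow> nat" where \<mu>:
      "\<And>k j. k < n \<Longrightarrow> j < Q \<Longrightarrow> g k j = (\<Sum>t\<in>T. int (\<mu> k t) * t j)"
      "\<And>k j. k < n \<Longrightarrow> j < Q \<Longrightarrow> \<bar>g k j\<bar> = (\<Sum>t\<in>T. int (\<mu> k t) * \<bar>t j\<bar>)"
      by blast
    have lin: "(\<Sum>j<Q. d i j * (\<Sum>t\<in>T. int (\<nu> t) * t j)) = (\<Sum>t\<in>T. D i t * int (\<nu> t))"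
      for i and \<nu> :: "(nat \<Rightarrow> int) \<Rightarrow> nat"
      unfolding D_def sum_distrib_left sum_distrib_right
      by (subst sum.swap) (simp add: algebra_simps)
    have linlink: "(\<Sum>k<n. \<Sum>j<Q. d i j * (\<Sum>t\<in>T. int (\<nu> k t) * t j)) =
        (\<Sum>t\<in>T. D i t * int (\<Sum>k<n. \<nu> k t))" for i and \<nu> :: "nat \<Rightarrow> (nat \<Rightarrow> int) \<Rightarrow> nat"
    proof -
      have "(\<Sum>k<n. \<Sum>j<Q. d i j * (\<Sum>t\<in>T. int (\<nu> k t) * t j)) = (\<Sum>k<n. \<Sum>t\<in>T. D i t * int (\<nu> k t))"
        by (simp only: lin)
      also have "\<dots> = (\<Sum>t\<in>T. \<Sum>k<n. D i t * int (\<nu> k t))" by (rule sum.swap)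
      finally show ?thesis by (simp add: sum_distrib_left)
    qed
    \<comment> \<open>\<open>y t\<close> counts the pieces of type \<open>t\<close> in all blocks
      together. In these aggregated unknowns the linking equations do not mention \<open>n\<close>,
      which makes the bound \<open>G'\<close> on the number of pieces in \<open>h\<close> the same
      for all \<open>n\<close>.\<close>
    define y where "y t = (\<Sum>k<n. \<mu> k t)" for t
    have "(\<lambda>t. int (y t)) \<in> sols {..<s} T D"
    proof -
      have "(\<Sum>t\<in>T. D i t * int (y t)) = (\<Sum>k<n. \<Sum>j<Q. d i j * g k j)" for i
        unfolding y_def linlink[symmetric] using \<mu>(1) by (intro sum.cong) auto
      then show ?thesis using g by (auto simp: sols_def ker_def)
    qed
    moreover have "\<exists>t\<in>T. y t \<noteq> 0"
    proof (rule ccontr)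
      assume "\<not> ?thesis"
      then have "\<forall>t\<in>T. \<forall>k<n. \<mu> k t = 0" by (auto simp: y_def)
      then have "g k j = 0" if "k < n" "j < Q" for k j using \<mu>(1)[OF that] that by simp
      then have "nrm n g = 0" by (simp add: nrm_def)
      with g show False by simp
    qed
    ultimately obtain h where h: "(\<lambda>t. int (h t)) \<in> sols {..<s} T D" "\<exists>t\<in>T. h t \<noteq> 0"
      "\<forall>t\<in>T. h t \<le> y t" "(\<Sum>t\<in>T. h t) \<le> G'" using G' by blast
    from h(3) obtain \<nu> where \<nu>: "\<And>k t. k < n \<Longrightarrow> t \<in> T \<Longrightarrow> \<nu> k t \<le> \<mu> k t"
      "\<And>t. t \<in> T \<Longrightarrow> (\<Sum>k<n. \<nu> k t) = h t"
      using split_multiplicities[of T h \<mu> n] unfolding y_def by blast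
    define e where "e k j = (\<Sum>t\<in>T. int (\<nu> k t) * t j)" for k j
    have ke: "ker n e"
      unfolding ker_def
    proof (intro conjI allI impI ballI)
      fix k i assume "k < n" "i \<in> {s..<m}"
      have "(\<Sum>j<Q. d i j * e k j) = (\<Sum>t\<in>T. D i t * int (\<nu> k t))" unfolding e_def by (rule lin)
      also have "\<dots> = 0" using T(2) \<open>i \<in> {s..<m}\<close> by (intro sum.neutral) (auto simp: sols_def D_def)
      finally show "(\<Sum>j<Q. d i j * e k j) = 0" .
    next
      fix i assume "i < s"
      have "(\<Sum>k<n. \<Sum>j<Q. d i j * e k j) = (\<Sum>t\<in>T. D i t * int (h t))"
        unfolding e_def linlink using \<nu>(2) by (intro sum.cong) auto
      also have "\<dots> = 0" using h(1) \<open>i < s\<close> by (simp add: sols_def)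
      finally show "(\<Sum>k<n. \<Sum>j<Q. d i j * e k j) = 0" .
    qed
    \<comment> \<open>The two triangle estimates below have right-hand sides that add up to
      \<open>\<bar>g k j\<bar>\<close>; since \<open>g k j\<close> is the sum of
      \<open>e k j\<close> and the rest, both must be equalities.\<close>
    have cf: "\<bar>e k j\<bar> = (\<Sum>t\<in>T. int (\<nu> k t) * \<bar>t j\<bar>) \<and> \<bar>g k j\<bar> = \<bar>e k j\<bar> + \<bar>g k j - e k j\<bar>"
      if kj: "k < n" "j < Q" for k j
    proof -
      have 1: "\<bar>e k j\<bar> \<le> (\<Sum>t\<in>T. int (\<nu> k t) * \<bar>t j\<bar>)" unfolding e_def
        by (rule order_trans[OF sum_abs]) (simp add: abs_mult)
      have "g k j - e k j = (\<Sum>t\<in>T. (int (\<mu> k t) - int (\<nu> k t)) * t j)"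
        unfolding e_def \<mu>(1)[OF kj] by (simp add: sum_subtractf left_diff_distrib)
      then have "\<bar>g k j - e k j\<bar> \<le> (\<Sum>t\<in>T. \<bar>(int (\<mu> k t) - int (\<nu> k t)) * t j\<bar>)" by simp
      also have "\<dots> = (\<Sum>t\<in>T. (int (\<mu> k t) - int (\<nu> k t)) * \<bar>t j\<bar>)"
        using \<nu>(1)[OF kj(1)] by (intro sum.cong) (auto simp: abs_mult)
      also have "\<dots> = \<bar>g k j\<bar> - (\<Sum>t\<in>T. int (\<nu> k t) * \<bar>t j\<bar>)"
        unfolding \<mu>(2)[OF kj] by (simp add: sum_subtractf left_diff_distrib)
      finally show ?thesis using 1 by linarith
    qed
    then have cfe: "conf n e g" by (simp add: conf_def)
    have "nrm n e = (\<Sum>k<n. \<Sum>j<Q. \<Sum>t\<in>T. int (\<nu> k t) * \<bar>t j\<bar>)"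
      unfolding nrm_def using cf by (intro sum.cong) auto
    also have "\<dots> = (\<Sum>k<n. \<Sum>t\<in>T. int (\<nu> k t) * (\<Sum>j<Q. \<bar>t j\<bar>))"
      unfolding sum_distrib_left by (subst sum.swap) simp
    also have "\<dots> = (\<Sum>t\<in>T. int (\<Sum>k<n. \<nu> k t) * (\<Sum>j<Q. \<bar>t j\<bar>))"
      unfolding of_nat_sum sum_distrib_right by (rule sum.swap)
    also have "\<dots> = (\<Sum>t\<in>T. int (h t) * (\<Sum>j<Q. \<bar>t j\<bar>))" using \<nu>(2) by simp
    finally have nrm: "nrm n e = (\<Sum>t\<in>T. int (h t) * (\<Sum>j<Q. \<bar>t j\<bar>))" .
    have "nrm n e \<le> (\<Sum>t\<in>T. int (h t) * b)" unfolding nrm using b by (intro sum_mono mult_left_mono) auto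
    also have "\<dots> = int (\<Sum>t\<in>T. h t) * b" by (simp add: sum_distrib_right)
    also have "\<dots> \<le> int G' * b" by (rule mult_right_mono[OF of_nat_mono[OF h(4)] b0])
    finally have le: "nrm n e \<le> int G' * b" .
    have "nrm n e > 0"
    proof -
      obtain t where t: "t \<in> T" "h t \<noteq> 0" using h by blast
      with T(3) obtain j where j: "j < Q" "t j \<noteq> 0" by blast
      have "\<bar>t j\<bar> \<le> (\<Sum>j<Q. \<bar>t j\<bar>)" using j by (intro member_le_sum) auto
      then have "0 < int (h t) * (\<Sum>j<Q. \<bar>t j\<bar>)" using t j by (intro mult_pos_pos) auto
      also have "\<dots> \<le> nrm n e" unfolding nrm using t T(1)
        by (intro member_le_sum) (auto intro!: mult_nonneg_nonneg sum_nonneg)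
      finally show ?thesis .
    qed
    with ke cfe le show ?thesis by blast
  qed
  then show ?thesis using b0 by (intro exI[of _ "int G' * b"]) auto
qed

lemma ker_diff: "ker n g \<Longrightarrow> ker n h \<Longrightarrow> ker n (\<lambda>k j. g k j - h k j)"
  unfolding ker_def by (simp add: right_diff_distrib sum_subtractf)

lemma ker_sum:
  assumes "\<And>i. i \<in> I \<Longrightarrow> ker n (e i)"
  shows "ker n (\<lambda>k j. \<Sum>i\<in>I. e i k j)"
  using assms
proof (induction I rule: infinite_finite_induct)
  case (insert a I)
  then have "ker n (e a)" "ker n (\<lambda>k j. \<Sum>i\<in>I. e i k j)" by auto
  then have "ker n (\<lambda>k j. e a k j + (\<Sum>i\<in>I. e i k j))"
    unfolding ker_def by (simp add: distrib_left sum.distrib)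
  with insert show ?case by simp
qed (simp_all add: ker_def)

lemma nrm_nonneg [simp]: "nrm n g \<ge> 0" by (simp add: nrm_def sum_nonneg)

lemma nrm_pos_iff: "nrm n g > 0 \<longleftrightarrow> (\<exists>k<n. \<exists>j<Q. g k j \<noteq> 0)"
proof -
  have "nrm n g = 0 \<longleftrightarrow> (\<forall>k<n. \<forall>j<Q. g k j = 0)"
    by (auto simp: nrm_def sum_nonneg_eq_0_iff sum_nonneg)
  moreover have "nrm n g > 0 \<longleftrightarrow> nrm n g \<noteq> 0" using nrm_nonneg[of n g] by linarith
  ultimately show ?thesis by simp
qed

lemma nrm_entry: "k < n \<Longrightarrow> j < Q \<Longrightarrow> \<bar>g k j\<bar> \<le> nrm n g"
proof -
  assume a: "k < n" "j < Q"
  have "\<bar>g k j\<bar> \<le> (\<Sum>j<Q. \<bar>g k j\<bar>)" using a by (intro member_le_sum) auto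
  also have "\<dots> \<le> nrm n g" unfolding nrm_def using a by (intro member_le_sum) (auto intro: sum_nonneg)
  finally show ?thesis .
qed

text \<open>A fixed choice of the bound makes \<open>G\<close> a constant of the matrix, which can
  be embedded in the program text.\<close>

definition G :: int where
  "G = (SOME G. G \<ge> 0 \<and> (\<forall>n g. ker n g \<longrightarrow> nrm n g > 0 \<longrightarrow>
     (\<exists>h. ker n h \<and> conf n h g \<and> nrm n h > 0 \<and> nrm n h \<le> G)))"

lemma G: "G \<ge> 0" "ker n g \<Longrightarrow> nrm n g > 0 \<Longrightarrow>
     (\<exists>h. ker n h \<and> conf n h g \<and> nrm n h > 0 \<and> nrm n h \<le> G)"
  using someI_ex[OF graver_bound, folded G_def] by simp_all

text \<open>The equation for absolute values excludes cancellation, so the sum over any subset of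
  the pieces is again conformal to \<open>g\<close>.\<close>

definition pieces :: "nat \<Rightarrow> (nat \<Rightarrow> nat \<Rightarrow> int) \<Rightarrow> nat \<Rightarrow> (nat \<Rightarrow> nat \<Rightarrow> nat \<Rightarrow> int) \<Rightarrow> bool" where
  "pieces n g l e \<longleftrightarrow>
    (\<forall>k<n. \<forall>j<Q. g k j = (\<Sum>i<l. e i k j) \<and> \<bar>g k j\<bar> = (\<Sum>i<l. \<bar>e i k j\<bar>)) \<and>
    (\<forall>i<l. ker n (e i) \<and> nrm n (e i) > 0 \<and> nrm n (e i) \<le> G)"

lemma piecesD:
  assumes "pieces n g l e"
  shows "\<And>k j. k < n \<Longrightarrow> j < Q \<Longrightarrow> g k j = (\<Sum>i<l. e i k j)"
    "\<And>k j. k < n \<Longrightarrow> j < Q \<Longrightarrow> \<bar>g k j\<bar> = (\<Sum>i<l. \<bar>e i k j\<bar>)"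
    "\<And>i. i < l \<Longrightarrow> ker n (e i) \<and> nrm n (e i) > 0 \<and> nrm n (e i) \<le> G"
  using assms unfolding pieces_def by blast+

lemma decompose:
  assumes "ker n g"
  shows "\<exists>l e. pieces n g l e"
  using assms
proof (induction "nat (nrm n g)" arbitrary: g rule: less_induct)
  case less
  show ?case
  proof (cases "nrm n g > 0")
    case False
    then have "\<forall>k<n. \<forall>j<Q. g k j = 0" using nrm_pos_iff by blast
    then have "pieces n g 0 e" for e by (simp add: pieces_def)
    then show ?thesis by blast
  next
    case True
    from G(2)[OF less.prems True] obtain h where
      h: "ker n h" "conf n h g" "nrm n h > 0" "nrm n h \<le> G" by blast
    define g' where "g' k j = g k j - h k j" for k j
    have "nrm n g = nrm n h + nrm n g'"
      using h(2) by (simp add: nrm_def conf_def g'_def sum.distrib)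
    then have "nat (nrm n g') < nat (nrm n g)" using h(3) True by linarith
    moreover have "ker n g'" unfolding g'_def using less.prems h(1) by (rule ker_diff)
    ultimately obtain l e where e: "pieces n g' l e" using less.hyps[of g'] by blast
    have "pieces n g (Suc l) (e(l := h))"
      unfolding pieces_def
    proof (intro conjI allI impI)
      fix k j assume kj: "k < n" "j < Q"
      show "g k j = (\<Sum>i<Suc l. (e(l := h)) i k j)" using piecesD(1)[OF e kj] by (simp add: g'_def)
      show "\<bar>g k j\<bar> = (\<Sum>i<Suc l. \<bar>(e(l := h)) i k j\<bar>)"
        using piecesD(2)[OF e kj] h(2) kj by (simp add: g'_def conf_def)
    qed (use piecesD(3)[OF e] h less_Suc_eq in auto)
    then show ?thesis by blast
  qed
qed

text \<open>Without cancellation the triangle inequality is tight for the pieces inside and outside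
  \<open>I\<close> at the same time.\<close>

lemma partial_sum_conf:
  fixes a :: "nat \<Rightarrow> int"
  assumes "g = (\<Sum>i<l. a i)" "\<bar>g\<bar> = (\<Sum>i<l. \<bar>a i\<bar>)" "I \<subseteq> {..<l}"
  shows "\<bar>g\<bar> = \<bar>\<Sum>i\<in>I. a i\<bar> + \<bar>g - (\<Sum>i\<in>I. a i)\<bar>"
proof -
  have fin: "finite I" using assms(3) finite_subset by blast
  have "g - (\<Sum>i\<in>I. a i) = (\<Sum>i\<in>{..<l} - I. a i)" unfolding assms(1) using assms(3) by (simp add: sum_diff)
  then have "\<bar>g - (\<Sum>i\<in>I. a i)\<bar> \<le> (\<Sum>i\<in>{..<l} - I. \<bar>a i\<bar>)" by simp
  moreover have "\<bar>\<Sum>i\<in>I. a i\<bar> \<le> (\<Sum>i\<in>I. \<bar>a i\<bar>)" by simp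
  moreover have "(\<Sum>i\<in>{..<l} - I. \<bar>a i\<bar>) = \<bar>g\<bar> - (\<Sum>i\<in>I. \<bar>a i\<bar>)"
    unfolding assms(2) using assms(3) by (simp add: sum_diff)
  ultimately show ?thesis by linarith
qed

lemma even_subsum:
  fixes e :: "nat \<Rightarrow> nat \<Rightarrow> nat \<Rightarrow> int"
  assumes "l > n * Q"
  shows "\<exists>I\<subseteq>{..<l}. I \<noteq> {} \<and> (\<forall>k<n. \<forall>j<Q. even (\<Sum>i\<in>I. e i k j))"
proof -
  define \<phi> where "\<phi> I = {(k, j). k < n \<and> j < Q \<and> odd (\<Sum>i\<in>I. e i k j)}" for I
  have "\<phi> ` Pow {..<l} \<subseteq> Pow ({..<n} \<times> {..<Q})" by (auto simp: \<phi>_def)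
  then have "card (\<phi> ` Pow {..<l}) \<le> card (Pow ({..<n} \<times> {..<Q}))" by (intro card_mono) auto
  also have "\<dots> = 2 ^ (n * Q)" by (simp add: card_Pow card_cartesian_product)
  also have "\<dots> < 2 ^ l" using assms by simp
  also have "\<dots> = card (Pow {..<l})" by (simp add: card_Pow)
  finally have "\<not> inj_on \<phi> (Pow {..<l})" using pigeonhole by blast
  then obtain I I' where I: "I \<subseteq> {..<l}" "I' \<subseteq> {..<l}" "I \<noteq> I'" "\<phi> I = \<phi> I'"
    by (auto simp: inj_on_def)
  have fin: "finite I" "finite I'" using I finite_subset by blast+
  show ?thesis
  \<comment> \<open>The two subsets have sums of equal parity; their common part contributes equally
    to both, so the symmetric difference has an even sum. It is nonempty because the subsets
    differ.\<close>
  proof (intro exI[of _ "(I - I') \<union> (I' - I)"] conjI allI impI)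
    fix k j assume "k < n" "j < Q"
    then have "odd (\<Sum>i\<in>I. e i k j) \<longleftrightarrow> odd (\<Sum>i\<in>I'. e i k j)" using I(4)
      unfolding \<phi>_def set_eq_iff by fastforce
    moreover have "(\<Sum>i\<in>(I - I') \<union> (I' - I). e i k j) = (\<Sum>i\<in>I - I'. e i k j) + (\<Sum>i\<in>I' - I. e i k j)"
      using fin by (intro sum.union_disjoint) auto
    moreover have "(\<Sum>i\<in>I. e i k j) = (\<Sum>i\<in>I \<inter> I'. e i k j) + (\<Sum>i\<in>I - I'. e i k j)"
      using fin(1) by (rule sum.Int_Diff)
    moreover have "(\<Sum>i\<in>I'. e i k j) = (\<Sum>i\<in>I \<inter> I'. e i k j) + (\<Sum>i\<in>I' - I. e i k j)"
      using sum.Int_Diff[OF fin(2), of _ I] by (simp add: Int_commute)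
    ultimately show "even (\<Sum>i\<in>(I - I') \<union> (I' - I). e i k j)" by presburger
  qed (use I in auto)
qed

section \<open>Proximity of optima at consecutive scales\<close>

definition dot :: "nat \<Rightarrow> (nat \<Rightarrow> nat \<Rightarrow> int) \<Rightarrow> (nat \<Rightarrow> nat \<Rightarrow> int) \<Rightarrow> int" where
  "dot n w g = (\<Sum>k<n. \<Sum>j<Q. w k j * g k j)"

lemma dot_diff: "dot n w (\<lambda>k j. g k j - h k j) = dot n w g - dot n w h"
  by (simp add: dot_def right_diff_distrib sum_subtractf)

lemma dot_add: "dot n w (\<lambda>k j. g k j + h k j) = dot n w g + dot n w h"
  by (simp add: dot_def distrib_left sum.distrib)

lemma dot_scale: "dot n w (\<lambda>k j. a * g k j) = a * dot n w g"
  by (simp add: dot_def sum_distrib_left algebra_simps)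

lemma dot_sum: "dot n w (\<lambda>k j. \<Sum>i\<in>I. e i k j) = (\<Sum>i\<in>I. dot n w (e i))"
proof -
  have "dot n w (\<lambda>k j. \<Sum>i\<in>I. e i k j) = (\<Sum>k<n. \<Sum>i\<in>I. \<Sum>j<Q. w k j * e i k j)"
    unfolding dot_def sum_distrib_left by (intro sum.cong refl) (rule sum.swap)
  also have "\<dots> = (\<Sum>i\<in>I. dot n w (e i))" unfolding dot_def by (rule sum.swap)
  finally show ?thesis .
qed

lemma dot_cong: "(\<And>k j. k < n \<Longrightarrow> j < Q \<Longrightarrow> g k j = h k j) \<Longrightarrow> dot n w g = dot n w h"
  unfolding dot_def by (intro sum.cong) auto

lemma ker_cong: "(\<And>k j. k < n \<Longrightarrow> j < Q \<Longrightarrow> g k j = h k j) \<Longrightarrow> ker n g \<longleftrightarrow> ker n h"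
  unfolding ker_def by simp

text \<open>As \<open>h\<close> lies between 0 and \<open>g\<close>, both new points lie between
  \<open>x\<close> and \<open>x + lam * g\<close>.\<close>

lemma between:
  fixes x g h lam :: int
  assumes "x \<ge> 0" "x + lam * g \<ge> 0" "\<bar>g\<bar> = \<bar>h\<bar> + \<bar>g - h\<bar>" "lam \<ge> 0"
  shows "x + lam * h \<ge> 0" "x + lam * (g - h) \<ge> 0"
proof -
  have "(0 \<le> h \<and> h \<le> g) \<or> (g \<le> h \<and> h \<le> 0)" using assms(3) by linarith
  then have "x + lam * h \<ge> 0 \<and> x + lam * (g - h) \<ge> 0"
  proof
    assume a: "0 \<le> h \<and> h \<le> g"
    then have "lam * h \<ge> 0" "lam * (g - h) \<ge> 0" using assms(4) by auto
    then show ?thesis using assms by linarith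
  next
    assume a: "g \<le> h \<and> h \<le> 0"
    then have "lam * h \<ge> lam * g" "lam * (g - h) \<ge> lam * g" using assms(4) by (auto intro: mult_left_mono)
    then show ?thesis using assms by linarith
  qed
  then show "x + lam * h \<ge> 0" "x + lam * (g - h) \<ge> 0" by auto
qed

text \<open>For positive \<open>lam\<close> the points \<open>x + lam * g\<close> are the
  nonnegative points with the row sums of \<open>x\<close> that are congruent to \<open>x\<close>
  modulo \<open>lam\<close>. Optimality of \<open>x\<close> modulo \<open>lam\<close> thus means
  that \<open>dot n w g\<close> is nonnegative for every such \<open>g\<close>.\<close>

definition feas :: "nat \<Rightarrow> (nat \<Rightarrow> nat \<Rightarrow> int) \<Rightarrow> int \<Rightarrow> (nat \<Rightarrow> nat \<Rightarrow> int) \<Rightarrow> bool" where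
  "feas n x lam g \<longleftrightarrow> ker n g \<and> (\<forall>k<n. \<forall>j<Q. x k j + lam * g k j \<ge> 0)"

text \<open>If more than \<open>n * Q\<close> pieces occur, some of them add up to an even vector \<open>2 h\<close>; by optimality
  at the coarser scale, removing it does not increase the objective.\<close>

lemma proximity:
  assumes x: "\<And>k j. k < n \<Longrightarrow> j < Q \<Longrightarrow> x k j \<ge> 0" and lam: "lam \<ge> 0"
    and opt: "\<And>h. feas n x (2 * lam) h \<Longrightarrow> dot n w h \<ge> 0"
    and g: "feas n x lam g"
  shows "\<exists>g'. feas n x lam g' \<and> dot n w g' \<le> dot n w g \<and> (\<forall>k<n. \<forall>j<Q. \<bar>g' k j\<bar> \<le> int (n * Q) * G)"
  using g
proof (induction "nat (nrm n g)" arbitrary: g rule: less_induct)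
  case less
  from less.prems have kg: "ker n g" and fg: "\<And>k j. k < n \<Longrightarrow> j < Q \<Longrightarrow> x k j + lam * g k j \<ge> 0"
    by (auto simp: feas_def)
  from decompose[OF kg] obtain l e where pe: "pieces n g l e" by blast
  note e = piecesD[OF pe]
  show ?case
  proof (cases "l > n * Q")
    case False
    have "\<bar>g k j\<bar> \<le> int (n * Q) * G" if kj: "k < n" "j < Q" for k j
    proof -
      have "\<bar>g k j\<bar> \<le> (\<Sum>i<l. G)" unfolding e(2)[OF kj]
        using e(3) nrm_entry[OF kj] by (intro sum_mono) (meson lessThan_iff order_trans)
      also have "\<dots> \<le> int (n * Q) * G" using False G(1) by (simp add: mult_right_mono flip: of_nat_mult)
      finally show ?thesis .
    qed
    with less.prems show ?thesis by blast
  next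
    case True
    obtain I where I: "I \<subseteq> {..<l}" "I \<noteq> {}" "\<And>k j. k < n \<Longrightarrow> j < Q \<Longrightarrow> even (\<Sum>i\<in>I. e i k j)"
      using even_subsum[OF True, of e] by blast
    define f where "f k j = (\<Sum>i\<in>I. e i k j)" for k j
    define h where "h k j = f k j div 2" for k j
    define g' where "g' k j = g k j - f k j" for k j
    have fh: "f k j = 2 * h k j" if "k < n" "j < Q" for k j
      using I(3)[OF that] by (simp add: h_def f_def)
    have kf: "ker n f" unfolding f_def using I(1) e(3) by (intro ker_sum) auto
    have cf: "\<bar>g k j\<bar> = \<bar>f k j\<bar> + \<bar>g' k j\<bar>" if kj: "k < n" "j < Q" for k j
      unfolding g'_def f_def using partial_sum_conf[OF e(1)[OF kj] e(2)[OF kj] I(1)] .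
    have bt: "x k j + lam * f k j \<ge> 0" "x k j + lam * g' k j \<ge> 0" if kj: "k < n" "j < Q" for k j
      using between[OF x[OF kj] fg[OF kj] _ lam] cf[OF kj] unfolding g'_def by auto
    have "ker n (\<lambda>k j. 2 * h k j)" using kf fh ker_cong by (metis (no_types, lifting))
    then have "ker n h" unfolding ker_def by (simp add: mult.left_commute flip: sum_distrib_left)
    \<comment> \<open>Because \<open>lam * f = 2 * lam * h\<close>, removing \<open>f\<close> from
      \<open>g\<close> undoes a step of the coarser scale. By conformality the step \<open>f\<close>
      alone and the remaining step \<open>g'\<close> both stay in the orthant.\<close>
    then have "feas n x (2 * lam) h" using bt(1) fh by (simp add: feas_def mult.assoc mult.left_commute)
    from opt[OF this] have "dot n w f \<ge> 0"
      using dot_cong[of n f "\<lambda>k j. 2 * h k j" w] fh by (simp add: dot_scale)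
    then have wg: "dot n w g' \<le> dot n w g" unfolding g'_def dot_diff by simp
    have "nrm n g = nrm n f + nrm n g'" using cf by (simp add: nrm_def sum.distrib)
    \<comment> \<open>This makes the norm drop strictly. Some piece with index in \<open>I\<close>
      has a nonzero entry; leaving the pieces of \<open>I\<close> out of \<open>g\<close> lowers the
      absolute value there, so \<open>f\<close> cannot vanish at that place.\<close>
    moreover have "nrm n f > 0"
    proof -
      obtain i where i: "i \<in> I" using I by blast
      with e(3) I(1) have "nrm n (e i) > 0" by auto
      then obtain k j where kj: "k < n" "j < Q" "e i k j \<noteq> 0" unfolding nrm_pos_iff by blast
      have "\<bar>g k j - f k j\<bar> = \<bar>\<Sum>i\<in>{..<l} - I. e i k j\<bar>"
        unfolding f_def e(1)[OF kj(1,2)] using I(1) by (simp add: sum_diff finite_subset)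
      also have "\<dots> \<le> (\<Sum>i\<in>{..<l} - I. \<bar>e i k j\<bar>)" by (rule sum_abs)
      also have "\<dots> \<le> (\<Sum>i\<in>{..<l} - {i}. \<bar>e i k j\<bar>)" using i by (intro sum_mono2) auto
      also have "\<dots> = \<bar>g k j\<bar> - \<bar>e i k j\<bar>" unfolding e(2)[OF kj(1,2)] using i I(1)
        by (subst sum_diff1) auto
      finally have "f k j \<noteq> 0" using kj(3) by auto
      then show ?thesis unfolding nrm_pos_iff using kj by blast
    qed
    ultimately have "nat (nrm n g') < nat (nrm n g)" using nrm_nonneg[of n g'] by linarith
    moreover have "ker n g'" unfolding g'_def by (rule ker_diff[OF kg kf])
    then have "feas n x lam g'" using bt(2) by (simp add: feas_def)
    ultimately obtain g'' where "feas n x lam g''" "dot n w g'' \<le> dot n w g'"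
      "\<forall>k<n. \<forall>j<Q. \<bar>g'' k j\<bar> \<le> int (n * Q) * G" using less.hyps[of g'] by blast
    then show ?thesis using wg by (meson order_trans)
  qed
qed

text \<open>A further step \<open>h\<close> from the new point combines with \<open>g\<close> to a
  step from \<open>x\<close>. By proximity some step inside the box is at least as good as
  \<open>g + h\<close>, and \<open>g\<close> is best in the box.\<close>

lemma scaling_step:
  assumes x: "\<And>k j. k < n \<Longrightarrow> j < Q \<Longrightarrow> x k j \<ge> 0" and lam: "lam \<ge> 0"
    and opt: "\<And>h. feas n x (2 * lam) h \<Longrightarrow> dot n w h \<ge> 0"
    and K: "int (n * Q) * G \<le> K"
    and g: "feas n x lam g"
    and best: "\<And>g'. feas n x lam g' \<Longrightarrow> \<forall>k<n. \<forall>j<Q. \<bar>g' k j\<bar> \<le> K \<Longrightarrow> dot n w g \<le> dot n w g'"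
    and h: "feas n (\<lambda>k j. x k j + lam * g k j) lam h"
  shows "dot n w h \<ge> 0"
proof -
  have "ker n (\<lambda>k j. \<Sum>i\<in>{0,1::nat}. (if i = 0 then g else h) k j)"
    using g h by (intro ker_sum) (auto simp: feas_def)
  then have "feas n x lam (\<lambda>k j. g k j + h k j)"
    using h by (simp add: feas_def distrib_left add.assoc)
  from proximity[OF x lam opt this] obtain g' where g': "feas n x lam g'"
    "dot n w g' \<le> dot n w (\<lambda>k j. g k j + h k j)" "\<forall>k<n. \<forall>j<Q. \<bar>g' k j\<bar> \<le> int (n * Q) * G" by blast
  have "\<forall>k<n. \<forall>j<Q. \<bar>g' k j\<bar> \<le> K" using g'(3) K by (meson order_trans)
  from best[OF g'(1) this] g'(2) show ?thesis by (simp add: dot_add)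
qed

text \<open>A negative entry of a piece would have to cancel against the others.\<close>

lemma nonneg_decompose:
  assumes "pieces n g l e" "\<forall>k<n. \<forall>j<Q. g k j \<ge> 0" "i < l" "k < n" "j < Q"
  shows "e i k j \<ge> 0"
proof (rule ccontr)
  assume a: "\<not> ?thesis"
  have "(\<Sum>i<l. e i k j) < (\<Sum>i<l. \<bar>e i k j\<bar>)"
    by (rule sum_strict_mono_ex1) (use a assms(3) in \<open>auto intro!: bexI[of _ i]\<close>)
  moreover have "g k j \<ge> 0" using assms(2,4,5) by simp
  ultimately show False using piecesD(1,2)[OF assms(1,4,5)] by linarith
qed

text \<open>The pieces of a nonnegative kernel element are nonnegative and fit into the box, so an
  improving direction of any size entails one that the search inside the box can see.\<close>

lemma recession:
  assumes K: "G \<le> K"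
    and rec: "\<And>g. feas n (\<lambda>_ _. 0) 1 g \<Longrightarrow> \<forall>k<n. \<forall>j<Q. \<bar>g k j\<bar> \<le> K \<Longrightarrow> dot n w g \<ge> 0"
    and g: "feas n (\<lambda>_ _. 0) 1 g"
  shows "dot n w g \<ge> 0"
proof -
  have "ker n g" using g by (simp add: feas_def)
  from decompose[OF this] obtain l e where pe: "pieces n g l e" by blast
  note e = piecesD[OF pe]
  have "dot n w (e i) \<ge> 0" if "i < l" for i
  proof (rule rec)
    show "feas n (\<lambda>_ _. 0) 1 (e i)"
      using e(3)[OF that] nonneg_decompose[OF pe _ that] g by (auto simp: feas_def)
    show "\<forall>k<n. \<forall>j<Q. \<bar>e i k j\<bar> \<le> K" using e(3)[OF that] nrm_entry K by (meson order_trans)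
  qed
  then have "dot n w (\<lambda>k j. \<Sum>i<l. e i k j) \<ge> 0" unfolding dot_sum by (auto intro: sum_nonneg)
  then show ?thesis using dot_cong[of n g "\<lambda>k j. \<Sum>i<l. e i k j" w] e(1) by simp
qed

text \<open>Once \<open>lam\<close> exceeds every entry of \<open>x\<close>, a single negative entry
  of a step leads out of the orthant. All feasible steps are then nonnegative kernel
  elements.\<close>

lemma initial_optimal:
  assumes rec: "\<And>g. feas n (\<lambda>_ _. 0) 1 g \<Longrightarrow> dot n w g \<ge> 0"
    and x: "\<And>k j. k < n \<Longrightarrow> j < Q \<Longrightarrow> x k j < lam"
    and g: "feas n x lam g" and lam: "lam \<ge> 0"
  shows "dot n w g \<ge> 0"
proof (rule rec)
  have "g k j \<ge> 0" if "k < n" "j < Q" for k j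
  proof (rule ccontr)
    assume "\<not> g k j \<ge> 0"
    then have "lam * g k j \<le> lam * (-1)" using lam by (intro mult_left_mono) auto
    moreover have "x k j + lam * g k j \<ge> 0" using g that by (simp add: feas_def)
    ultimately show False using x[OF that] by simp
  qed
  then show "feas n (\<lambda>_ _. 0) 1 g" using g by (simp add: feas_def)
qed

section \<open>Exactness of the slack penalty\<close>

lemma abs_dot_le:
  assumes "\<forall>k<n. \<forall>j<Q. \<bar>g k j\<bar> \<le> K"
  shows "\<bar>dot n c g\<bar> \<le> K * nrm n c"
proof -
  have "\<bar>dot n c g\<bar> \<le> (\<Sum>k<n. \<Sum>j<Q. \<bar>c k j * g k j\<bar>)"
    unfolding dot_def by (rule order_trans[OF sum_abs sum_mono[OF sum_abs]])
  also have "\<dots> \<le> (\<Sum>k<n. \<Sum>j<Q. \<bar>c k j\<bar> * K)"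
    using assms by (intro sum_mono) (auto simp: abs_mult intro: mult_left_mono)
  also have "\<dots> = K * nrm n c" by (simp add: nrm_def sum_distrib_left mult.commute)
  finally show ?thesis .
qed

text \<open>\<open>p\<close> counts slack; \<open>M\<close> is so large that reducing the slack dominates the objective.\<close>

lemma penalty_exact:
  assumes K: "G \<le> K" and M: "M > K * nrm n c"
    and z: "\<And>k j. k < n \<Longrightarrow> j < Q \<Longrightarrow> z k j \<ge> 0"
    and opt: "\<And>h. feas n z 1 h \<Longrightarrow> dot n (\<lambda>k j. c k j + M * p k j) h \<ge> 0"
    and g: "feas n z 1 g"
  shows "dot n p g \<ge> 0"
proof -
  have "ker n g" using g by (simp add: feas_def)
  from decompose[OF this] obtain l e where pe: "pieces n g l e" by blast
  note e = piecesD[OF pe]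
  have "dot n p (e i) \<ge> 0" if i: "i < l" for i
  proof (rule ccontr)
    assume "\<not> ?thesis"
    \<comment> \<open>If the total slack decreased along \<open>g\<close>, it would decrease along
      some piece, by integrality at least by 1. That piece is a feasible step by itself; it gains
      \<open>M\<close> and loses at most \<open>K * nrm n c\<close>, against optimality.\<close>
    then have neg: "dot n p (e i) \<le> -1" by simp
    have "feas n z 1 (e i)" unfolding feas_def
    proof (intro conjI allI impI)
      fix k j assume kj: "k < n" "j < Q"
      have "\<bar>g k j\<bar> = \<bar>e i k j\<bar> + \<bar>g k j - e i k j\<bar>"
        using partial_sum_conf[OF e(1)[OF kj] e(2)[OF kj], of "{i}"] i by simp
      moreover have "z k j + 1 * g k j \<ge> 0" using g kj by (simp add: feas_def)
      ultimately show "z k j + 1 * e i k j \<ge> 0" using between(1)[OF z[OF kj], of 1] by simp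
    qed (use e(3)[OF i] in auto)
    from opt[OF this] have "dot n c (e i) + M * dot n p (e i) \<ge> 0"
      unfolding dot_def by (simp add: algebra_simps sum.distrib sum_distrib_left)
    moreover have "\<forall>k<n. \<forall>j<Q. \<bar>e i k j\<bar> \<le> K" using e(3)[OF i] nrm_entry K by (meson order_trans)
    then have "\<bar>dot n c (e i)\<bar> \<le> K * nrm n c" by (rule abs_dot_le)
    moreover have "M * dot n p (e i) \<le> M * (-1)"
    proof (rule mult_left_mono[OF neg])
      have "K * nrm n c \<ge> 0" using K G(1) by simp
      then show "M \<ge> 0" using M by simp
    qed
    ultimately show False using M by linarith
  qed
  then have "dot n p (\<lambda>k j. \<Sum>i<l. e i k j) \<ge> 0" unfolding dot_sum by (auto intro: sum_nonneg)
  then show ?thesis using dot_cong[of n g "\<lambda>k j. \<Sum>i<l. e i k j" p] e(1) by simp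
qed

end

section \<open>Counting the steps of programs\<close>

lemma floorlog_le_pow: "n \<le> 2 ^ k \<Longrightarrow> floorlog 2 n \<le> Suc k" for n k :: nat
  by (rule floorlog_leI) (auto intro: le_less_trans)

lemma bit_size_le: "\<bar>z\<bar> \<le> 2 ^ k \<Longrightarrow> bit_size z \<le> k + 2"
  unfolding bit_size_def using floorlog_le_pow[of "nat \<bar>z\<bar>" k] by (simp add: nat_le_iff)

lemma abs_less_bit_size: "\<bar>z\<bar> < 2 ^ bit_size z"
proof (cases "z = 0")
  case False
  then have "nat \<bar>z\<bar> < 2 ^ floorlog 2 (nat \<bar>z\<bar>)" using floorlog_bounds[of "nat \<bar>z\<bar>" 2] by simp
  then have "\<bar>z\<bar> < 2 ^ floorlog 2 (nat \<bar>z\<bar>)" by (simp add: nat_less_iff)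
  then show ?thesis by (simp add: bit_size_def)
qed simp

text \<open>As long as all cells have at most \<open>L\<close> bits, an elementary step costs at most \<open>L\<close> times a
  constant \<open>kap\<close> that depends only on the program text. It remains to count steps (\<open>T\<close> in \<open>ok\<close>).\<close>

definition bounded :: "nat \<Rightarrow> mem \<Rightarrow> bool" where
  "bounded L m \<longleftrightarrow> (\<forall>v i. \<bar>m v i\<bar> \<le> 2 ^ L)"

lemma update_apply [simp]:
  "update m v i z w = (if w = v then (m v)(i := z) else m w)"
  by (simp add: update_def)

lemma bounded_update: "bounded L m \<Longrightarrow> \<bar>z\<bar> \<le> 2 ^ L \<Longrightarrow> bounded L (update m v i z)"
  by (simp add: bounded_def)

text \<open>Values have absolute value at most \<open>2 ^ (abits e * L)\<close>: a sum needs one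
  extra bit for the carry, a product adds the exponents, and a quotient is never larger than its
  numerator, also for divisor 0.\<close>

fun abits :: "aexp \<Rightarrow> nat" where
  "abits (Const z) = bit_size z"
| "abits (Cell v e) = 1"
| "abits (Plus e1 e2) = abits e1 + abits e2 + 1"
| "abits (Minus e1 e2) = abits e1 + abits e2 + 1"
| "abits (Times e1 e2) = abits e1 + abits e2"
| "abits (Quot e1 e2) = abits e1"

fun akap :: "aexp \<Rightarrow> nat" where
  "akap (Const z) = bit_size z + 2"
| "akap (Cell v e) = akap e + 3"
| "akap (Plus e1 e2) = akap e1 + akap e2 + abits (Plus e1 e2) + 2"
| "akap (Minus e1 e2) = akap e1 + akap e2 + abits (Minus e1 e2) + 2"
| "akap (Times e1 e2) = akap e1 + akap e2 + abits (Times e1 e2) + 2"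
| "akap (Quot e1 e2) = akap e1 + akap e2 + abits (Quot e1 e2) + 2"

fun bkap :: "bexp \<Rightarrow> nat" where
  "bkap (Less e1 e2) = 1 + akap e1 + akap e2"
| "bkap (Not b) = 1 + bkap b"
| "bkap (And b1 b2) = 1 + bkap b1 + bkap b2"

fun kap :: "com \<Rightarrow> nat" where
  "kap Skip = 1"
| "kap (Assign v e1 e2) = 1 + akap e1 + akap e2"
| "kap (Read v e) = 4 + akap e"
| "kap (Write e) = 1 + akap e"
| "kap (Seq P Q) = kap P + kap Q"
| "kap (Cond b P Q) = 1 + bkap b + kap P + kap Q"
| "kap (While b P) = 1 + bkap b + kap P"

lemma abs_div_le: "\<bar>x div y\<bar> \<le> \<bar>x\<bar>" for x y :: int
proof -
  have pos: "\<bar>x div y\<bar> \<le> \<bar>x\<bar>" if "y > 0" for x y :: int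
  proof (cases "x \<ge> 0")
    case True
    then show ?thesis using zdiv_mono2[of x 1 y] that by (simp add: pos_imp_zdiv_nonneg_iff)
  next
    case False
    then have "x div y < 0" using that by (simp add: pos_imp_zdiv_neg_iff)
    then show ?thesis using zdiv_mono2_neg[of x 1 y] that False by simp
  qed
  consider "y = 0" | "y > 0" | "y < 0" by linarith
  then show ?thesis using pos[of y x] pos[of "- y" "- x"] by cases simp_all
qed

lemma aval_bound:
  assumes "bounded L m" "L \<ge> 1"
  shows "\<bar>aval e m\<bar> \<le> 2 ^ (abits e * L)"
proof (induction e)
  case (Const z)
  have "\<bar>z\<bar> \<le> 2 ^ bit_size z" using abs_less_bit_size[of z] by simp
  also have "(2::int) ^ bit_size z \<le> 2 ^ (bit_size z * L)" using assms(2) by (intro power_increasing) auto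
  finally show ?case by simp
next
  case (Cell v e)
  then show ?case using assms(1) by (simp add: bounded_def)
next
  case (Plus e1 e2)
  have "(2::int) ^ (abits e1 * L) \<le> 2 ^ ((abits e1 + abits e2) * L)"
    "(2::int) ^ (abits e2 * L) \<le> 2 ^ ((abits e1 + abits e2) * L)"
    by (intro power_increasing; simp)+
  then have "\<bar>aval (Plus e1 e2) m\<bar> \<le> 2 ^ Suc ((abits e1 + abits e2) * L)"
    unfolding aval.simps power_Suc using Plus by linarith
  also have "(2::int) ^ Suc ((abits e1 + abits e2) * L) \<le> 2 ^ (abits (Plus e1 e2) * L)"
    using assms(2) by (intro power_increasing) auto
  finally show ?case .
next
  case (Minus e1 e2)
  have "(2::int) ^ (abits e1 * L) \<le> 2 ^ ((abits e1 + abits e2) * L)"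
    "(2::int) ^ (abits e2 * L) \<le> 2 ^ ((abits e1 + abits e2) * L)"
    by (intro power_increasing; simp)+
  then have "\<bar>aval (Minus e1 e2) m\<bar> \<le> 2 ^ Suc ((abits e1 + abits e2) * L)"
    unfolding aval.simps power_Suc using Minus by linarith
  also have "(2::int) ^ Suc ((abits e1 + abits e2) * L) \<le> 2 ^ (abits (Minus e1 e2) * L)"
    using assms(2) by (intro power_increasing) auto
  finally show ?case .
next
  case (Times e1 e2)
  then have "\<bar>aval e1 m\<bar> * \<bar>aval e2 m\<bar> \<le> 2 ^ (abits e1 * L) * 2 ^ (abits e2 * L)"
    by (intro mult_mono) auto
  then show ?case by (simp add: abs_mult algebra_simps power_add)
next
  case (Quot e1 e2)
  then show ?case using abs_div_le[of "aval e1 m" "aval e2 m"] by simp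
qed

lemma bit_size_aval:
  assumes "bounded L m" "L \<ge> 1"
  shows "bit_size (aval e m) \<le> (abits e + 2) * L"
proof -
  have "bit_size (aval e m) \<le> abits e * L + 2" by (rule bit_size_le[OF aval_bound[OF assms]])
  also have "\<dots> \<le> (abits e + 2) * L" using assms(2) by (simp add: algebra_simps)
  finally show ?thesis .
qed

lemma acost_le:
  assumes "bounded L m" "L \<ge> 1"
  shows "acost e m \<le> akap e * L"
proof (induction e)
  case (Const z)
  then show ?case using bit_size_aval[OF assms, of "Const z"] by simp
next
  case (Cell v e)
  then show ?case using bit_size_aval[OF assms, of "Cell v e"] by (simp add: algebra_simps)
next
  case (Plus e1 e2)
  then show ?case using bit_size_aval[OF assms, of "Plus e1 e2"] by (simp add: algebra_simps)
next
  case (Minus e1 e2)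
  then show ?case using bit_size_aval[OF assms, of "Minus e1 e2"] by (simp add: algebra_simps)
next
  case (Times e1 e2)
  then show ?case using bit_size_aval[OF assms, of "Times e1 e2"] by (simp add: algebra_simps)
next
  case (Quot e1 e2)
  then show ?case using bit_size_aval[OF assms, of "Quot e1 e2"] by (simp add: algebra_simps)
qed

lemma bcost_le:
  assumes "bounded L m" "L \<ge> 1"
  shows "bcost b m \<le> bkap b * L"
proof (induction b)
  case (Less e1 e2)
  then show ?case using acost_le[OF assms, of e1] acost_le[OF assms, of e2] assms(2)
    by (simp add: algebra_simps)
qed (use assms(2) in \<open>simp_all add: algebra_simps\<close>)

text \<open>Total correctness, since \<open>exec\<close> holds of terminating runs only; the bit
  bound \<open>L\<close> is assumed of the initial memory and re-established for the final one.
  Charging every counted step with \<open>kap\<close> of the whole command is wasteful, but it lets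
  the step counts of consecutive commands simply add up.\<close>

definition ok :: "nat \<Rightarrow> nat \<Rightarrow> com \<Rightarrow> mem \<Rightarrow> int list \<Rightarrow> int list \<Rightarrow>
    (mem \<Rightarrow> int list \<Rightarrow> int list \<Rightarrow> bool) \<Rightarrow> bool" where
  "ok L T c m xs ys Q \<longleftrightarrow> (bounded L m \<longrightarrow> L \<ge> 1 \<longrightarrow>
     (\<exists>t m' xs' ys'. exec c (m, xs, ys) t (m', xs', ys') \<and> t \<le> T * kap c * L \<and>
        bounded L m' \<and> Q m' xs' ys'))"

section \<open>Proof rules for commands\<close>

lemma ok_assign:
  assumes "\<bar>aval e2 m\<bar> \<le> 2 ^ L" "Q (update m v (aval e1 m) (aval e2 m)) xs ys"
  shows "ok L 1 (Assign v e1 e2) m xs ys Q"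
  unfolding ok_def
proof (intro impI)
  assume b: "bounded L m" "L \<ge> 1"
  have "1 + acost e1 m + acost e2 m \<le> 1 * kap (Assign v e1 e2) * L"
    using acost_le[OF b, of e1] acost_le[OF b, of e2] b(2) by (simp add: algebra_simps)
  with exec.Assign bounded_update[OF b(1) assms(1)] assms(2)
  show "\<exists>t m' xs' ys'. exec (Assign v e1 e2) (m, xs, ys) t (m', xs', ys') \<and>
      t \<le> 1 * kap (Assign v e1 e2) * L \<and> bounded L m' \<and> Q m' xs' ys'" by blast
qed

lemma ok_read:
  assumes "\<bar>x\<bar> \<le> 2 ^ L" "Q (update m v (aval e m) x) xs ys"
  shows "ok L 1 (Read v e) m (x # xs) ys Q"
  unfolding ok_def
proof (intro impI)
  assume b: "bounded L m" "L \<ge> 1"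
  have "1 + acost e m + bit_size x \<le> 1 * kap (Read v e) * L"
    using acost_le[OF b, of e] bit_size_le[OF assms(1)] b(2) by (simp add: algebra_simps)
  with exec.Read bounded_update[OF b(1) assms(1)] assms(2)
  show "\<exists>t m' xs' ys'. exec (Read v e) (m, x # xs, ys) t (m', xs', ys') \<and>
      t \<le> 1 * kap (Read v e) * L \<and> bounded L m' \<and> Q m' xs' ys'" by blast
qed

lemma ok_write:
  assumes "Q m xs (ys @ [aval e m])"
  shows "ok L 1 (Write e) m xs ys Q"
  unfolding ok_def
proof (intro impI)
  assume b: "bounded L m" "L \<ge> 1"
  have "1 + acost e m \<le> 1 * kap (Write e) * L"
    using acost_le[OF b, of e] b(2) by (simp add: algebra_simps)
  with exec.Write b(1) assms
  show "\<exists>t m' xs' ys'. exec (Write e) (m, xs, ys) t (m', xs', ys') \<and>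
      t \<le> 1 * kap (Write e) * L \<and> bounded L m' \<and> Q m' xs' ys'" by blast
qed

lemma ok_skip: "Q m xs ys \<Longrightarrow> ok L 1 Skip m xs ys Q"
  unfolding ok_def
proof (intro impI)
  assume "Q m xs ys" "bounded L m" "L \<ge> 1"
  moreover have "1 \<le> 1 * kap Skip * L" using \<open>L \<ge> 1\<close> by simp
  ultimately show "\<exists>t m' xs' ys'. exec Skip (m, xs, ys) t (m', xs', ys') \<and>
      t \<le> 1 * kap Skip * L \<and> bounded L m' \<and> Q m' xs' ys'" using exec.Skip by blast
qed

lemma ok_seq:
  assumes "ok L T1 c1 m xs ys (\<lambda>m' xs' ys'. ok L T2 c2 m' xs' ys' Q)"
  shows "ok L (T1 + T2) (Seq c1 c2) m xs ys Q"
  unfolding ok_def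
proof (intro impI)
  assume b: "bounded L m" "L \<ge> 1"
  from assms b obtain t m' xs' ys' where 1: "exec c1 (m, xs, ys) t (m', xs', ys')"
    "t \<le> T1 * kap c1 * L" "bounded L m'" "ok L T2 c2 m' xs' ys' Q"
    unfolding ok_def[of L T1] by blast
  from 1(3,4) b(2) obtain u m'' xs'' ys'' where 2: "exec c2 (m', xs', ys') u (m'', xs'', ys'')"
    "u \<le> T2 * kap c2 * L" "bounded L m''" "Q m'' xs'' ys''"
    unfolding ok_def by blast
  have "T1 * kap c1 \<le> T1 * (kap c1 + kap c2)" "T2 * kap c2 \<le> T2 * (kap c1 + kap c2)" by simp_all
  then have "T1 * kap c1 * L + T2 * kap c2 * L \<le> (T1 + T2) * kap (Seq c1 c2) * L"
    by (simp add: algebra_simps)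
  with 1(2) 2(2) have "t + u \<le> (T1 + T2) * kap (Seq c1 c2) * L" by linarith
  with exec.Seq[OF 1(1) 2(1)] 2(3,4)
  show "\<exists>t m' xs' ys'. exec (Seq c1 c2) (m, xs, ys) t (m', xs', ys') \<and>
      t \<le> (T1 + T2) * kap (Seq c1 c2) * L \<and> bounded L m' \<and> Q m' xs' ys'" by blast
qed

lemma ok_mono:
  assumes "ok L T c m xs ys Q" "T \<le> T'"
    "\<And>m' xs' ys'. bounded L m' \<Longrightarrow> Q m' xs' ys' \<Longrightarrow> Q' m' xs' ys'"
  shows "ok L T' c m xs ys Q'"
proof -
  have "t \<le> T' * kap c * L" if "t \<le> T * kap c * L" for t
    using that assms(2) by (meson mult_le_mono1 order_trans)
  then show ?thesis using assms(1,3) unfolding ok_def by blast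
qed

lemma ok_cond:
  assumes "bval b m \<Longrightarrow> ok L T c1 m xs ys Q" "\<not> bval b m \<Longrightarrow> ok L T c2 m xs ys Q"
  shows "ok L (T + 1) (Cond b c1 c2) m xs ys Q"
  unfolding ok_def
proof (intro impI)
  assume b: "bounded L m" "L \<ge> 1"
  let ?c = "if bval b m then c1 else c2"
  from assms b obtain t m' xs' ys' where 1: "exec ?c (m, xs, ys) t (m', xs', ys')"
    "t \<le> T * kap ?c * L" "bounded L m'" "Q m' xs' ys'"
    unfolding ok_def by (cases "bval b m") auto
  have "exec (Cond b c1 c2) (m, xs, ys) (1 + bcost b m + t) (m', xs', ys')"
    using exec.CondTrue[of b "(m, xs, ys)"] exec.CondFalse[of b "(m, xs, ys)"] 1(1)
    by (cases "bval b m") auto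
  moreover have "1 + bcost b m + t \<le> (T + 1) * kap (Cond b c1 c2) * L"
  proof -
    have "1 + bcost b m \<le> (1 + bkap b) * L" using bcost_le[OF b, of b] b(2) by simp
    also have "\<dots> \<le> kap (Cond b c1 c2) * L" by (intro mult_le_mono1) simp
    finally have "1 + bcost b m \<le> kap (Cond b c1 c2) * L" .
    moreover have "T * kap ?c * L \<le> T * kap (Cond b c1 c2) * L"
      by (intro mult_le_mono1 mult_le_mono2) simp
    ultimately show ?thesis using 1(2) by (simp add: algebra_simps)
  qed
  ultimately show "\<exists>t m' xs' ys'. exec (Cond b c1 c2) (m, xs, ys) t (m', xs', ys') \<and>
      t \<le> (T + 1) * kap (Cond b c1 c2) * L \<and> bounded L m' \<and> Q m' xs' ys'" using 1(3,4) by blast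
qed

text \<open>The index of the invariant is the exact number of remaining iterations, so it acts as
  variant and as time bound.\<close>

lemma ok_while:
  assumes step: "\<And>k m xs ys. I (Suc k) m xs ys \<Longrightarrow> bval b m \<and> ok L T c m xs ys (I k)"
    and stop: "\<And>m xs ys. I 0 m xs ys \<Longrightarrow> \<not> bval b m"
    and init: "I k m xs ys"
  shows "ok L (k * (T + 1) + 1) (While b c) m xs ys (I 0)"
  using init
proof (induction k arbitrary: m xs ys)
  case 0
  show ?case unfolding ok_def
  proof (intro impI)
    assume b: "bounded L m" "L \<ge> 1"
    have "1 + bcost b m \<le> (1 + bkap b) * L" using bcost_le[OF b, of b] b(2) by simp
    also have "\<dots> \<le> (0 * (T + 1) + 1) * kap (While b c) * L" by simp
    finally show "\<exists>t m' xs' ys'. exec (While b c) (m, xs, ys) t (m', xs', ys') \<and>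
        t \<le> (0 * (T + 1) + 1) * kap (While b c) * L \<and> bounded L m' \<and> I 0 m' xs' ys'"
      using exec.WhileFalse[of b "(m, xs, ys)" c] stop 0 b(1) by auto
  qed
next
  case (Suc k)
  show ?case unfolding ok_def
  proof (intro impI)
    assume b: "bounded L m" "L \<ge> 1"
    from step[OF Suc.prems] b obtain t m1 xs1 ys1 where 1: "exec c (m, xs, ys) t (m1, xs1, ys1)"
      "t \<le> T * kap c * L" "bounded L m1" "I k m1 xs1 ys1" and bv: "bval b m"
      unfolding ok_def by blast
    from Suc.IH[OF 1(4)] 1(3) b(2) obtain u m' xs' ys' where
      2: "exec (While b c) (m1, xs1, ys1) u (m', xs', ys')"
      "u \<le> (k * (T + 1) + 1) * kap (While b c) * L" "bounded L m'" "I 0 m' xs' ys'"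
      unfolding ok_def by blast
    have "1 + bcost b m \<le> (1 + bkap b) * L" using bcost_le[OF b, of b] b(2) by simp
    also have "\<dots> \<le> kap (While b c) * L" by simp
    finally have "1 + bcost b m \<le> kap (While b c) * L" .
    moreover have "T * kap c * L \<le> T * kap (While b c) * L"
      by (intro mult_le_mono1 mult_le_mono2) simp
    moreover have "(Suc k * (T + 1) + 1) * kap (While b c) * L =
        kap (While b c) * L + T * kap (While b c) * L + (k * (T + 1) + 1) * kap (While b c) * L"
      by (simp add: algebra_simps)
    ultimately have "1 + bcost b m + t + u \<le> (Suc k * (T + 1) + 1) * kap (While b c) * L"
      using 1(2) 2(2) by linarith
    moreover have "exec (While b c) (m, xs, ys) (1 + bcost b m + t + u) (m', xs', ys')"
      using exec.WhileTrue[of b "(m, xs, ys)", OF _ 1(1) 2(1)] bv by simp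
    ultimately show "\<exists>t m' xs' ys'. exec (While b c) (m, xs, ys) t (m', xs', ys') \<and>
        t \<le> (Suc k * (T + 1) + 1) * kap (While b c) * L \<and> bounded L m' \<and> I 0 m' xs' ys'"
      using 2(3,4) by blast
  qed
qed

fun mods :: "com \<Rightarrow> string set" where
  "mods Skip = {}"
| "mods (Assign v e1 e2) = {v}"
| "mods (Read v e) = {v}"
| "mods (Write e) = {}"
| "mods (Seq P Q) = mods P \<union> mods Q"
| "mods (Cond b P Q) = mods P \<union> mods Q"
| "mods (While b P) = mods P"

lemma exec_mods: "exec c \<sigma> t \<tau> \<Longrightarrow> v \<notin> mods c \<Longrightarrow> fst \<tau> v = fst \<sigma> v"
  by (induction rule: exec.induct) auto

lemma ok_frame:
  assumes "ok L T c m xs ys Q"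
  shows "ok L T c m xs ys (\<lambda>m' xs' ys'. Q m' xs' ys' \<and> (\<forall>v. v \<notin> mods c \<longrightarrow> m' v = m v))"
  unfolding ok_def
proof (intro impI)
  assume "bounded L m" "L \<ge> 1"
  with assms obtain t m' xs' ys' where 1: "exec c (m, xs, ys) t (m', xs', ys')"
    "t \<le> T * kap c * L" "bounded L m'" "Q m' xs' ys'" unfolding ok_def by blast
  from exec_mods[OF 1(1)] have "\<forall>v. v \<notin> mods c \<longrightarrow> m' v = m v" by simp
  with 1 show "\<exists>t m' xs' ys'. exec c (m, xs, ys) t (m', xs', ys') \<and> t \<le> T * kap c * L \<and>
    bounded L m' \<and> Q m' xs' ys' \<and> (\<forall>v. v \<notin> mods c \<longrightarrow> m' v = m v)" by blast
qed

abbreviation scal :: "string \<Rightarrow> aexp" where "scal v \<equiv> Cell v (Const 0)"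

definition For :: "string \<Rightarrow> aexp \<Rightarrow> aexp \<Rightarrow> com \<Rightarrow> com" where
  "For v lo hi c = Seq (Assign v (Const 0) lo)
     (While (Less (scal v) hi) (Seq c (Assign v (Const 0) (Plus (scal v) (Const 1)))))"

lemma mods_For [simp]: "mods (For v lo hi c) = insert v (mods c)"
  by (auto simp: For_def)

text \<open>The bound \<open>hi\<close> is evaluated anew at each test, hence the assumption that it
  keeps the value \<open>h\<close>. Each round costs \<open>T\<close> plus the increment and the
  test; the final \<open>2\<close> stands for the initial assignment and the failing test. The
  invariant is stated for the memory after the increment.\<close>

lemma ok_for:
  assumes lh: "l \<le> h" "\<bar>l\<bar> \<le> 2 ^ L" "\<bar>h\<bar> \<le> 2 ^ L" "aval lo m = l"
    and hi: "\<And>i m' xs' ys'. (\<And>w. w \<notin> insert v (mods c) \<Longrightarrow> m' w = m w) \<Longrightarrow> m' v 0 = i \<Longrightarrow>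
        l \<le> i \<Longrightarrow> i \<le> h \<Longrightarrow> I i m' xs' ys' \<Longrightarrow> aval hi m' = h"
    and init: "I l (update m v 0 l) xs ys"
    and step: "\<And>i m' xs' ys'. (\<And>w. w \<notin> insert v (mods c) \<Longrightarrow> m' w = m w) \<Longrightarrow> m' v 0 = i \<Longrightarrow>
        l \<le> i \<Longrightarrow> i < h \<Longrightarrow> I i m' xs' ys' \<Longrightarrow>
        ok L T c m' xs' ys' (\<lambda>m'' xs'' ys''. m'' v 0 = i \<and> I (i + 1) (update m'' v 0 (i + 1)) xs'' ys'')"
    and fin: "\<And>m' xs' ys'. (\<And>w. w \<notin> insert v (mods c) \<Longrightarrow> m' w = m w) \<Longrightarrow> m' v 0 = h \<Longrightarrow>
        I h m' xs' ys' \<Longrightarrow> Q m' xs' ys'"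
  shows "ok L (nat (h - l) * (T + 2) + 2) (For v lo hi c) m xs ys Q"
proof -
  define J where "J k m' xs' ys' \<longleftrightarrow> (\<forall>w. w \<notin> insert v (mods c) \<longrightarrow> m' w = m w) \<and>
    m' v 0 = h - int k \<and> l \<le> h - int k \<and> I (h - int k) m' xs' ys'" for k m' xs' ys'
  let ?c = "Seq c (Assign v (Const 0) (Plus (scal v) (Const 1)))"
  have "ok L (nat (h - l) * ((T + 1) + 1) + 1) (While (Less (scal v) hi) ?c) (update m v 0 l) xs ys (J 0)"
  proof (rule ok_while)
    fix k m' xs' ys' assume J: "J (Suc k) m' xs' ys'"
    let ?i = "h - int (Suc k)"
    have fr: "\<And>w. w \<notin> insert v (mods c) \<Longrightarrow> m' w = m w" and v: "m' v 0 = ?i" and li: "l \<le> ?i"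
      and I: "I ?i m' xs' ys'" using J by (auto simp: J_def)
    have "aval hi m' = h" by (rule hi[OF fr v li _ I]) auto
    then have "bval (Less (scal v) hi) m'" using v by simp
    moreover have lt: "?i < h" by simp
    have "ok L (T + 1) ?c m' xs' ys' (J k)"
    proof (rule ok_seq, rule ok_mono[OF ok_frame[OF step[OF fr v li lt I]] order_refl])
      fix m'' xs'' ys''
      assume 1: "(m'' v 0 = ?i \<and> I (?i + 1) (update m'' v 0 (?i + 1)) xs'' ys'') \<and>
        (\<forall>w. w \<notin> mods c \<longrightarrow> m'' w = m' w)"
      have "\<bar>?i + 1\<bar> \<le> 2 ^ L" using lh li by linarith
      with 1 fr v li show "ok L 1 (Assign v (Const 0) (Plus (scal v) (Const 1))) m'' xs'' ys'' (J k)"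
        by (intro ok_assign) (auto simp: J_def)
    qed
    ultimately show "bval (Less (scal v) hi) m' \<and> ok L (T + 1) ?c m' xs' ys' (J k)" by blast
  next
    fix m' xs' ys' assume J: "J 0 m' xs' ys'"
    have fr: "\<And>w. w \<notin> insert v (mods c) \<Longrightarrow> m' w = m w" and v: "m' v 0 = h" and li: "l \<le> h"
      and I: "I h m' xs' ys'" using J by (auto simp: J_def)
    have "aval hi m' = h" by (rule hi[OF fr v li _ I]) auto
    then show "\<not> bval (Less (scal v) hi) m'" using v by simp
  next
    show "J (nat (h - l)) (update m v 0 l) xs ys" using init lh by (auto simp: J_def)
  qed
  then have "ok L (nat (h - l) * ((T + 1) + 1) + 1) (While (Less (scal v) hi) ?c) (update m v 0 l) xs ys Q"
    by (rule ok_mono) (auto simp: J_def intro!: fin)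
  then have "ok L (1 + (nat (h - l) * ((T + 1) + 1) + 1)) (For v lo hi c) m xs ys Q"
    unfolding For_def using lh by (intro ok_seq ok_assign) auto
  then show ?thesis by (rule ok_mono) auto
qed

text \<open>The variant for commands that touch neither tape.\<close>

definition okm :: "nat \<Rightarrow> nat \<Rightarrow> com \<Rightarrow> mem \<Rightarrow> (mem \<Rightarrow> bool) \<Rightarrow> bool" where
  "okm L T c m Q \<longleftrightarrow> (\<forall>xs ys. ok L T c m xs ys (\<lambda>m' xs' ys'. Q m' \<and> xs' = xs \<and> ys' = ys))"

lemma okmD: "okm L T c m Q \<Longrightarrow> ok L T c m xs ys (\<lambda>m' xs' ys'. Q m' \<and> xs' = xs \<and> ys' = ys)"
  by (simp add: okm_def)

lemma okm_assign:
  "\<bar>aval e2 m\<bar> \<le> 2 ^ L \<Longrightarrow> Q (update m v (aval e1 m) (aval e2 m)) \<Longrightarrow> okm L 1 (Assign v e1 e2) m Q"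
  unfolding okm_def by (intro allI ok_assign) auto

lemma okm_skip: "Q m \<Longrightarrow> okm L 1 Skip m Q"
  unfolding okm_def by (intro allI ok_skip) auto

lemma okm_mono:
  assumes "okm L T c m Q" "T \<le> T'" "\<And>m'. bounded L m' \<Longrightarrow> Q m' \<Longrightarrow> Q' m'"
  shows "okm L T' c m Q'"
  unfolding okm_def
proof (intro allI)
  fix xs ys
  show "ok L T' c m xs ys (\<lambda>m' xs' ys'. Q' m' \<and> xs' = xs \<and> ys' = ys)"
    by (rule ok_mono[OF okmD[OF assms(1)] assms(2)]) (use assms(3) in auto)
qed

lemma okm_seq:
  assumes "okm L T1 c1 m (\<lambda>m'. okm L T2 c2 m' Q)"
  shows "okm L (T1 + T2) (Seq c1 c2) m Q"
  unfolding okm_def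
proof (intro allI ok_seq ok_mono[OF okmD[OF assms] order_refl])
  fix xs ys :: "int list" and m' xs' ys'
  assume "okm L T2 c2 m' Q \<and> xs' = xs \<and> ys' = ys"
  then show "ok L T2 c2 m' xs' ys' (\<lambda>m' xs' ys'. Q m' \<and> xs' = xs \<and> ys' = ys)"
    using okmD[of L T2 c2 m' Q xs ys] by simp
qed

lemma okm_cond:
  "(bval b m \<Longrightarrow> okm L T c1 m Q) \<Longrightarrow> (\<not> bval b m \<Longrightarrow> okm L T c2 m Q) \<Longrightarrow>
    okm L (T + 1) (Cond b c1 c2) m Q"
  unfolding okm_def using ok_cond by blast

lemma okm_frame: "okm L T c m Q \<Longrightarrow> okm L T c m (\<lambda>m'. Q m' \<and> (\<forall>v. v \<notin> mods c \<longrightarrow> m' v = m v))"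
  unfolding okm_def
proof (intro allI)
  fix xs ys
  assume a: "\<forall>xs ys. ok L T c m xs ys (\<lambda>m' xs' ys'. Q m' \<and> xs' = xs \<and> ys' = ys)"
  show "ok L T c m xs ys (\<lambda>m' xs' ys'. (Q m' \<and> (\<forall>v. v \<notin> mods c \<longrightarrow> m' v = m v)) \<and> xs' = xs \<and> ys' = ys)"
    by (rule ok_mono[OF ok_frame[OF a[rule_format]] order_refl]) auto
qed

lemma okm_while:
  assumes "\<And>k m. I (Suc k) m \<Longrightarrow> bval b m \<and> okm L T c m (I k)"
    and "\<And>m. I 0 m \<Longrightarrow> \<not> bval b m" and "I k m"
  shows "okm L (k * (T + 1) + 1) (While b c) m (I 0)"
  unfolding okm_def
proof (intro allI)
  fix xs ys
  show "ok L (k * (T + 1) + 1) (While b c) m xs ys (\<lambda>m' xs' ys'. I 0 m' \<and> xs' = xs \<and> ys' = ys)"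
  proof (rule ok_while[where I = "\<lambda>k m' xs' ys'. I k m' \<and> xs' = xs \<and> ys' = ys"])
    fix k m' xs' ys' assume "I (Suc k) m' \<and> xs' = xs \<and> ys' = ys"
    then show "bval b m' \<and> ok L T c m' xs' ys' (\<lambda>m' xs' ys'. I k m' \<and> xs' = xs \<and> ys' = ys)"
      using assms(1)[of k m'] okmD[of L T c m' "I k" xs ys] by blast
  qed (use assms in auto)
qed

lemma okm_for:
  assumes lh: "l \<le> h" "\<bar>l\<bar> \<le> 2 ^ L" "\<bar>h\<bar> \<le> 2 ^ L" "aval lo m = l"
    and hi: "\<And>i m'. (\<And>w. w \<notin> insert v (mods c) \<Longrightarrow> m' w = m w) \<Longrightarrow> m' v 0 = i \<Longrightarrow>
        l \<le> i \<Longrightarrow> i \<le> h \<Longrightarrow> I i m' \<Longrightarrow> aval hi m' = h"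
    and init: "I l (update m v 0 l)"
    and step: "\<And>i m'. (\<And>w. w \<notin> insert v (mods c) \<Longrightarrow> m' w = m w) \<Longrightarrow> m' v 0 = i \<Longrightarrow>
        l \<le> i \<Longrightarrow> i < h \<Longrightarrow> I i m' \<Longrightarrow>
        okm L T c m' (\<lambda>m''. m'' v 0 = i \<and> I (i + 1) (update m'' v 0 (i + 1)))"
    and fin: "\<And>m'. (\<And>w. w \<notin> insert v (mods c) \<Longrightarrow> m' w = m w) \<Longrightarrow> m' v 0 = h \<Longrightarrow> I h m' \<Longrightarrow> Q m'"
  shows "okm L (nat (h - l) * (T + 2) + 2) (For v lo hi c) m Q"
  unfolding okm_def
proof (intro allI)
  fix xs ys
  show "ok L (nat (h - l) * (T + 2) + 2) (For v lo hi c) m xs ys (\<lambda>m' xs' ys'. Q m' \<and> xs' = xs \<and> ys' = ys)"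
  proof (rule ok_for[where I = "\<lambda>i m' xs' ys'. I i m' \<and> xs' = xs \<and> ys' = ys", OF lh])
    fix i m' xs' ys'
    assume "\<And>w. w \<notin> insert v (mods c) \<Longrightarrow> m' w = m w" "m' v 0 = i" "l \<le> i" "i < h"
      "I i m' \<and> xs' = xs \<and> ys' = ys"
    then show "ok L T c m' xs' ys' (\<lambda>m'' xs'' ys''. m'' v 0 = i \<and>
        I (i + 1) (update m'' v 0 (i + 1)) \<and> xs'' = xs \<and> ys'' = ys)"
      using okmD[OF step[of m' i], of xs' ys'] by simp
  next
    fix i m' xs' ys'
    assume "\<And>w. w \<notin> insert v (mods c) \<Longrightarrow> m' w = m w" "m' v 0 = i" "l \<le> i" "i \<le> h"
      "I i m' \<and> xs' = xs \<and> ys' = ys"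
    then show "aval hi m' = h" using hi[of m' i] by blast
  next
    fix m' xs' ys'
    assume "\<And>w. w \<notin> insert v (mods c) \<Longrightarrow> m' w = m w" "m' v 0 = h" "I h m' \<and> xs' = xs \<and> ys' = ys"
    then show "Q m' \<and> xs' = xs \<and> ys' = ys" using fin[of m'] by blast
  qed (use init in simp)
qed

text \<open>Loops over a range fixed by the matrices are unrolled, so that the loop index is a
  literal and matrix entries can be literals too.\<close>

primrec unroll :: "(nat \<Rightarrow> com) \<Rightarrow> nat \<Rightarrow> com" where
  "unroll f 0 = Skip"
| "unroll f (Suc n) = Seq (unroll f n) (f n)"

lemma ok_unroll:
  assumes "I 0 m xs ys"
    and "\<And>j m xs ys. j < n \<Longrightarrow> I j m xs ys \<Longrightarrow> ok L T (f j) m xs ys (I (Suc j))"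
  shows "ok L (1 + n * T) (unroll f n) m xs ys (I n)"
  using assms
proof (induction n)
  case 0
  then show ?case using ok_skip[of "I 0" m xs ys L] by simp
next
  case (Suc n)
  have "ok L ((1 + n * T) + T) (unroll f (Suc n)) m xs ys (I (Suc n))"
    unfolding unroll.simps
    by (rule ok_seq, rule ok_mono[OF Suc.IH]) (use Suc.prems in auto)
  then show ?case by (simp add: algebra_simps)
qed

lemma okm_unroll:
  assumes "I 0 m" and "\<And>j m. j < n \<Longrightarrow> I j m \<Longrightarrow> okm L T (f j) m (I (Suc j))"
  shows "okm L (1 + n * T) (unroll f n) m (I n)"
  unfolding okm_def
proof (intro allI)
  fix xs ys
  show "ok L (1 + n * T) (unroll f n) m xs ys (\<lambda>m' xs' ys'. I n m' \<and> xs' = xs \<and> ys' = ys)"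
  proof (rule ok_unroll[where I = "\<lambda>k m' xs' ys'. I k m' \<and> xs' = xs \<and> ys' = ys"])
    fix j m' xs' ys' assume "j < n" "I j m' \<and> xs' = xs \<and> ys' = ys"
    then show "ok L T (f j) m' xs' ys' (\<lambda>m' xs' ys'. I (Suc j) m' \<and> xs' = xs \<and> ys' = ys)"
      using assms(2)[of j m'] okmD[of L T "f j" m' "I (Suc j)" xs ys] by blast
  qed (use assms in auto)
qed

section \<open>Dynamic programming over the coordinates\<close>

definition w_exp :: aexp where
  "w_exp = Plus (Times (scal ''f'') (Cell ''c'' (scal ''t''))) (Times (scal ''M'') (Cell ''h'' (scal ''t'')))"

definition val_exp :: aexp where
  "val_exp = Plus (Times w_exp (scal ''g''))
     (Cell ''V'' (Plus (Times (Plus (scal ''t'') (Const 1)) (scal ''D'')) (scal ''sn'')))"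

text \<open>The condition \<open>2 * |sn| < P (t + 1)\<close> takes two comparisons, as expressions
  have no absolute value.\<close>

definition in_range :: bexp where
  "in_range = And (Not (Less (Plus (Times (scal ''mu'') (Cell ''x'' (scal ''t''))) (Times (scal ''lam'') (scal ''g''))) (Const 0)))
     (And (Less (Times (Const 2) (scal ''sn'')) (Cell ''P'' (Plus (scal ''t'') (Const 1))))
          (Less (Minus (Const 0) (Times (Const 2) (scal ''sn''))) (Cell ''P'' (Plus (scal ''t'') (Const 1)))))"

definition next_state :: aexp where
  "next_state = Plus (scal ''S'') (Times (scal ''g'') (Cell ''E'' (scal ''t'')))"

text \<open>The table lies row by row in one array; a row has \<open>D = 2 * Wm\<close> cells, for
  the states from \<open>- Wm\<close> to \<open>Wm - 1\<close>.\<close>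

definition slot :: aexp where
  "slot = Plus (Times (scal ''t'') (scal ''D'')) (scal ''S'')"

abbreviation put :: "string \<Rightarrow> aexp \<Rightarrow> com" where "put v e \<equiv> Assign v (Const 0) e"

definition try_move :: com where
  "try_move = Seq (put ''sn'' next_state)
     (Cond (And in_range (Less val_exp (scal ''best'')))
        (Seq (put ''best'' val_exp) (put ''arg'' (scal ''g''))) Skip)"

definition fill_entry :: com where
  "fill_entry = Seq (put ''best'' (scal ''inf'')) (Seq (put ''arg'' (Const 0))
     (Seq (For ''g'' (Minus (Const 0) (scal ''K'')) (Plus (scal ''K'') (Const 1)) try_move)
     (Seq (Assign ''V'' slot (scal ''best'')) (Assign ''G'' slot (scal ''arg'')))))"

text \<open>Loops count upwards only, hence the counter \<open>u\<close> with
  \<open>t = N - 1 - u\<close>. Only state 0 of the last row receives a value, because a final cap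
  of 1 admits no other final state.\<close>

definition backward :: com where
  "backward = Seq (Assign ''V'' (Times (scal ''N'') (scal ''D'')) (Const 0))
     (For ''u'' (Const 0) (scal ''N'')
        (Seq (put ''t'' (Minus (Minus (scal ''N'') (Const 1)) (scal ''u'')))
             (For ''S'' (Minus (Const 0) (scal ''Wm'')) (scal ''Wm'') fill_entry)))"

definition forward :: com where
  "forward = Seq (put ''S'' (Const 0))
     (For ''t'' (Const 0) (scal ''N'')
        (Seq (put ''g'' (Cell ''G'' slot))
        (Seq (Assign ''x'' (scal ''t'') (Plus (Cell ''x'' (scal ''t'')) (Times (scal ''lam'') (scal ''g''))))
             (put ''S'' next_state))))"

lemma mods_dp [simp]:
  "mods try_move = {''sn'', ''best'', ''arg''}"
  "mods fill_entry = {''sn'', ''best'', ''arg'', ''g'', ''V'', ''G''}"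
  "mods backward = {''sn'', ''best'', ''arg'', ''g'', ''V'', ''G'', ''u'', ''t'', ''S''}"
  "mods forward = {''S'', ''t'', ''g'', ''x''}"
  by (auto simp: try_move_def fill_entry_def backward_def forward_def)

text \<open>\<open>X\<close> is the current point, \<open>w\<close> the objective,
  \<open>E t\<close> the change of state per unit of coordinate \<open>t\<close>, and
  \<open>P t\<close> a strict bound on twice the absolute value of the state before coordinate
  \<open>t\<close>; \<open>P N = 1\<close> forces the final state 0. As \<open>B\<close> bounds the
  contribution of one coordinate, \<open>inf\<close> exceeds the value of every path.\<close>

locale dp =
  fixes N :: nat and K Wm inf B lam :: int and X w E P :: "nat \<Rightarrow> int"
  assumes K: "K \<ge> 0" and Wm: "Wm \<ge> 1"
    and P: "\<And>t. t \<le> N \<Longrightarrow> P t \<ge> 1" "\<And>t. t \<le> N \<Longrightarrow> P t \<le> 2 * Wm" "P N = 1"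
    and B: "\<And>t. t < N \<Longrightarrow> K * \<bar>w t\<bar> \<le> B" "B \<ge> 0" "inf > int N * B"
    and X: "\<And>t. t < N \<Longrightarrow> X t \<ge> 0"
begin

definition adr :: "nat \<Rightarrow> int \<Rightarrow> int" where "adr t S = int t * (2 * Wm) + S"

definition move :: "nat \<Rightarrow> int \<Rightarrow> int \<Rightarrow> bool" where
  "move t S g \<longleftrightarrow> X t + lam * g \<ge> 0 \<and> \<bar>2 * (S + g * E t)\<bar> < P (Suc t)"

definition cand :: "(int \<Rightarrow> int) \<Rightarrow> nat \<Rightarrow> int \<Rightarrow> int \<Rightarrow> int" where
  "cand V t S g = w t * g + V (adr (Suc t) (S + g * E t))"

text \<open>\<open>best\<close> and \<open>arg\<close> minimize \<open>cand\<close> over the moves in \<open>{-K..<i}\<close>; \<open>inf\<close> stands for infeasible.\<close>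

definition minim :: "(int \<Rightarrow> int) \<Rightarrow> nat \<Rightarrow> int \<Rightarrow> int \<Rightarrow> int \<Rightarrow> int \<Rightarrow> bool" where
  "minim V t S i best arg \<longleftrightarrow> best \<le> inf \<and> best \<ge> - (int (N - t) * B) \<and> \<bar>arg\<bar> \<le> K \<and>
     (\<forall>g. - K \<le> g \<and> g < i \<and> move t S g \<longrightarrow> best \<le> cand V t S g) \<and>
     (best < inf \<longrightarrow> move t S arg \<and> best = cand V t S arg)"

definition entry :: "(int \<Rightarrow> int) \<Rightarrow> (int \<Rightarrow> int) \<Rightarrow> nat \<Rightarrow> int \<Rightarrow> bool" where
  "entry V G t S \<longleftrightarrow> minim V t S (K + 1) (V (adr t S)) (G (adr t S))"

definition filled :: "(int \<Rightarrow> int) \<Rightarrow> (int \<Rightarrow> int) \<Rightarrow> nat \<Rightarrow> bool" where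
  "filled V G t0 \<longleftrightarrow> V (adr N 0) = 0 \<and>
     (\<forall>t. t0 \<le> t \<and> t < N \<longrightarrow> (\<forall>S. - Wm \<le> S \<and> S < Wm \<longrightarrow> entry V G t S))"

lemma adr_inj:
  assumes "adr t S = adr t' S'" "- Wm \<le> S" "S < Wm" "- Wm \<le> S'" "S' < Wm"
  shows "t = t' \<and> S = S'"
proof -
  have eq: "(int t - int t') * (2 * Wm) = S' - S" using assms(1) by (simp add: adr_def algebra_simps)
  have "t = t'"
  proof (rule ccontr)
    assume "t \<noteq> t'"
    then have "1 \<le> \<bar>int t - int t'\<bar>" by linarith
    then have "1 * (2 * Wm) \<le> \<bar>int t - int t'\<bar> * (2 * Wm)" using Wm by (intro mult_right_mono) auto
    also have "\<dots> = \<bar>S' - S\<bar>" using eq Wm by (metis abs_mult abs_of_nonneg mult_nonneg_nonneg zero_le_numeral order_trans zero_le_one)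
    finally show False using assms by linarith
  qed
  then show ?thesis using eq by simp
qed

lemma move_range: "t < N \<Longrightarrow> move t S g \<Longrightarrow> - Wm < S + g * E t \<and> S + g * E t < Wm"
  using P(2)[of "Suc t"] unfolding move_def by (simp add: abs_less_iff)

lemma move_last: "Suc t = N \<Longrightarrow> move t S g \<Longrightarrow> S + g * E t = 0"
  using P(3) unfolding move_def by auto

text \<open>Apart from minimality, the lower bound \<open>- (int (N - t) * B)\<close> must be
  carried along; it keeps the table entries within the bit bound.\<close>

lemma minim_step:
  assumes f: "filled V G (Suc t)" and t: "t < N" and m: "minim V t S i best arg" and i: "- K \<le> i" "i \<le> K"
    and mv: "move t S i" and lt: "cand V t S i < best"
  shows "minim V t S (i + 1) (cand V t S i) i"
proof -
  let ?S = "S + i * E t"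
  have "V (adr (Suc t) ?S) \<ge> - (int (N - Suc t) * B)"
  proof (cases "Suc t = N")
    case True
    then show ?thesis using move_last[OF True mv] f by (simp add: filled_def)
  next
    case False
    then have "entry V G (Suc t) ?S" using f t move_range[OF t mv] by (simp add: filled_def)
    then show ?thesis by (simp add: entry_def minim_def)
  qed
  moreover have "w t * i \<ge> - B"
  proof -
    have "\<bar>w t * i\<bar> = \<bar>i\<bar> * \<bar>w t\<bar>" by (simp add: abs_mult)
    also have "\<dots> \<le> K * \<bar>w t\<bar>" using i by (intro mult_right_mono) auto
    also have "\<dots> \<le> B" using B(1)[OF t] .
    finally show ?thesis by linarith
  qed
  moreover have "int (N - t) * B = int (N - Suc t) * B + B"
  proof -
    have "N - t = Suc (N - Suc t)" using t by simp
    then show ?thesis by (simp add: algebra_simps)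
  qed
  ultimately have "cand V t S i \<ge> - (int (N - t) * B)" unfolding cand_def by linarith
  then show ?thesis using m lt mv i unfolding minim_def
    by (smt (verit))
qed

lemma minim_skip:
  assumes "minim V t S i best arg" "\<not> (move t S i \<and> cand V t S i < best)"
  shows "minim V t S (i + 1) best arg"
  using assms unfolding minim_def by (smt (verit))

text \<open>Moves from row \<open>t\<close> reach only cells of row \<open>t + 1\<close> with states
  inside the range, so changes elsewhere in the table are harmless.\<close>

lemma minim_cong:
  assumes "\<And>S'. - Wm \<le> S' \<Longrightarrow> S' < Wm \<Longrightarrow> V' (adr (Suc t) S') = V (adr (Suc t) S')" "t < N"
  shows "minim V' t S i best arg \<longleftrightarrow> minim V t S i best arg"
proof -
  have "cand V' t S g = cand V t S g" if "move t S g" for g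
    using assms(1)[of "S + g * E t"] move_range[OF assms(2) that] by (simp add: cand_def)
  then show ?thesis unfolding minim_def by auto
qed

section \<open>Paths and the Bellman equation\<close>

definition pre :: "(nat \<Rightarrow> int) \<Rightarrow> nat \<Rightarrow> int" where
  "pre g t = (\<Sum>u<t. g u * E u)"

definition valid :: "(nat \<Rightarrow> int) \<Rightarrow> bool" where
  "valid g \<longleftrightarrow> (\<forall>t<N. \<bar>g t\<bar> \<le> K \<and> move t (pre g t) (g t))"

definition wdot :: "(nat \<Rightarrow> int) \<Rightarrow> int" where
  "wdot g = (\<Sum>t<N. w t * g t)"

lemma pre_Suc [simp]: "pre g (Suc t) = pre g t + g t * E t"
  by (simp add: pre_def)

lemma valid_range:
  assumes "valid g" "t \<le> N"
  shows "- Wm < pre g t \<and> pre g t < Wm"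
proof (cases t)
  case 0
  then show ?thesis using Wm by (simp add: pre_def)
next
  case (Suc u)
  then show ?thesis using assms move_range[of u "pre g u" "g u"] by (simp add: valid_def)
qed

lemma valid_end:
  assumes "valid g"
  shows "pre g N = 0"
proof (cases N)
  case (Suc u)
  then have "move u (pre g u) (g u)" using assms unfolding valid_def by blast
  with Suc show ?thesis using move_last[of u "pre g u" "g u"] by simp
qed (simp add: pre_def)

text \<open>The lower-bound half of Bellman's principle, by induction from the last coordinate;
  attainment comes from \<open>follow\<close>.\<close>

lemma table_le:
  assumes f: "filled V G 0" and g: "valid g" and t: "t \<le> N"
  shows "V (adr t (pre g t)) \<le> (\<Sum>u=t..<N. w u * g u)"
  using t
proof (induction "N - t" arbitrary: t)
  case 0
  then have "t = N" by simp
  moreover have "pre g N = 0" by (rule valid_end[OF g])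
  ultimately show ?case using f by (simp add: filled_def)
next
  case (Suc k)
  then have t: "t < N" by simp
  have "entry V G t (pre g t)" using f t valid_range[OF g, of t] by (simp add: filled_def)
  then have "V (adr t (pre g t)) \<le> cand V t (pre g t) (g t)"
  proof -
    have "\<forall>h. - K \<le> h \<and> h < K + 1 \<and> move t (pre g t) h \<longrightarrow> V (adr t (pre g t)) \<le> cand V t (pre g t) h"
      using \<open>entry V G t (pre g t)\<close> by (simp add: entry_def minim_def)
    moreover have "- K \<le> g t \<and> g t < K + 1 \<and> move t (pre g t) (g t)"
      using g t by (auto simp: valid_def abs_le_iff)
    ultimately show ?thesis by blast
  qed
  also have "\<dots> \<le> w t * g t + (\<Sum>u=Suc t..<N. w u * g u)"
    using Suc.hyps(1)[of "Suc t"] Suc.hyps(2) t by (simp add: cand_def)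
  also have "\<dots> = (\<Sum>u=t..<N. w u * g u)" using t by (simp add: sum.atLeast_Suc_lessThan)
  finally show ?case .
qed

lemma table_le_0: "filled V G 0 \<Longrightarrow> valid g \<Longrightarrow> V 0 \<le> wdot g"
  using table_le[of V G g 0] by (simp add: adr_def pre_def wdot_def atLeast0LessThan)

text \<open>Staying at the current point is always a path, so the value at the origin of the table
  is at most 0 and thereby finite.\<close>

lemma valid_zero: "valid (\<lambda>_. 0)"
  unfolding valid_def move_def pre_def
proof (intro allI impI conjI)
  fix t assume "t < N"
  then show "\<bar>2 * ((\<Sum>u<t. 0 * E u) + 0 * E t)\<bar> < P (Suc t)" using P(1)[of "Suc t"] by simp
qed (use X K in auto)

lemma table_nonpos: "filled V G 0 \<Longrightarrow> V 0 \<le> 0"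
  using table_le_0[OF _ valid_zero] by (simp add: wdot_def)

definition upto :: "(nat \<Rightarrow> int) \<Rightarrow> nat \<Rightarrow> bool" where
  "upto g t \<longleftrightarrow> (\<forall>u<t. \<bar>g u\<bar> \<le> K \<and> move u (pre g u) (g u))"

lemma follow:
  assumes f: "filled V G 0" and g: "upto g t" and t: "t < N"
    and V: "V (adr t (pre g t)) = V 0 - (\<Sum>u<t. w u * g u)"
  defines "a \<equiv> G (adr t (pre g t))"
  shows "upto (g(t := a)) (Suc t)" "pre (g(t := a)) t = pre g t"
    "V (adr (Suc t) (pre (g(t := a)) (Suc t))) = V 0 - (\<Sum>u<Suc t. w u * (g(t := a)) u)"
    "\<bar>a\<bar> \<le> K"
proof -
  let ?S = "pre g t"
  have r: "- Wm < ?S \<and> ?S < Wm"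
  proof (cases t)
    case 0
    then show ?thesis using Wm by (simp add: pre_def)
  next
    case (Suc u)
    then show ?thesis using g t move_range[of u "pre g u" "g u"] by (simp add: upto_def)
  qed
  then have e: "minim V t ?S (K + 1) (V (adr t ?S)) a"
    using f t unfolding filled_def entry_def a_def by auto
  \<comment> \<open>The value still to be attained is \<open>V 0\<close> minus the cost so far,
    hence at most \<open>int N * B\<close> and below \<open>inf\<close>. The stored argument is
    therefore a genuine minimizer and not the default 0.\<close>
  have "\<bar>w u * g u\<bar> \<le> B" if "u < t" for u
  proof -
    have "\<bar>w u * g u\<bar> = \<bar>g u\<bar> * \<bar>w u\<bar>" by (simp add: abs_mult)
    also have "\<dots> \<le> K * \<bar>w u\<bar>" using g that by (intro mult_right_mono) (auto simp: upto_def)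
    also have "\<dots> \<le> B" using B(1) that t by simp
    finally show ?thesis .
  qed
  then have "(\<Sum>u<t. - (w u * g u)) \<le> (\<Sum>u<t. B)" by (intro sum_mono) (smt (verit) lessThan_iff)
  then have "- (\<Sum>u<t. w u * g u) \<le> int t * B" by (simp add: sum_negf)
  also have "\<dots> \<le> int N * B" using t B(2) by (intro mult_right_mono) auto
  finally have "V (adr t ?S) < inf" using V B(3) table_nonpos[OF f] by linarith
  with e have mv: "move t ?S a" and eq: "V (adr t ?S) = cand V t ?S a" and a: "\<bar>a\<bar> \<le> K"
    by (auto simp: minim_def)
  have pre: "pre (g(t := a)) u = pre g u" if "u \<le> t" for u
    unfolding pre_def using that by (intro sum.cong) auto
  show "pre (g(t := a)) t = pre g t" by (simp add: pre)
  show "upto (g(t := a)) (Suc t)" using g mv a pre by (auto simp: upto_def less_Suc_eq)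
  have "(\<Sum>u<t. w u * (g(t := a)) u) = (\<Sum>u<t. w u * g u)" by (intro sum.cong) auto
  then show "V (adr (Suc t) (pre (g(t := a)) (Suc t))) = V 0 - (\<Sum>u<Suc t. w u * (g(t := a)) u)"
    using eq V by (simp add: cand_def pre)
  show "\<bar>a\<bar> \<le> K" by (fact a)
qed

end

section \<open>Correctness and step counts of the two passes\<close>

locale dp_machine = dp +
  fixes L :: nat
  assumes fits: "int N \<le> 2 ^ L" "K + 1 \<le> 2 ^ L" "Wm \<le> 2 ^ L" "inf \<le> 2 ^ L" "int N * B \<le> 2 ^ L"
    "\<And>t. t < N \<Longrightarrow> Wm + K * \<bar>E t\<bar> \<le> 2 ^ L"
begin

text \<open>\<open>X\<close> and \<open>w\<close> are tied to the memory only through the products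
  that the program forms, so one program serves the unboundedness test and all scaling rounds under
  different flags.\<close>

definition env :: "mem \<Rightarrow> bool" where
  "env m \<longleftrightarrow> m ''N'' 0 = int N \<and> m ''K'' 0 = K \<and> m ''D'' 0 = 2 * Wm \<and> m ''Wm'' 0 = Wm \<and>
     m ''lam'' 0 = lam \<and> m ''inf'' 0 = inf \<and>
     (\<forall>t<N. m ''mu'' 0 * m ''x'' (int t) = X t \<and> m ''E'' (int t) = E t \<and>
        m ''f'' 0 * m ''c'' (int t) + m ''M'' 0 * m ''h'' (int t) = w t) \<and>
     (\<forall>t\<le>N. m ''P'' (int t) = P t)"

definition env_vars :: "string set" where
  "env_vars = {''N'', ''K'', ''D'', ''Wm'', ''lam'', ''inf'', ''mu'', ''x'', ''E'', ''f'', ''c'', ''M'', ''h'', ''P''}"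

lemma env_frame:
  assumes "env m" "\<And>v. v \<notin> F \<Longrightarrow> m' v = m v" "\<forall>v\<in>F. v \<notin> env_vars"
  shows "env m'"
proof -
  have "\<forall>v\<in>env_vars. m' v = m v" using assms(2,3) by blast
  then show ?thesis using assms(1) unfolding env_def env_vars_def by simp
qed

lemma okm_try_move:
  assumes e: "env m" and f: "filled (m ''V'') (m ''G'') (Suc t)" and t: "t < N" "m ''t'' 0 = int t"
    and S: "m ''S'' 0 = S" "- Wm \<le> S" "S < Wm" and g: "m ''g'' 0 = g" "- K \<le> g" "g \<le> K"
    and mi: "minim (m ''V'') t S g (m ''best'' 0) (m ''arg'' 0)"
  shows "okm L (1 + ((1 + 1) + 1)) try_move m
    (\<lambda>m'. minim (m ''V'') t S (g + 1) (m' ''best'' 0) (m' ''arg'' 0))"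
proof -
  have sn: "\<bar>S + g * E t\<bar> \<le> 2 ^ L"
  proof -
    have "\<bar>g * E t\<bar> = \<bar>g\<bar> * \<bar>E t\<bar>" by (simp add: abs_mult)
    also have "\<dots> \<le> K * \<bar>E t\<bar>" using g by (intro mult_right_mono) auto
    finally show ?thesis using fits(6)[OF t(1)] S by linarith
  qed
  let ?m = "update m ''sn'' 0 (S + g * E t)"
  have ev: "aval next_state m = S + g * E t" using e t S g by (simp add: next_state_def env_def)
  have Pt: "m ''P'' (int t + 1) = P (Suc t)"
    using e t(1) by (simp add: env_def add.commute[of _ 1] flip: of_nat_Suc)
  have "int t + 1 = int (Suc t)" by simp
  then have c: "aval val_exp ?m = cand (m ''V'') t S g"
    using e t S g unfolding env_def by (simp add: val_exp_def w_exp_def cand_def adr_def algebra_simps)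
  have b: "bval in_range ?m \<longleftrightarrow> move t S g"
    using e t S g Pt unfolding env_def by (simp add: in_range_def move_def not_less abs_less_iff)
  have i1: "\<bar>g\<bar> \<le> 2 ^ L" using g fits(2) by linarith
  have step: "minim (m ''V'') t S (g + 1) (cand (m ''V'') t S g) g" "\<bar>cand (m ''V'') t S g\<bar> \<le> 2 ^ L"
    if a: "move t S g" "cand (m ''V'') t S g < m ''best'' 0"
  proof -
    show 1: "minim (m ''V'') t S (g + 1) (cand (m ''V'') t S g) g"
      using minim_step[OF f t(1) mi g(2,3) a] .
    have "int (N - t) * B \<le> int N * B" using B(2) by (intro mult_right_mono) auto
    then show "\<bar>cand (m ''V'') t S g\<bar> \<le> 2 ^ L" using 1 fits(4,5) unfolding minim_def by linarith
  qed
  show ?thesis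
    unfolding try_move_def
  proof (intro okm_seq okm_assign, goal_cases)
    case 1
    then show ?case using sn ev by simp
  next
    case 2
    show ?case
    proof (intro okm_cond)
      assume "bval (And in_range (Less val_exp (scal ''best''))) (update m ''sn'' (aval (Const 0) m) (aval next_state m))"
      then have a: "move t S g" "cand (m ''V'') t S g < m ''best'' 0" using b c ev by simp_all
      show "okm L (1 + 1) (Seq (put ''best'' val_exp) (put ''arg'' (scal ''g'')))
          (update m ''sn'' (aval (Const 0) m) (aval next_state m))
          (\<lambda>m'. minim (m ''V'') t S (g + 1) (m' ''best'' 0) (m' ''arg'' 0))"
        by (intro okm_seq okm_assign) (use step[OF a] c ev g(1) i1 in \<open>simp_all\<close>)
    next
      assume "\<not> bval (And in_range (Less val_exp (scal ''best''))) (update m ''sn'' (aval (Const 0) m) (aval next_state m))"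
      then have a: "\<not> (move t S g \<and> cand (m ''V'') t S g < m ''best'' 0)" using b c ev by simp
      show "okm L (1 + 1) Skip (update m ''sn'' (aval (Const 0) m) (aval next_state m))
          (\<lambda>m'. minim (m ''V'') t S (g + 1) (m' ''best'' 0) (m' ''arg'' 0))"
        by (rule okm_mono[OF okm_skip[of "\<lambda>m'. minim (m ''V'') t S (g + 1) (m' ''best'' 0) (m' ''arg'' 0)"]])
          (use minim_skip[OF mi a] in simp_all)
    qed
  qed
qed

definition T_entry :: nat where
  "T_entry = 1 + (1 + ((nat (K + 1 - (- K)) * ((1 + ((1 + 1) + 1)) + 2) + 2) + (1 + 1)))"

text \<open>Distinct rows occupy distinct cells, and entries of rows after \<open>t\<close> refer to
  later rows only, so writing into row \<open>t\<close> leaves them correct.\<close>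

lemma filled_update:
  assumes "filled V G (Suc t)" "t < N" "- Wm \<le> S" "S < Wm"
  shows "filled (V(adr t S := a)) (G(adr t S := b)) (Suc t)"
  unfolding filled_def
proof (intro conjI allI impI)
  show "(V(adr t S := a)) (adr N 0) = 0"
    using assms adr_inj[of N 0 t S] Wm by (auto simp: filled_def)
  fix t' S' assume h: "Suc t \<le> t' \<and> t' < N" "- Wm \<le> S' \<and> S' < Wm"
  have ne: "adr u U \<noteq> adr t S" if "Suc t \<le> u" "- Wm \<le> U" "U < Wm" for u U
    using adr_inj[of u U t S] that assms by auto
  have "minim (V(adr t S := a)) t' S' (K + 1) (V (adr t' S')) (G (adr t' S'))
      = minim V t' S' (K + 1) (V (adr t' S')) (G (adr t' S'))"
    using ne h by (intro minim_cong) auto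
  then show "entry (V(adr t S := a)) (G(adr t S := b)) t' S'"
    using assms(1) h ne[of t' S'] by (simp add: filled_def entry_def)
qed

definition row :: "(int \<Rightarrow> int) \<Rightarrow> (int \<Rightarrow> int) \<Rightarrow> nat \<Rightarrow> int \<Rightarrow> bool" where
  "row V G t S0 \<longleftrightarrow> filled V G (Suc t) \<and> (\<forall>S. - Wm \<le> S \<and> S < S0 \<longrightarrow> entry V G t S)"

lemma row_update:
  assumes "row V G t S" "t < N" "- Wm \<le> S" "S < Wm" "minim V t S (K + 1) a b"
  shows "row (V(adr t S := a)) (G(adr t S := b)) t (S + 1)"
  unfolding row_def
proof (intro conjI allI impI)
  show "filled (V(adr t S := a)) (G(adr t S := b)) (Suc t)"
    using assms by (intro filled_update) (auto simp: row_def)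
  fix S' assume h: "- Wm \<le> S' \<and> S' < S + 1"
  have ne: "adr (Suc t) U \<noteq> adr t S" if "- Wm \<le> U" "U < Wm" for U
    using adr_inj[of "Suc t" U t S] that assms by auto
  have c: "minim (V(adr t S := a)) t S' i x y = minim V t S' i x y" for i x y
    using ne assms(2) by (intro minim_cong) auto
  show "entry (V(adr t S := a)) (G(adr t S := b)) t S'"
  proof (cases "S' = S")
    case True
    then show ?thesis using assms(5) c by (simp add: entry_def)
  next
    case False
    then have "adr t S' \<noteq> adr t S" using adr_inj[of t S' t S] h assms by auto
    then show ?thesis using assms(1) h False c by (simp add: entry_def row_def)
  qed
qed

lemma row_full: "row V G t Wm \<Longrightarrow> filled V G t"
  unfolding row_def filled_def
proof (elim conjE, intro conjI allI impI)
  fix t' S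
  assume "\<forall>ta. Suc t \<le> ta \<and> ta < N \<longrightarrow> (\<forall>S. - Wm \<le> S \<and> S < Wm \<longrightarrow> entry V G ta S)"
    "\<forall>S. - Wm \<le> S \<and> S < Wm \<longrightarrow> entry V G t S" "t \<le> t' \<and> t' < N" "- Wm \<le> S \<and> S < Wm"
  then show "entry V G t' S" by (cases "t' = t") auto
qed

lemma okm_fill_entry:
  assumes e: "env m" and f: "row (m ''V'') (m ''G'') t S" and t: "t < N" "m ''t'' 0 = int t"
    and S: "m ''S'' 0 = S" "- Wm \<le> S" "S < Wm"
  shows "okm L T_entry fill_entry m (\<lambda>m'. row (m' ''V'') (m' ''G'') t (S + 1))"
proof -
  have inf0: "inf \<ge> 0" using B by (smt (verit) mult_nonneg_nonneg of_nat_0_le_iff)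
  have "int (N - t) * B \<ge> 0" using B(2) by simp
  \<comment> \<open>\<open>inf\<close> together with the default argument 0 describes the minimum
    over the empty range of moves.\<close>
  then have start: "minim (m ''V'') t S (- K) inf 0" using inf0 K by (simp add: minim_def)
  define m1 where "m1 = update (update m ''best'' 0 inf) ''arg'' 0 0"
  have loop: "okm L (nat (K + 1 - (- K)) * ((1 + ((1 + 1) + 1)) + 2) + 2)
      (For ''g'' (Minus (Const 0) (scal ''K'')) (Plus (scal ''K'') (Const 1)) try_move) m1
      (\<lambda>m2. okm L (1 + 1) (Seq (Assign ''V'' slot (scal ''best'')) (Assign ''G'' slot (scal ''arg''))) m2
        (\<lambda>m'. row (m' ''V'') (m' ''G'') t (S + 1)))"
  proof (rule okm_for[where I = "\<lambda>i m2. minim (m ''V'') t S i (m2 ''best'' 0) (m2 ''arg'' 0)"])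
    show "- K \<le> K + 1" "\<bar>- K\<bar> \<le> 2 ^ L" "\<bar>K + 1\<bar> \<le> 2 ^ L" using K fits(2) by auto
    show "aval (Minus (Const 0) (scal ''K'')) m1 = - K" using e by (simp add: m1_def env_def)
    show "minim (m ''V'') t S (- K) (update m1 ''g'' 0 (- K) ''best'' 0) (update m1 ''g'' 0 (- K) ''arg'' 0)"
      using start by (simp add: m1_def)
  next
    fix i m2 assume fr: "\<And>v. v \<notin> insert ''g'' (mods try_move) \<Longrightarrow> m2 v = m1 v"
    then have fr': "\<And>v. v \<notin> {''g'', ''sn'', ''best'', ''arg''} \<Longrightarrow> m2 v = m v" by (simp add: m1_def)
    show "aval (Plus (scal ''K'') (Const 1)) m2 = K + 1" using e fr'[of "''K''"] by (simp add: env_def)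
    assume i: "m2 ''g'' 0 = i" "- K \<le> i" "i < K + 1" and mi: "minim (m ''V'') t S i (m2 ''best'' 0) (m2 ''arg'' 0)"
    have "env m2" by (rule env_frame[OF e, of "{''g'', ''sn'', ''best'', ''arg''}"]) (simp_all add: env_vars_def fr')
    moreover have "m2 ''V'' = m ''V''" "m2 ''G'' = m ''G''" "m2 ''t'' = m ''t''" "m2 ''S'' = m ''S''" by (simp_all add: fr')
    ultimately have "okm L (1 + ((1 + 1) + 1)) try_move m2
      (\<lambda>m'. minim (m2 ''V'') t S (i + 1) (m' ''best'' 0) (m' ''arg'' 0))"
      using f t S i mi by (intro okm_try_move) (auto simp: row_def)
    from okm_frame[OF this] show "okm L (1 + ((1 + 1) + 1)) try_move m2 (\<lambda>m''. m'' ''g'' 0 = i \<and>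
        minim (m ''V'') t S (i + 1) (update m'' ''g'' 0 (i + 1) ''best'' 0) (update m'' ''g'' 0 (i + 1) ''arg'' 0))"
      by (rule okm_mono) (use \<open>m2 ''V'' = m ''V''\<close> i in auto)
  next
    fix m2 assume fr: "\<And>v. v \<notin> insert ''g'' (mods try_move) \<Longrightarrow> m2 v = m1 v"
      and mi: "minim (m ''V'') t S (K + 1) (m2 ''best'' 0) (m2 ''arg'' 0)"
    then have fr': "\<And>v. v \<notin> {''g'', ''sn'', ''best'', ''arg''} \<Longrightarrow> m2 v = m v" by (simp add: m1_def)
    have eq: "m2 ''V'' = m ''V''" "m2 ''G'' = m ''G''" "m2 ''t'' 0 = int t" "m2 ''S'' 0 = S" "m2 ''D'' 0 = 2 * Wm"
      using fr' t S e by (simp_all add: env_def)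
    have "int (N - t) * B \<le> int N * B" using B(2) by (intro mult_right_mono) auto
    then have bb: "\<bar>m2 ''best'' 0\<bar> \<le> 2 ^ L" "\<bar>m2 ''arg'' 0\<bar> \<le> 2 ^ L"
      using mi fits unfolding minim_def by linarith+
    have "row ((m ''V'')(adr t S := m2 ''best'' 0)) ((m ''G'')(adr t S := m2 ''arg'' 0)) t (S + 1)"
      by (rule row_update[OF f t(1) S(2,3) mi])
    then show "okm L (1 + 1) (Seq (Assign ''V'' slot (scal ''best'')) (Assign ''G'' slot (scal ''arg''))) m2
        (\<lambda>m'. row (m' ''V'') (m' ''G'') t (S + 1))"
      by (intro okm_seq okm_assign) (use bb eq in \<open>simp_all add: slot_def adr_def\<close>)
  qed
  have m1: "update (update m ''best'' (aval (Const 0) m) (aval (scal ''inf'') m)) ''arg''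
      (aval (Const 0) (update m ''best'' (aval (Const 0) m) (aval (scal ''inf'') m)))
      (aval (Const 0) (update m ''best'' (aval (Const 0) m) (aval (scal ''inf'') m))) = m1"
    using e by (simp add: m1_def env_def)
  show ?thesis
    unfolding T_entry_def fill_entry_def
    by (rule okm_seq, rule okm_assign, use e fits(4) inf0 in \<open>simp add: env_def\<close>,
        rule okm_seq, rule okm_assign, simp, rule okm_seq, unfold m1, rule loop)
qed

definition T_row :: nat where
  "T_row = 1 + (nat (Wm - (- Wm)) * (T_entry + 2) + 2)"

lemma okm_row:
  assumes e: "env m" and f: "filled (m ''V'') (m ''G'') (Suc t)" and t: "t < N" "m ''u'' 0 = int N - 1 - int t"
  shows "okm L T_row (Seq (put ''t'' (Minus (Minus (scal ''N'') (Const 1)) (scal ''u'')))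
      (For ''S'' (Minus (Const 0) (scal ''Wm'')) (scal ''Wm'') fill_entry)) m
    (\<lambda>m'. filled (m' ''V'') (m' ''G'') t)"
proof -
  define m1 where "m1 = update m ''t'' 0 (int t)"
  have e1: "env m1" unfolding m1_def by (rule env_frame[OF e, of "{''t''}"]) (simp_all add: env_vars_def)
  have "okm L (nat (Wm - (- Wm)) * (T_entry + 2) + 2)
      (For ''S'' (Minus (Const 0) (scal ''Wm'')) (scal ''Wm'') fill_entry) m1 (\<lambda>m'. filled (m' ''V'') (m' ''G'') t)"
  proof (rule okm_for[where I = "\<lambda>i m'. row (m' ''V'') (m' ''G'') t i"])
    show "- Wm \<le> Wm" "\<bar>- Wm\<bar> \<le> 2 ^ L" "\<bar>Wm\<bar> \<le> 2 ^ L" using Wm fits(3) by auto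
    show "aval (Minus (Const 0) (scal ''Wm'')) m1 = - Wm" using e1 by (simp add: env_def)
    show "row (update m1 ''S'' 0 (- Wm) ''V'') (update m1 ''S'' 0 (- Wm) ''G'') t (- Wm)"
      using f by (auto simp: m1_def row_def)
  next
    fix i m2 assume fr: "\<And>v. v \<notin> insert ''S'' (mods fill_entry) \<Longrightarrow> m2 v = m1 v"
    show "aval (scal ''Wm'') m2 = Wm" using e1 fr by (simp add: env_def)
    assume i: "m2 ''S'' 0 = i" "- Wm \<le> i" "i < Wm" "row (m2 ''V'') (m2 ''G'') t i"
    have "env m2" by (rule env_frame[OF e1, of "insert ''S'' (mods fill_entry)"]) (simp_all add: env_vars_def fr)
    moreover have "m2 ''t'' 0 = int t" using fr by (simp add: m1_def)
    ultimately have "okm L T_entry fill_entry m2 (\<lambda>m'. row (m' ''V'') (m' ''G'') t (i + 1))"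
      using i t by (intro okm_fill_entry) auto
    from okm_frame[OF this] show "okm L T_entry fill_entry m2 (\<lambda>m''. m'' ''S'' 0 = i \<and>
        row (update m'' ''S'' 0 (i + 1) ''V'') (update m'' ''S'' 0 (i + 1) ''G'') t (i + 1))"
      by (rule okm_mono) (use i in auto)
  qed (rule row_full)
  moreover have "update m ''t'' (aval (Const 0) m) (aval (Minus (Minus (scal ''N'') (Const 1)) (scal ''u'')) m) = m1"
    using e t by (simp add: m1_def env_def)
  moreover have "\<bar>aval (Minus (Minus (scal ''N'') (Const 1)) (scal ''u'')) m\<bar> \<le> 2 ^ L"
    using e t fits(1) by (simp add: env_def)
  ultimately show ?thesis unfolding T_row_def by (intro okm_seq okm_assign) simp_all
qed

definition T_backward :: nat where
  "T_backward = 1 + (N * (T_row + 2) + 2)"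

lemma okm_backward:
  assumes e: "env m"
  shows "okm L T_backward backward m (\<lambda>m'. filled (m' ''V'') (m' ''G'') 0)"
proof -
  define m1 where "m1 = update m ''V'' (int N * (2 * Wm)) 0"
  let ?body = "Seq (put ''t'' (Minus (Minus (scal ''N'') (Const 1)) (scal ''u'')))
      (For ''S'' (Minus (Const 0) (scal ''Wm'')) (scal ''Wm'') fill_entry)"
  have e1: "env m1" unfolding m1_def by (rule env_frame[OF e, of "{''V''}"]) (simp_all add: env_vars_def)
  have "okm L (nat (int N - 0) * (T_row + 2) + 2) (For ''u'' (Const 0) (scal ''N'') ?body) m1
    (\<lambda>m'. filled (m' ''V'') (m' ''G'') 0)"
  proof (rule okm_for[where I = "\<lambda>i m'. filled (m' ''V'') (m' ''G'') (N - nat i)"])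
    show "0 \<le> int N" "\<bar>0\<bar> \<le> (2 :: int) ^ L" "\<bar>int N\<bar> \<le> 2 ^ L" using fits(1) by auto
    show "filled (update m1 ''u'' 0 0 ''V'') (update m1 ''u'' 0 0 ''G'') (N - nat 0)"
      by (auto simp: m1_def filled_def adr_def)
  next
    fix i m2 assume fr: "\<And>v. v \<notin> insert ''u'' (mods ?body) \<Longrightarrow> m2 v = m1 v"
    show "aval (scal ''N'') m2 = int N" using e1 fr by (simp add: env_def)
    assume i: "m2 ''u'' 0 = i" "0 \<le> i" "i < int N" "filled (m2 ''V'') (m2 ''G'') (N - nat i)"
    have "env m2" by (rule env_frame[OF e1, of "insert ''u'' (mods ?body)"]) (simp_all add: env_vars_def fr)
    moreover have "N - nat i = Suc (N - nat i - 1)" "int (N - nat i - 1) = int N - 1 - i" using i by auto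
    ultimately have "okm L T_row ?body m2 (\<lambda>m'. filled (m' ''V'') (m' ''G'') (N - nat i - 1))"
      using i by (intro okm_row) auto
    moreover have "N - nat (i + 1) = N - nat i - 1" using i by simp
    ultimately show "okm L T_row ?body m2 (\<lambda>m''. m'' ''u'' 0 = i \<and>
        filled (update m'' ''u'' 0 (i + 1) ''V'') (update m'' ''u'' 0 (i + 1) ''G'') (N - nat (i + 1)))"
      using i by (auto intro: okm_mono[OF okm_frame])
  qed simp_all
  then show ?thesis unfolding T_backward_def backward_def
    by (intro okm_seq okm_assign) (use e in \<open>simp_all add: m1_def env_def\<close>)
qed

definition T_forward :: nat where
  "T_forward = 1 + (N * (1 + (1 + 1) + 2) + 2)"

lemma okm_forward:
  assumes e: "env m" and f: "filled (m ''V'') (m ''G'') 0"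
    and fit: "\<And>t. t < N \<Longrightarrow> \<bar>m ''x'' (int t)\<bar> + \<bar>lam\<bar> * K \<le> 2 ^ L"
  shows "okm L T_forward forward m (\<lambda>m'. \<exists>g. valid g \<and> wdot g = m ''V'' 0 \<and>
    (\<forall>t<N. m' ''x'' (int t) = m ''x'' (int t) + lam * g t))"
proof -
  define m1 where "m1 = update m ''S'' 0 0"
  let ?body = "Seq (put ''g'' (Cell ''G'' slot))
        (Seq (Assign ''x'' (scal ''t'') (Plus (Cell ''x'' (scal ''t'')) (Times (scal ''lam'') (scal ''g''))))
             (put ''S'' next_state))"
  \<comment> \<open>The last clause keeps the coordinates from \<open>i\<close> on at their initial
    values, to which the coming steps are added.\<close>
  define I where "I i m' \<longleftrightarrow> (\<exists>g. upto g (nat i) \<and> m' ''S'' 0 = pre g (nat i) \<and>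
      m ''V'' (adr (nat i) (pre g (nat i))) = m ''V'' 0 - (\<Sum>u<nat i. w u * g u) \<and>
      (\<forall>t<nat i. m' ''x'' (int t) = m ''x'' (int t) + lam * g t) \<and>
      (\<forall>j. j < 0 \<or> j \<ge> i \<longrightarrow> m' ''x'' j = m ''x'' j))" for i :: int and m' :: mem
  have "okm L (nat (int N - 0) * ((1 + (1 + 1)) + 2) + 2) (For ''t'' (Const 0) (scal ''N'') ?body) m1
    (\<lambda>m'. \<exists>g. valid g \<and> wdot g = m ''V'' 0 \<and>
      (\<forall>t<N. m' ''x'' (int t) = m ''x'' (int t) + lam * g t))"
  proof (rule okm_for[where I = I])
    show "0 \<le> int N" "\<bar>0\<bar> \<le> (2 :: int) ^ L" "\<bar>int N\<bar> \<le> 2 ^ L" using fits(1) by auto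
    show "I 0 (update m1 ''t'' 0 0)" by (simp add: I_def m1_def upto_def pre_def adr_def)
  next
    fix i m2 assume fr: "\<And>v. v \<notin> insert ''t'' (mods ?body) \<Longrightarrow> m2 v = m1 v"
    show "aval (scal ''N'') m2 = int N" using e fr by (simp add: env_def m1_def)
    assume i: "m2 ''t'' 0 = i" "0 \<le> i" "i < int N" and I: "I i m2"
    define t where "t = nat i"
    have it: "i = int t" "t < N" "nat (int t + 1) = Suc t" using i by (auto simp: t_def)
    have vals: "m2 ''D'' 0 = 2 * Wm" "m2 ''lam'' 0 = lam" "m2 ''E'' (int t) = E t" "m2 ''G'' = m ''G''"
      using e fr it by (simp_all add: env_def m1_def)
    from I obtain g where g: "upto g t" "m2 ''S'' 0 = pre g t"
      "m ''V'' (adr t (pre g t)) = m ''V'' 0 - (\<Sum>u<t. w u * g u)"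
      "\<forall>u<t. m2 ''x'' (int u) = m ''x'' (int u) + lam * g u" "\<forall>j. j < 0 \<or> j \<ge> i \<longrightarrow> m2 ''x'' j = m ''x'' j"
      unfolding I_def t_def by blast
    define a where "a = m ''G'' (adr t (pre g t))"
    note fo = follow[OF f g(1) it(2) g(3), folded a_def]
    let ?g = "g(t := a)"
    have ab: "\<bar>a\<bar> \<le> 2 ^ L" using fo(4) fits(2) by linarith
    have xb: "\<bar>m2 ''x'' (int t) + lam * a\<bar> \<le> 2 ^ L"
    proof -
      have "\<bar>lam * a\<bar> \<le> \<bar>lam\<bar> * K" unfolding abs_mult using fo(4) by (intro mult_left_mono) auto
      moreover have "m2 ''x'' (int t) = m ''x'' (int t)" using g(5) it by simp
      ultimately show ?thesis using fit[OF it(2)] by linarith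
    qed
    have Sb: "\<bar>pre g t + a * E t\<bar> \<le> 2 ^ L"
    proof -
      have "move t (pre ?g t) (?g t)" using fo(1) by (auto simp: upto_def)
      then have "move t (pre g t) a" using fo(2) by simp
      from move_range[OF it(2) this] fits(3) show ?thesis by linarith
    qed
    have av: "m ''G'' (int t * (2 * Wm) + pre g t) = a" by (simp add: a_def adr_def)
    have Inew: "I (int t + 1) m'" if "m' ''S'' 0 = pre g t + a * E t"
      "m' ''x'' = (m2 ''x'')(int t := m2 ''x'' (int t) + lam * a)" for m'
      unfolding I_def it
    proof (intro exI[of _ ?g] conjI allI impI)
      show "upto ?g (Suc t)" by (rule fo(1))
      show "m' ''S'' 0 = pre ?g (Suc t)" using that(1) fo(2) by simp
      show "m ''V'' (adr (Suc t) (pre ?g (Suc t))) = m ''V'' 0 - (\<Sum>u<Suc t. w u * ?g u)" by (rule fo(3))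
      show "m' ''x'' (int u) = m ''x'' (int u) + lam * ?g u" if u: "u < Suc t" for u
        using u g(4,5) it(1) \<open>m' ''x'' = _\<close> by (cases "u = t") auto
      show "m' ''x'' j = m ''x'' j" if j: "j < 0 \<or> j \<ge> int t + 1" for j
        using j g(5) it(1) \<open>m' ''x'' = _\<close> by auto
    qed
    show "okm L (1 + (1 + 1)) ?body m2 (\<lambda>m''. m'' ''t'' 0 = i \<and> I (i + 1) (update m'' ''t'' 0 (i + 1)))"
      by (intro okm_seq okm_assign)
        (simp_all add: ab xb Sb vals g(2) i(1) it slot_def next_state_def av Inew)
  next
    fix m' assume "I (int N) m'"
    then obtain g where g: "upto g N" "m ''V'' (adr N (pre g N)) = m ''V'' 0 - (\<Sum>u<N. w u * g u)"
      "\<forall>t<N. m' ''x'' (int t) = m ''x'' (int t) + lam * g t" unfolding I_def by auto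
    have v: "valid g" using g(1) by (simp add: upto_def valid_def)
    have "pre g N = 0" by (rule valid_end[OF v])
    then have "wdot g = m ''V'' 0" using g(2) f by (simp add: filled_def wdot_def)
    with v g(3) show "\<exists>g. valid g \<and> wdot g = m ''V'' 0 \<and>
      (\<forall>t<N. m' ''x'' (int t) = m ''x'' (int t) + lam * g t)" by blast
  qed simp_all
  then show ?thesis unfolding T_forward_def forward_def
    by (intro okm_seq okm_assign) (simp_all add: m1_def)
qed

end

section \<open>Encoding the rows as digits\<close>

lemma top_digit_le: "\<bar>y\<bar> \<le> q \<Longrightarrow> 2 * \<bar>x\<bar> < p \<Longrightarrow> 2 * \<bar>x + y\<bar> < p + 2 * q" for x y p q :: int
  using abs_triangle_ineq[of x y] by (smt (verit))

lemma top_digit_gt: "p \<le> \<bar>y\<bar> \<Longrightarrow> 2 * \<bar>x\<bar> < p \<Longrightarrow> p < 2 * \<bar>x + y\<bar>" for x y p :: int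
  using abs_triangle_ineq[of "x + y" "- x"] by (smt (verit))

text \<open>Base \<open>2 * b + 1\<close> is balanced: digits between \<open>- b\<close> and
  \<open>b\<close> represent only integers below half of the next power in absolute value.\<close>

lemma digits_bound:
  fixes v :: "nat \<Rightarrow> int"
  assumes "\<And>i. i < m \<Longrightarrow> \<bar>v i\<bar> \<le> b" "b \<ge> 0"
  shows "2 * \<bar>\<Sum>i<m. v i * (2 * b + 1) ^ i\<bar> < (2 * b + 1) ^ m"
  using assms(1)
proof (induction m)
  case (Suc m)
  let ?W = "2 * b + 1"
  have IH: "2 * \<bar>\<Sum>i<m. v i * ?W ^ i\<bar> < ?W ^ m" using Suc by simp
  have "\<bar>v m * ?W ^ m\<bar> \<le> b * ?W ^ m" using Suc.prems[of m] assms(2) by (simp add: abs_mult mult_right_mono)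
  then have "2 * \<bar>\<Sum>i<Suc m. v i * ?W ^ i\<bar> < ?W ^ m + 2 * (b * ?W ^ m)"
    unfolding sum.lessThan_Suc by (rule top_digit_le[OF _ IH])
  also have "\<dots> = ?W ^ Suc m" by (simp add: algebra_simps)
  finally show ?case .
qed simp

text \<open>A nonzero top digit at position \<open>l\<close> or above contributes at least its full
  power, while all lower digits together stay below half of it and cannot compensate.\<close>

lemma digits_zero:
  fixes v :: "nat \<Rightarrow> int"
  assumes "\<And>i. i < m \<Longrightarrow> \<bar>v i\<bar> \<le> b" "b \<ge> 0" "2 * \<bar>\<Sum>i<m. v i * (2 * b + 1) ^ i\<bar> < (2 * b + 1) ^ l"
    "l \<le> i" "i < m"
  shows "v i = 0"
  using assms(1,3,5)
proof (induction m)
  case (Suc m)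
  let ?W = "2 * b + 1"
  have low: "2 * \<bar>\<Sum>i<m. v i * ?W ^ i\<bar> < ?W ^ m" using Suc.prems(1) assms(2) by (intro digits_bound) auto
  have vm: "v m = 0" if "l \<le> m"
  proof (rule ccontr)
    assume "v m \<noteq> 0"
    then have "1 * ?W ^ m \<le> \<bar>v m\<bar> * ?W ^ m" using assms(2) by (intro mult_right_mono) auto
    then have "?W ^ m \<le> \<bar>v m * ?W ^ m\<bar>" using assms(2) by (simp add: abs_mult)
    then have "?W ^ m < 2 * \<bar>\<Sum>i<Suc m. v i * ?W ^ i\<bar>"
      unfolding sum.lessThan_Suc by (rule top_digit_gt[OF _ low])
    also have "\<dots> < ?W ^ l" by (rule Suc.prems(2))
    also have "\<dots> \<le> ?W ^ m" using that assms(2) by (intro power_increasing) auto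
    finally show False by simp
  qed
  show ?case
  proof (cases "i = m")
    case True
    then show ?thesis using vm assms(4) by simp
  next
    case False
    then have "i < m" using Suc.prems(3) by simp
    moreover have "v m = 0" using vm assms(4) calculation by simp
    ultimately show ?thesis using Suc by simp
  qed
qed simp

definition flat :: "nat \<Rightarrow> (nat \<Rightarrow> int) \<Rightarrow> nat \<Rightarrow> nat \<Rightarrow> int" where
  "flat Q x k j = x (k * Q + j)"

lemma sum_flat: "(\<Sum>t<n * Q. f t) = (\<Sum>k<n. \<Sum>j<Q. flat Q f k j)" for f :: "nat \<Rightarrow> int"
proof -
  have "(\<Sum>j<Q. flat Q f k j) = sum f {k * Q..<k * Q + Q}" for k
    using sum.shift_bounds_nat_ivl[of f 0 "k * Q" Q] by (simp add: flat_def atLeast0LessThan add.commute)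
  then show ?thesis using sum.nat_group[of f Q n] by (simp add: mult.commute)
qed

lemma flat_index: "k < n \<Longrightarrow> j < Q \<Longrightarrow> k * Q + j < n * Q" for k n j Q :: nat
proof -
  assume "k < n" "j < Q"
  then have "k * Q + j < Suc k * Q" by simp
  also have "\<dots> \<le> n * Q" using \<open>k < n\<close> by (intro mult_le_mono1) simp
  finally show ?thesis .
qed

lemma flat_index_ex: "t < n * Q \<Longrightarrow> \<exists>k<n. \<exists>j<Q. t = k * Q + j" for t n Q :: nat
  by (metis div_mult_mod_eq less_mult_imp_div_less mod_less_divisor mult_eq_0_iff not_gr_zero not_less_zero)

section \<open>Kernel membership as size conditions on one integer\<close>

context nfold_system
begin

lemma dot_flat: "(\<Sum>t<n * Q. w t * g t) = dot n (flat Q w) (flat Q g)"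
  unfolding sum_flat dot_def by (simp add: flat_def)

text \<open>The partial sums of all rows are the digits of a single integer in base \<open>W\<close>, with digits of
  absolute value at most \<open>(W - 1) / 2\<close>. The digits of the block rows vanish iff twice the integer
  is below \<open>W ^ s\<close> in absolute value.\<close>

definition code :: "int \<Rightarrow> nat \<Rightarrow> int" where
  "code W t = (\<Sum>i<m. d i (t mod Q) * W ^ i)"

text \<open>Linking rows are the low digits. At a block boundary the block rows must have returned
  to 0, which is the bound \<open>W ^ s\<close>; inside a block \<open>W ^ m\<close> imposes nothing
  beyond the digit bounds; at the end all digits must vanish, which is the bound 1.\<close>

definition cap :: "nat \<Rightarrow> int \<Rightarrow> nat \<Rightarrow> int" where
  "cap n W t = (if t = n * Q then 1 else if t mod Q = 0 then W ^ s else W ^ m)"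

lemma ker_iff_capped:
  fixes g :: "nat \<Rightarrow> int"
  assumes a: "\<And>i j. i < m \<Longrightarrow> j < Q \<Longrightarrow> \<bar>d i j\<bar> \<le> a" "a \<ge> 0"
    and g: "\<And>t. t < n * Q \<Longrightarrow> \<bar>g t\<bar> \<le> K" and K: "K \<ge> 0"
  defines "W \<equiv> 2 * (K * int (n * Q) * a) + 1"
  shows "ker n (flat Q g) \<longleftrightarrow>
    (\<forall>t\<le>n * Q. 2 * \<bar>\<Sum>u<t. g u * code W u\<bar> < cap n W t)"
proof -
  \<comment> \<open>A partial row sum has at most \<open>n * Q\<close> terms, each at most
    \<open>K * a\<close>, so \<open>?V\<close> bounds every digit and \<open>W\<close> is the
    matching balanced base.\<close>
  let ?V = "K * int (n * Q) * a"
  define v where "v t i = (\<Sum>u<t. g u * d i (u mod Q))" for t i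
  have pre: "(\<Sum>u<t. g u * code W u) = (\<Sum>i<m. v t i * W ^ i)" for t
    unfolding code_def v_def sum_distrib_left sum_distrib_right
    by (subst sum.swap) (simp add: mult.assoc)
  have V0: "?V \<ge> 0" using K a(2) by simp
  have vb: "\<bar>v t i\<bar> \<le> ?V" if "t \<le> n * Q" "i < m" for t i
  proof -
    have "\<bar>v t i\<bar> \<le> (\<Sum>u<t. \<bar>g u * d i (u mod Q)\<bar>)" unfolding v_def by (rule sum_abs)
    also have "\<dots> \<le> (\<Sum>u<t. K * a)"
    proof (intro sum_mono)
      fix u assume "u \<in> {..<t}"
      then have u: "u < n * Q" using that by simp
      then have "Q > 0" by (cases Q) auto
      then show "\<bar>g u * d i (u mod Q)\<bar> \<le> K * a"
        unfolding abs_mult using g[OF u] a(1)[of i "u mod Q"] that K by (intro mult_mono) auto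
    qed
    also have "\<dots> = int t * (K * a)" by simp
    also have "\<dots> \<le> int (n * Q) * (K * a)" using that K a(2) by (intro mult_right_mono of_nat_mono) auto
    finally show ?thesis by (simp add: algebra_simps)
  qed
  have vk: "v (k * Q) i = (\<Sum>k'<k. \<Sum>j<Q. d i j * flat Q g k' j)" for k i
    unfolding v_def sum_flat by (simp add: flat_def mult.commute)
  show ?thesis
  proof
    assume ker: "ker n (flat Q g)"
    have vA: "v (k * Q) i = 0" if "k \<le> n" "s \<le> i" "i < m" for k i
      unfolding vk using ker that by (intro sum.neutral) (auto simp: ker_def)
    have vB: "v (n * Q) i = 0" if "i < m" for i
      using vA[of n i] ker that unfolding vk by (cases "i < s") (auto simp: ker_def)
    show "\<forall>t\<le>n * Q. 2 * \<bar>\<Sum>u<t. g u * code W u\<bar> < cap n W t"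
    proof (intro allI impI)
      fix t assume t: "t \<le> n * Q"
      show "2 * \<bar>\<Sum>u<t. g u * code W u\<bar> < cap n W t"
      proof (cases "t = n * Q")
        case True
        then show ?thesis unfolding pre using vB by (simp add: cap_def)
      next
        case False
        show ?thesis
        proof (cases "t mod Q = 0")
          case True
          define k where "k = t div Q"
          have tk: "t = k * Q" using True by (auto simp: k_def)
          have "k \<le> n" using t False unfolding tk by auto
          then have "(\<Sum>i<m. v t i * W ^ i) = (\<Sum>i<s. v t i * W ^ i)"
            using vA s_le_m unfolding tk by (intro sum.mono_neutral_right) (auto simp: not_less)
          also have "2 * \<bar>\<dots>\<bar> < W ^ s" unfolding W_def using vb[OF t] V0 s_le_m by (intro digits_bound) auto
          finally show ?thesis using True False by (simp add: pre cap_def)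
        next
          case f: False
          have "2 * \<bar>\<Sum>i<m. v t i * W ^ i\<bar> < W ^ m"
            unfolding W_def using vb[OF t] V0 by (intro digits_bound) auto
          then show ?thesis using f False by (simp add: pre cap_def)
        qed
      qed
    qed
  next
    assume cap: "\<forall>t\<le>n * Q. 2 * \<bar>\<Sum>u<t. g u * code W u\<bar> < cap n W t"
    have cap': "2 * \<bar>\<Sum>i<m. v t i * (2 * ?V + 1) ^ i\<bar> < cap n (2 * ?V + 1) t" if "t \<le> n * Q" for t
      using cap[rule_format, OF that, unfolded pre] unfolding W_def .
    have vB: "v (n * Q) i = 0" if "i < m" for i
    proof (rule digits_zero[OF vb[OF order_refl] V0 _ le0 that])
      show "2 * \<bar>\<Sum>i<m. v (n * Q) i * (2 * ?V + 1) ^ i\<bar> < (2 * ?V + 1) ^ 0"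
        using cap'[OF order_refl] unfolding cap_def by simp
    qed
    have vA: "v (k * Q) i = 0" if "k \<le> n" "s \<le> i" "i < m" for k i
    proof (cases "k * Q = n * Q")
      case True
      show ?thesis unfolding True by (rule vB[OF that(3)])
    next
      case False
      have kn: "k * Q \<le> n * Q" using that by simp
      show ?thesis
      proof (rule digits_zero[OF vb[OF kn] V0 _ that(2,3)])
        have "cap n (2 * ?V + 1) (k * Q) = (2 * ?V + 1) ^ s" using False unfolding cap_def by simp
        then show "2 * \<bar>\<Sum>i<m. v (k * Q) i * (2 * ?V + 1) ^ i\<bar> < (2 * ?V + 1) ^ s"
          using cap'[OF kn] by simp
      qed
    qed
    show "ker n (flat Q g)"
      unfolding ker_def
    proof (intro conjI allI impI ballI)
      fix k i assume k: "k < n" and i: "i \<in> {s..<m}"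
      \<comment> \<open>A single block is the difference of the partial sums at its two
        boundaries.\<close>
      have "v (Suc k * Q) i = v (k * Q) i + (\<Sum>j<Q. d i j * flat Q g k j)" unfolding vk by simp
      then show "(\<Sum>j<Q. d i j * flat Q g k j) = 0" using vA[of k i] vA[of "Suc k" i] k i by auto
    next
      fix i assume "i < s"
      then show "(\<Sum>k<n. \<Sum>j<Q. d i j * flat Q g k j) = 0" using vB[of i] s_le_m unfolding vk by simp
    qed
  qed
qed

lemma code_bound:
  assumes a: "\<And>i j. i < m \<Longrightarrow> j < Q \<Longrightarrow> \<bar>d i j\<bar> \<le> a" and b: "a \<le> b" "b \<ge> 0" "Q > 0"
  shows "\<bar>code (2 * b + 1) t\<bar> \<le> (2 * b + 1) ^ m"
proof -
  have "2 * \<bar>code (2 * b + 1) t\<bar> < (2 * b + 1) ^ m"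
    unfolding code_def
  proof (rule digits_bound)
    show "\<bar>d i (t mod Q)\<bar> \<le> b" if "i < m" for i using a[OF that, of "t mod Q"] b by simp
  qed (rule b)
  then show ?thesis by simp
qed

end

section \<open>Slack columns and penalties\<close>

locale nfold_rows =
  fixes e :: "nat \<Rightarrow> nat \<Rightarrow> int" and s m q :: nat
  assumes s_le: "s \<le> m"
begin

text \<open>The slack columns \<open>q + i\<close> and \<open>q + m + i\<close> of row \<open>i\<close> make a starting point available.\<close>

definition d :: "nat \<Rightarrow> nat \<Rightarrow> int" where
  "d i j = (if j < q then e i j else if j < q + m then (if j = q + i then 1 else 0)
     else (if j = q + m + i then -1 else 0))"

definition Q :: nat where "Q = q + 2 * m"

sublocale nfold_system d s m Q by unfold_locales (rule s_le)

definition slack :: "nat \<Rightarrow> nat \<Rightarrow> int" where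
  "slack k j = (if j < q then 0 else 1)"

lemma sum_columns: "(\<Sum>j<Q. f j) = (\<Sum>j<q. f j) + (\<Sum>i<m. f (q + i)) + (\<Sum>i<m. f (q + m + i))"
  for f :: "nat \<Rightarrow> int"
proof -
  have "(\<Sum>j<a + b. f j) = (\<Sum>j<a. f j) + (\<Sum>i<b. f (a + i))" for a b
    by (induction b) (simp_all add: add.assoc)
  from this[of "q + m" m] this[of q m] show ?thesis by (simp add: Q_def mult_2 add.assoc)
qed

lemma row_sum:
  assumes "i < m"
  shows "(\<Sum>j<Q. d i j * y j) = (\<Sum>j<q. e i j * y j) + y (q + i) - y (q + m + i)"
proof -
  have 1: "(\<Sum>j<q. d i j * y j) = (\<Sum>j<q. e i j * y j)" by (simp add: d_def)
  have "(\<Sum>i'<m. d i (q + i') * y (q + i')) = (\<Sum>i'<m. if i' = i then y (q + i) else 0)"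
    by (intro sum.cong) (auto simp: d_def)
  then have 2: "(\<Sum>i'<m. d i (q + i') * y (q + i')) = y (q + i)" using assms by simp
  have "(\<Sum>i'<m. d i (q + m + i') * y (q + m + i')) = (\<Sum>i'<m. if i' = i then - y (q + m + i) else 0)"
    by (intro sum.cong) (auto simp: d_def)
  then have 3: "(\<Sum>i'<m. d i (q + m + i') * y (q + m + i')) = - y (q + m + i)" using assms by simp
  show ?thesis unfolding sum_columns 1 2 3 by simp
qed

end

section \<open>Transfer between the original and the extended problem\<close>

locale nfold_problem = nfold_rows +
  fixes n :: nat and \<rho> :: "nat \<Rightarrow> nat \<Rightarrow> int" and c :: "nat \<Rightarrow> nat \<Rightarrow> int"
begin

text \<open>The linking right-hand side is written as a sum over blocks, so that each block has a
  full right-hand side of its own and a starting point can be built block by block.\<close>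

definition feasible :: "(nat \<Rightarrow> nat \<Rightarrow> int) \<Rightarrow> bool" where
  "feasible z \<longleftrightarrow> (\<forall>k<n. \<forall>j<q. z k j \<ge> 0) \<and>
     (\<forall>k<n. \<forall>i\<in>{s..<m}. (\<Sum>j<q. e i j * z k j) = \<rho> k i) \<and>
     (\<forall>i<s. (\<Sum>k<n. \<Sum>j<q. e i j * z k j) = (\<Sum>k<n. \<rho> k i))"

definition cost :: "(nat \<Rightarrow> nat \<Rightarrow> int) \<Rightarrow> int" where
  "cost z = (\<Sum>k<n. \<Sum>j<q. c k j * z k j)"

text \<open>\<open>\<rho>\<^sup>2 + \<rho>\<close> and \<open>\<rho>\<^sup>2\<close> are nonnegative integers with difference \<open>\<rho>\<close>, obtained without a
  case distinction on the sign.\<close>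

definition start :: "nat \<Rightarrow> nat \<Rightarrow> int" where
  "start k j = (if j < q then 0 else if j < q + m then \<rho> k (j - q) * \<rho> k (j - q) + \<rho> k (j - q)
     else \<rho> k (j - q - m) * \<rho> k (j - q - m))"

definition cx :: "nat \<Rightarrow> nat \<Rightarrow> int" where
  "cx k j = (if j < q then c k j else 0)"

definition pad :: "(nat \<Rightarrow> nat \<Rightarrow> int) \<Rightarrow> nat \<Rightarrow> nat \<Rightarrow> int" where
  "pad z k j = (if j < q then z k j else 0)"

lemma start_nonneg: "start k j \<ge> 0"
proof -
  have "x * x + x \<ge> 0" for x :: int
  proof (cases "x \<ge> 0")
    case False
    then have "x * (x + 1) \<ge> 0" by (intro mult_nonpos_nonpos) auto
    then show ?thesis by (simp add: algebra_simps)
  qed simp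
  then show ?thesis by (simp add: start_def)
qed

lemma start_row: "i < m \<Longrightarrow> (\<Sum>j<Q. d i j * start k j) = \<rho> k i"
  by (simp add: row_sum) (simp add: start_def)

text \<open>\<open>start\<close> solves all extended rows, so membership in its kernel coset
  replaces the equations in the invariants of the scaling.\<close>

lemma ker_start_iff:
  "ker n (\<lambda>k j. x k j - start k j) \<longleftrightarrow>
     (\<forall>k<n. \<forall>i\<in>{s..<m}. (\<Sum>j<Q. d i j * x k j) = \<rho> k i) \<and>
     (\<forall>i<s. (\<Sum>k<n. \<Sum>j<Q. d i j * x k j) = (\<Sum>k<n. \<rho> k i))"
  using s_le start_row unfolding ker_def by (simp add: right_diff_distrib sum_subtractf)

lemma slackfree_row: "i < m \<Longrightarrow> y (q + i) = 0 \<Longrightarrow> y (q + m + i) = 0 \<Longrightarrow>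
    (\<Sum>j<Q. d i j * y j) = (\<Sum>j<q. e i j * y j)"
  by (simp add: row_sum)

lemma dot_slack: "dot n slack x = (\<Sum>k<n. \<Sum>j\<in>{q..<Q}. x k j)"
proof -
  have "(\<Sum>j<Q. slack k j * x k j) = (\<Sum>j\<in>{q..<Q}. x k j)" for k
    by (rule sum.mono_neutral_cong_right) (auto simp: slack_def)
  then show ?thesis by (simp add: dot_def)
qed

lemma slack_zero:
  assumes "dot n slack x \<le> 0" "\<And>k j. k < n \<Longrightarrow> j < Q \<Longrightarrow> x k j \<ge> 0" "k < n" "q \<le> j" "j < Q"
  shows "x k j = 0"
proof -
  have "x k j \<le> (\<Sum>j\<in>{q..<Q}. x k j)" using assms by (intro member_le_sum) auto
  also have "\<dots> \<le> dot n slack x" unfolding dot_slack using assms(2,3)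
    by (intro member_le_sum[of k _ "\<lambda>k. \<Sum>j\<in>{q..<Q}. x k j"]) (auto intro: sum_nonneg)
  finally show ?thesis using assms(1) assms(2)[OF assms(3,5)] by simp
qed

lemma dot_cx: "dot n cx x = cost x"
proof -
  have "(\<Sum>j<Q. cx k j * x k j) = (\<Sum>j<q. c k j * x k j)" for k
    by (rule sum.mono_neutral_cong_right) (auto simp: cx_def Q_def)
  then show ?thesis by (simp add: dot_def cost_def)
qed

lemma feasible_pad:
  assumes "feasible z"
  shows "ker n (\<lambda>k j. pad z k j - start k j)" "pad z k j \<ge> 0 \<or> k \<ge> n" "dot n slack (pad z) = 0" "cost (pad z) = cost z"
proof -
  have "(\<Sum>j<Q. d i j * pad z k j) = (\<Sum>j<q. e i j * z k j)" if "i < m" for i k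
    using slackfree_row[OF that, of "pad z k"] by (simp add: pad_def)
  then show "ker n (\<lambda>k j. pad z k j - start k j)"
    using assms s_le by (simp add: ker_start_iff feasible_def)
  show "pad z k j \<ge> 0 \<or> k \<ge> n" using assms by (auto simp: feasible_def pad_def)
  show "dot n slack (pad z) = 0" unfolding dot_slack by (simp add: pad_def)
  show "cost (pad z) = cost z" by (simp add: cost_def pad_def)
qed

lemma feasible_slackfree:
  assumes "ker n (\<lambda>k j. x k j - start k j)" "\<And>k j. k < n \<Longrightarrow> j < Q \<Longrightarrow> x k j \<ge> 0" "dot n slack x \<le> 0"
  shows "feasible x"
proof -
  have "(\<Sum>j<Q. d i j * x k j) = (\<Sum>j<q. e i j * x k j)" if "i < m" "k < n" for i k
    using that slack_zero[OF assms(3,2), of k] by (intro slackfree_row) (auto simp: Q_def)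
  moreover have "x k j \<ge> 0" if "k < n" "j < q" for k j using assms(2) that by (simp add: Q_def)
  ultimately show ?thesis using assms(1) s_le by (simp add: ker_start_iff feasible_def)
qed

definition weight :: "int \<Rightarrow> int \<Rightarrow> nat \<Rightarrow> nat \<Rightarrow> int" where
  "weight M f k j = f * cx k j + M * slack k j"

lemma dot_weight: "dot n (weight M f) g = f * dot n cx g + M * dot n slack g"
  by (simp add: dot_def weight_def algebra_simps sum.distrib sum_distrib_left)

text \<open>A feasible \<open>z\<close>, padded by zero slack, would be a step from \<open>x\<close>
  that lowers the slack, which \<open>penalty_exact\<close> excludes. Both flags are covered because
  infeasibility has to be recognized also after an improving direction was found.\<close>

lemma infeasible:
  assumes K: "G \<le> K" and M: "M > K * nrm n cx" and f: "f \<in> {0, 1}"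
    and x: "ker n (\<lambda>k j. x k j - start k j)" "\<And>k j. k < n \<Longrightarrow> j < Q \<Longrightarrow> x k j \<ge> 0"
    and opt: "\<And>h. feas n x 1 h \<Longrightarrow> dot n (weight M f) h \<ge> 0"
    and slack: "dot n slack x > 0"
  shows "\<not> feasible z"
proof
  assume z: "feasible z"
  define g where "g k j = (pad z k j - start k j) - (x k j - start k j)" for k j
  have g: "feas n x 1 g"
    unfolding feas_def g_def using ker_diff[OF feasible_pad(1)[OF z] x(1)] feasible_pad(2)[OF z]
    by (auto simp: not_le[symmetric])
  have "K * nrm n (\<lambda>k j. f * cx k j) \<le> K * nrm n cx"
    using K G(1) f by (auto simp: nrm_def intro!: sum_nonneg mult_nonneg_nonneg)
  then have M': "M > K * nrm n (\<lambda>k j. f * cx k j)" using M by linarith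
  have "dot n slack g \<ge> 0"
  proof (rule penalty_exact[OF K M' x(2) _ g])
    show "dot n (\<lambda>k j. f * cx k j + M * slack k j) h \<ge> 0" if "feas n x 1 h" for h
      using opt[OF that] unfolding weight_def[abs_def] .
  qed
  moreover have "dot n slack g = dot n slack (pad z) - dot n slack x" unfolding g_def[abs_def]
    by (simp add: dot_diff)
  ultimately show False using slack feasible_pad(3)[OF z] by simp
qed

text \<open>The slack of \<open>x\<close> and of every padded feasible point is 0, so the penalty
  drops out of the comparison.\<close>

lemma optimal:
  assumes x: "ker n (\<lambda>k j. x k j - start k j)" "\<And>k j. k < n \<Longrightarrow> j < Q \<Longrightarrow> x k j \<ge> 0"
    and opt: "\<And>h. feas n x 1 h \<Longrightarrow> dot n (weight M 1) h \<ge> 0"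
    and slack: "dot n slack x \<le> 0" and z: "feasible z"
  shows "cost x \<le> cost z"
proof -
  define g where "g k j = (pad z k j - start k j) - (x k j - start k j)" for k j
  have "feas n x 1 g"
    unfolding feas_def g_def using ker_diff[OF feasible_pad(1)[OF z] x(1)] feasible_pad(2)[OF z]
    by (auto simp: not_le[symmetric])
  moreover have "dot n w g = dot n w (pad z) - dot n w x" for w
    unfolding g_def[abs_def] by (simp add: dot_diff)
  moreover have "dot n slack x = 0"
    using slack_zero[OF slack x(2)] unfolding dot_slack by (intro sum.neutral) auto
  ultimately show ?thesis using opt[of g] feasible_pad(3,4)[OF z] by (simp add: dot_weight dot_cx)
qed

text \<open>The objective part of \<open>g\<close> is below \<open>M\<close> in absolute value, so a
  single unit of slack would make the weight positive. Hence \<open>g\<close> is slack-free, its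
  cost is at most -1, and it can be repeated from any feasible point.\<close>

lemma unbounded:
  assumes K: "K \<ge> 0" and M: "M > K * nrm n cx"
    and x: "feasible x"
    and g: "feas n (\<lambda>_ _. 0) 1 g" "\<forall>k<n. \<forall>j<Q. \<bar>g k j\<bar> \<le> K" "dot n (weight M 1) g < 0"
  shows "\<exists>z. feasible z \<and> cost z < b"
proof -
  have g0: "g k j \<ge> 0" if "k < n" "j < Q" for k j using g(1) that by (simp add: feas_def)
  have "\<bar>dot n cx g\<bar> \<le> K * nrm n cx" by (rule abs_dot_le[OF g(2)])
  then have neg: "M * dot n slack g < M" using g(3) M by (simp add: dot_weight)
  have "M > 0" using M K by (smt (verit) mult_nonneg_nonneg nrm_nonneg)
  then have sl: "dot n slack g \<le> 0" using neg by (smt (verit) mult_le_cancel_left1)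
  then have s0: "g k j = 0" if "k < n" "q \<le> j" "j < Q" for k j using slack_zero[OF sl g0] that by auto
  then have "dot n slack g = 0" unfolding dot_slack by (intro sum.neutral) auto
  then have cg: "cost g \<le> -1" using g(3) by (simp add: dot_weight dot_cx)
  have rg: "(\<Sum>j<Q. d i j * g k j) = (\<Sum>j<q. e i j * g k j)" if "i < m" "k < n" for i k
    using that s0 by (intro slackfree_row) (auto simp: Q_def)
  \<comment> \<open>Every repetition gains at least 1, so this number of repetitions passes below
    \<open>b\<close>.\<close>
  define l where "l = \<bar>cost x - b\<bar> + 1"
  define z where "z k j = x k j + l * g k j" for k j
  have lin: "(\<Sum>j<q. w j * z k j) = (\<Sum>j<q. w j * x k j) + l * (\<Sum>j<q. w j * g k j)" for w k
    by (simp add: z_def distrib_left sum.distrib sum_distrib_left mult.left_commute)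
  have kg: "ker n g" using g(1) by (simp add: feas_def)
  have "feasible z"
    unfolding feasible_def
  proof (intro conjI allI impI ballI)
    fix k j assume "k < n" "j < q"
    then show "z k j \<ge> 0" using x g0 by (simp add: feasible_def z_def l_def Q_def)
  next
    fix k i assume "k < n" "i \<in> {s..<m}"
    then show "(\<Sum>j<q. e i j * z k j) = \<rho> k i"
      using x kg rg[of i k] unfolding lin by (simp add: feasible_def ker_def)
  next
    fix i assume i: "i < s"
    have "(\<Sum>k<n. \<Sum>j<q. e i j * g k j) = (\<Sum>k<n. \<Sum>j<Q. d i j * g k j)"
    proof (rule sum.cong[OF refl])
      fix k assume "k \<in> {..<n}"
      then show "(\<Sum>j<q. e i j * g k j) = (\<Sum>j<Q. d i j * g k j)" using rg[of i k] i s_le by simp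
    qed
    also have "\<dots> = 0" using kg i by (simp add: ker_def)
    finally show "(\<Sum>k<n. \<Sum>j<q. e i j * z k j) = (\<Sum>k<n. \<rho> k i)"
      using x i unfolding lin by (simp add: feasible_def sum.distrib flip: sum_distrib_left)
  qed
  moreover have "cost z = cost x + l * cost g"
    unfolding cost_def lin by (simp add: sum.distrib sum_distrib_left)
  moreover have "l * cost g \<le> l * (-1)" using cg by (intro mult_left_mono) (auto simp: l_def)
  ultimately show ?thesis by (intro exI[of _ z]) (auto simp: l_def)
qed

end

section \<open>Initialization\<close>

definition unflat :: "nat \<Rightarrow> (nat \<Rightarrow> nat \<Rightarrow> int) \<Rightarrow> nat \<Rightarrow> int" where
  "unflat Q y t = y (t div Q) (t mod Q)"

lemma unflat_index [simp]: "j < Q \<Longrightarrow> unflat Q y (k * Q + j) = y k j"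
  by (simp add: unflat_def)

text \<open>Exponents are bounded by the fixed number of rows, so powers are spelled out as products
  in the program text.\<close>

primrec pow_exp :: "nat \<Rightarrow> aexp" where
  "pow_exp 0 = Const 1"
| "pow_exp (Suc i) = Times (scal ''W'') (pow_exp i)"

primrec poly_exp :: "(nat \<Rightarrow> int) \<Rightarrow> nat \<Rightarrow> aexp" where
  "poly_exp v 0 = Const 0"
| "poly_exp v (Suc i) = Plus (poly_exp v i) (Times (Const (v i)) (pow_exp i))"

lemma aval_pow_exp [simp]: "aval (pow_exp i) m = m ''W'' 0 ^ i"
  by (induction i) auto

lemma aval_poly_exp [simp]: "aval (poly_exp v i) m = (\<Sum>j<i. v j * m ''W'' 0 ^ j)"
  by (induction i) auto

lemma mods_unroll: "mods (unroll f n) = (\<Union>j<n. mods (f j))"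
  by (induction n) (auto simp: lessThan_Suc)

lemma okm_assign_seq:
  assumes "aval e1 m = a" "aval e2 m = b" "\<bar>b\<bar> \<le> 2 ^ L" "okm L T c (update m v a b) Q"
  shows "okm L (1 + T) (Seq (Assign v e1 e2) c) m Q"
  using assms by (intro okm_seq okm_assign) auto

context nfold_rows
begin

text \<open>With \<open>K = kappa * int n\<close> one gets \<open>K = n Q G + n G + n\<close>, which
  is at least \<open>n Q G\<close> for proximity, at least \<open>G\<close> for recession and
  penalty, and positive.\<close>

definition kappa :: int where "kappa = G * (int Q + 1) + 1"

definition amax :: int where "amax = 1 + (\<Sum>i<m. \<Sum>j<Q. \<bar>d i j\<bar>)"

lemma d_le_amax: "i < m \<Longrightarrow> j < Q \<Longrightarrow> \<bar>d i j\<bar> \<le> amax"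
proof -
  assume a: "i < m" "j < Q"
  have "\<bar>d i j\<bar> \<le> (\<Sum>j<Q. \<bar>d i j\<bar>)" using a by (intro member_le_sum) auto
  also have "\<dots> \<le> (\<Sum>i<m. \<Sum>j<Q. \<bar>d i j\<bar>)" using a
    by (intro member_le_sum[of i _ "\<lambda>i. \<Sum>j<Q. \<bar>d i j\<bar>"]) (auto intro: sum_nonneg)
  finally show ?thesis by (simp add: amax_def)
qed

lemma amax_pos: "amax \<ge> 1" unfolding amax_def by (simp add: sum_nonneg)

lemma kappa_pos: "kappa \<ge> 1" unfolding kappa_def using G(1) by simp

section \<open>The setup program\<close>

definition scalars_prog :: com where
  "scalars_prog =
    Seq (put ''N'' (Times (scal ''n'') (Const (int Q))))
    (Seq (put ''K'' (Times (Const kappa) (scal ''n'')))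
    (Seq (put ''W'' (Plus (Times (Const 2) (Times (Times (scal ''K'') (scal ''N'')) (Const amax))) (Const 1)))
    (Seq (put ''Ws'' (pow_exp s))
    (Seq (put ''Wm'' (pow_exp m))
         (put ''D'' (Times (Const 2) (scal ''Wm'')))))))"

definition read_prog :: com where
  "read_prog = For ''i'' (Const 0) (Plus (Const (int s)) (Times (scal ''n'') (Const (int (m - s + q)))))
     (Read ''in'' (scal ''i''))"

text \<open>The quotient of 1 by \<open>k + 1\<close> is 1 for block 0 and 0 otherwise; it assigns
  the whole linking right-hand side to block 0 without branching.\<close>

definition rhs_exp :: "nat \<Rightarrow> aexp" where
  "rhs_exp i = (if i < s then Times (Quot (Const 1) (Plus (scal ''k'') (Const 1))) (Cell ''in'' (Const (int i)))
     else Cell ''in'' (Plus (Plus (Const (int s)) (Times (scal ''k'') (Const (int (m - s))))) (Const (int (i - s)))))"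

definition start_exp :: "nat \<Rightarrow> aexp" where
  "start_exp j = (if j < q then Const 0
     else if j < q + m then Plus (Times (rhs_exp (j - q)) (rhs_exp (j - q))) (rhs_exp (j - q))
     else Times (rhs_exp (j - q - m)) (rhs_exp (j - q - m)))"

definition cost_exp :: "nat \<Rightarrow> aexp" where
  "cost_exp j = (if j < q then Cell ''in'' (Plus (Plus (Const (int s)) (Times (scal ''n'') (Const (int (m - s)))))
       (Plus (Times (scal ''k'') (Const (int q))) (Const (int j)))) else Const 0)"

definition column_prog :: "nat \<Rightarrow> com" where
  "column_prog j = (let t = Plus (Times (scal ''k'') (Const (int Q))) (Const (int j)) in
    Seq (Assign ''E'' t (poly_exp (\<lambda>i. d i j) m))
    (Seq (Assign ''P'' t (if j = 0 then scal ''Ws'' else scal ''Wm''))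
    (Seq (Assign ''c'' t (cost_exp j))
    (Seq (Assign ''h'' t (Const (if j < q then 0 else 1)))
         (Assign ''x'' t (start_exp j))))))"

definition columns_prog :: com where
  "columns_prog = Seq (For ''k'' (Const 0) (scal ''n'') (unroll column_prog Q))
     (Assign ''P'' (scal ''N'') (Const 1))"

text \<open>The sum of squares \<open>sc\<close> bounds the 1-norm of an integer objective without
  taking absolute values. The sum \<open>sx\<close> of the nonnegative starting entries bounds each
  of them.\<close>

definition sums_prog :: com where
  "sums_prog = Seq (put ''sc'' (Const 0)) (Seq (put ''sx'' (Const 0))
     (For ''t'' (Const 0) (scal ''N'')
       (Seq (put ''sc'' (Plus (scal ''sc'') (Times (Cell ''c'' (scal ''t'')) (Cell ''c'' (scal ''t'')))))
            (put ''sx'' (Plus (scal ''sx'') (Cell ''x'' (scal ''t'')))))))"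

definition penalty_prog :: com where
  "penalty_prog =
    Seq (put ''M'' (Plus (Times (scal ''K'') (scal ''sc'')) (Const 1)))
    (Seq (put ''inf'' (Plus (Times (scal ''N'') (Times (scal ''K'') (Plus (scal ''sc'') (scal ''M'')))) (Const 1)))
    (Seq (put ''f'' (Const 1)) (put ''lam'' (Const 1))))"

definition setup_prog :: com where
  "setup_prog = Seq (Read ''n'' (Const 0)) (Seq scalars_prog (Seq read_prog
     (Seq columns_prog (Seq sums_prog penalty_prog))))"

end

locale nfold_run = nfold_rows +
  fixes n :: nat and iv :: "nat \<Rightarrow> int" and L :: nat
  assumes n: "n \<ge> 1"
begin

text \<open>After \<open>n\<close>, the tape holds the \<open>s\<close> linking entries, then
  \<open>n\<close> groups of \<open>m - s\<close> block entries, then the objective. Block 0 carries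
  the linking vector and the other blocks carry 0, so the sum over blocks is right.\<close>

definition rhs :: "nat \<Rightarrow> nat \<Rightarrow> int" where
  "rhs k i = (if i < s then if k = 0 then iv i else 0 else iv (s + k * (m - s) + (i - s)))"

definition obj :: "nat \<Rightarrow> nat \<Rightarrow> int" where
  "obj k j = iv (s + n * (m - s) + k * q + j)"

sublocale nfold_problem e s m q n rhs obj by unfold_locales

definition len :: nat where "len = s + n * (m - s + q)"
definition N :: nat where "N = n * Q"
definition K :: int where "K = kappa * int n"
definition W :: int where "W = 2 * (K * int N * amax) + 1"
definition sc :: int where "sc = (\<Sum>t<N. unflat Q cx t * unflat Q cx t)"
definition sx :: int where "sx = (\<Sum>t<N. unflat Q start t)"
definition M :: int where "M = K * sc + 1"
definition B :: int where "B = K * (sc + M)"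
definition inf :: int where "inf = int N * B + 1"
text \<open>Bounds every coordinate during scaling: it starts below \<open>sx\<close>, and the
  rounds add at most \<open>K\<close> times the sum of the scales, which is below the initial scale
  and so below \<open>2 * sx + 1\<close>.\<close>

definition top :: int where "top = sx + K * (2 * sx + 1)"

end

text \<open>The bounds cover the numbers that the program computes: \<open>(K + 1) * W ^ m\<close> a
  state plus one attempted move, \<open>2 * sx + 2\<close> the initial scale,
  \<open>int N * top\<close> the slack sum.\<close>

locale nfold_fits = nfold_run +
  assumes fit: "int n \<le> 2 ^ L" "int len \<le> 2 ^ L" "\<And>i. i < len \<Longrightarrow> \<bar>iv i\<bar> \<le> 2 ^ L" "int N \<le> 2 ^ L" "K + 1 \<le> 2 ^ L"
    "W \<le> 2 ^ L" "2 * W ^ m \<le> 2 ^ L" "(K + 1) * W ^ m \<le> 2 ^ L" "sc \<le> 2 ^ L" "M \<le> 2 ^ L" "inf \<le> 2 ^ L"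
    "top \<le> 2 ^ L" "2 * sx + 2 \<le> 2 ^ L" "int N * top \<le> 2 ^ L"
begin

section \<open>Correctness of the setup\<close>

lemma K_pos: "K \<ge> 1"
proof -
  have "1 * 1 \<le> kappa * int n" using kappa_pos n by (intro mult_mono) auto
  then show ?thesis by (simp add: K_def)
qed

lemma W_pos: "W \<ge> 1" unfolding W_def using K_pos amax_pos by simp

lemma pow_le: "i \<le> m \<Longrightarrow> W ^ i \<le> W ^ m" using W_pos by (intro power_increasing) auto

lemma pow_pos: "W ^ i \<ge> 1" using W_pos by simp

lemma pow_fit: "i \<le> m \<Longrightarrow> \<bar>W ^ i\<bar> \<le> 2 ^ L"
  using pow_le[of i] pow_pos[of i] pow_pos[of m] fit(7) by linarith

lemma code_fit: "t < N \<Longrightarrow> \<bar>code W t\<bar> \<le> W ^ m"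
proof -
  assume t: "t < N"
  then have "int N \<ge> 1" by simp
  moreover have "Q > 0" using t by (cases Q) (auto simp: N_def)
  ultimately have "int N \<ge> 1" "Q > 0" by auto
  have 1: "amax \<le> K * int N * amax"
  proof -
    have "1 * 1 \<le> K * int N" using K_pos \<open>int N \<ge> 1\<close> by (intro mult_mono) auto
    then have "1 * amax \<le> (K * int N) * amax" using amax_pos by (intro mult_right_mono) auto
    then show ?thesis by simp
  qed
  show ?thesis unfolding W_def by (rule code_bound[OF d_le_amax 1]) (use \<open>Q > 0\<close> 1 amax_pos in auto)
qed

definition base :: "mem \<Rightarrow> bool" where
  "base m' \<longleftrightarrow> m' ''n'' 0 = int n \<and> m' ''N'' 0 = int N \<and> m' ''K'' 0 = K \<and> m' ''W'' 0 = W \<and>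
     m' ''Ws'' 0 = W ^ s \<and> m' ''Wm'' 0 = W ^ m \<and> m' ''D'' 0 = 2 * W ^ m"

lemma okm_scalars:
  assumes "m' ''n'' 0 = int n"
  shows "okm L 6 scalars_prog m' base"
proof -
  have nn: "\<bar>int N\<bar> \<le> 2 ^ L" "\<bar>K\<bar> \<le> 2 ^ L" "\<bar>W\<bar> \<le> 2 ^ L" "\<bar>W ^ s\<bar> \<le> 2 ^ L" "\<bar>W ^ m\<bar> \<le> 2 ^ L" "\<bar>2 * W ^ m\<bar> \<le> 2 ^ L"
    using fit K_pos W_pos pow_fit[OF s_le] pow_fit[of m] pow_pos[of m] by auto
  have eqs: "int n * int Q = int N" "kappa * int n = K" "2 * (K * int N * amax) + 1 = W"
    by (simp_all add: N_def K_def W_def)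
  have "okm L (1 + (1 + (1 + (1 + (1 + 1))))) scalars_prog m' base"
    unfolding scalars_prog_def
    by (intro okm_seq okm_assign) (simp_all add: assms eqs nn nn[simplified] base_def)
  then show ?thesis by (simp add: eval_nat_numeral)
qed

lemma ok_read_prog:
  assumes "base m'"
  shows "ok L (len * (1 + 2) + 2) read_prog m' (map iv [0..<len]) ys
    (\<lambda>m'' xs' ys'. base m'' \<and> (\<forall>i<len. m'' ''in'' (int i) = iv i) \<and> ys' = ys)"
proof -
  have h: "aval (Plus (Const (int s)) (Times (scal ''n'') (Const (int (m - s + q))))) m'' = int len"
    if "m'' ''n'' 0 = int n" for m'' using that by (simp add: len_def)
  have "ok L (nat (int len - 0) * (1 + 2) + 2) read_prog m' (map iv [0..<len]) ys
    (\<lambda>m'' xs' ys'. base m'' \<and> (\<forall>i<len. m'' ''in'' (int i) = iv i) \<and> ys' = ys)"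
    unfolding read_prog_def
  proof (rule ok_for[where I = "\<lambda>i m'' xs' ys'. xs' = map iv [nat i..<len] \<and> ys' = ys \<and>
      (\<forall>i'<nat i. m'' ''in'' (int i') = iv i')"])
    show "0 \<le> int len" "\<bar>0\<bar> \<le> (2::int) ^ L" "\<bar>int len\<bar> \<le> 2 ^ L" using fit(2) by auto
  next
    fix i m'' xs' ys' assume "\<And>w. w \<notin> insert ''i'' (mods (Read ''in'' (scal ''i''))) \<Longrightarrow> m'' w = m' w"
    then show "aval (Plus (Const (int s)) (Times (scal ''n'') (Const (int (m - s + q))))) m'' = int len"
      using assms by (intro h) (simp add: base_def)
    assume i: "m'' ''i'' 0 = i" "0 \<le> i" "i < int len" and I: "xs' = map iv [nat i..<len] \<and> ys' = ys \<and>
      (\<forall>i'<nat i. m'' ''in'' (int i') = iv i')"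
    then obtain j where j: "i = int j" "j < len" by (metis nat_0_le of_nat_less_iff)
    have "ok L 1 (Read ''in'' (scal ''i'')) m'' (iv j # map iv [Suc j..<len]) ys' (\<lambda>m''' xs'' ys''. m''' ''i'' 0 = i \<and>
        xs'' = map iv [nat (i + 1)..<len] \<and> ys'' = ys \<and>
        (\<forall>i'<nat (i + 1). update m''' ''i'' 0 (i + 1) ''in'' (int i') = iv i'))"
      using fit(3)[OF j(2)] I i j by (intro ok_read) (auto simp: nat_add_distrib less_Suc_eq)
    moreover have "xs' = iv j # map iv [Suc j..<len]" using I j by (simp add: upt_conv_Cons)
    ultimately show "ok L 1 (Read ''in'' (scal ''i'')) m'' xs' ys' (\<lambda>m''' xs'' ys''. m''' ''i'' 0 = i \<and>
        xs'' = map iv [nat (i + 1)..<len] \<and> ys'' = ys \<and>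
        (\<forall>i'<nat (i + 1). update m''' ''i'' 0 (i + 1) ''in'' (int i') = iv i'))" by simp
  next
    fix m'' xs' ys' assume fr: "\<And>w. w \<notin> insert ''i'' (mods (Read ''in'' (scal ''i''))) \<Longrightarrow> m'' w = m' w"
      and I: "xs' = map iv [nat (int len)..<len] \<and> ys' = ys \<and> (\<forall>i'<nat (int len). m'' ''in'' (int i') = iv i')"
    have "base m''" using assms fr by (simp add: base_def)
    then show "base m'' \<and> (\<forall>i<len. m'' ''in'' (int i) = iv i) \<and> ys' = ys" using I by simp
  qed simp_all
  then show ?thesis by simp
qed

definition colok :: "mem \<Rightarrow> nat \<Rightarrow> bool" where
  "colok m' t \<longleftrightarrow> m' ''E'' (int t) = code W t \<and> m' ''P'' (int t) = cap n W t \<and>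
     m' ''c'' (int t) = unflat Q cx t \<and> m' ''h'' (int t) = unflat Q slack t \<and> m' ''x'' (int t) = unflat Q start t"

definition inputs :: "mem \<Rightarrow> bool" where
  "inputs m' \<longleftrightarrow> (\<forall>i<len. m' ''in'' (int i) = iv i)"

lemma sx_ge: "t < N \<Longrightarrow> unflat Q start t \<le> sx" "sx \<ge> 0"
  unfolding sx_def unflat_def using start_nonneg by (auto intro!: member_le_sum sum_nonneg)

lemma top_ge: "2 * sx + 1 \<le> top" "sx \<le> top"
proof -
  have "1 * (2 * sx + 1) \<le> K * (2 * sx + 1)" using K_pos sx_ge(2) by (intro mult_right_mono) auto
  then have "2 * sx + 1 \<le> K * (2 * sx + 1)" by simp
  then show "2 * sx + 1 \<le> top" unfolding top_def using sx_ge(2) by linarith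
  then show "sx \<le> top" using sx_ge(2) by linarith
qed

lemma start_fit: "t < N \<Longrightarrow> \<bar>unflat Q start t\<bar> \<le> 2 ^ L"
  using sx_ge(1)[of t] start_nonneg[of "t div Q" "t mod Q"] top_ge fit(12) unfolding unflat_def by linarith

lemma aval_rhs:
  assumes "inputs m'" "m' ''k'' 0 = int k" "k < n" "i < m"
  shows "aval (rhs_exp i) m' = rhs k i"
proof (cases "i < s")
  case True
  have "1 div (int k + 1) = (if k = 0 then 1 else 0)" by simp
  moreover have "m' ''in'' (int i) = iv i" using assms(1) True unfolding inputs_def len_def by simp
  ultimately show ?thesis using True assms by (simp add: rhs_exp_def rhs_def)
next
  case False
  let ?a = "s + k * (m - s) + (i - s)"
  have "k * (m - s) + (i - s) < n * (m - s)" using assms False s_le by (intro flat_index) auto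
  also have "\<dots> \<le> n * (m - s + q)" by simp
  finally have "?a < len" unfolding len_def by simp
  then have "m' ''in'' (int ?a) = iv ?a" using assms(1) unfolding inputs_def by blast
  then show ?thesis using False assms(2) by (simp add: rhs_exp_def rhs_def add.assoc)
qed

lemma aval_start:
  assumes "inputs m'" "m' ''k'' 0 = int k" "k < n" "j < Q"
  shows "aval (start_exp j) m' = start k j"
  using assms aval_rhs[OF assms(1-3)] by (auto simp: start_exp_def start_def Q_def)

lemma obj_index: "k < n \<Longrightarrow> j < q \<Longrightarrow> s + n * (m - s) + k * q + j < len"
  using flat_index[of k n j q] unfolding len_def by (simp add: distrib_left)

lemma aval_cost:
  assumes "inputs m'" "base m'" "m' ''k'' 0 = int k" "k < n"
  shows "aval (cost_exp j) m' = cx k j" "\<bar>cx k j\<bar> \<le> 2 ^ L"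
proof -
  let ?a = "s + n * (m - s) + k * q + j"
  show "aval (cost_exp j) m' = cx k j"
  proof (cases "j < q")
    case True
    then have "m' ''in'' (int ?a) = iv ?a" using obj_index[OF assms(4)] assms(1) unfolding inputs_def by blast
    then show ?thesis using True assms by (simp add: cost_exp_def cx_def obj_def base_def add.assoc)
  qed (simp add: cost_exp_def cx_def)
  show "\<bar>cx k j\<bar> \<le> 2 ^ L" using fit(3) obj_index[OF assms(4)] unfolding cx_def obj_def by simp
qed

lemma okm_column:
  assumes b: "base m'" "inputs m'" "m' ''k'' 0 = int k" and k: "k < n" and j: "j < Q"
    and c: "\<forall>t<k * Q + j. colok m' t"
  shows "okm L 5 (column_prog j) m' (\<lambda>m''. base m'' \<and> inputs m'' \<and> m'' ''k'' 0 = int k \<and> (\<forall>t<k * Q + Suc j. colok m'' t))"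
proof -
  let ?t = "k * Q + j"
  have tN: "?t < N" unfolding N_def by (rule flat_index[OF k j])
  have code: "code W ?t = (\<Sum>i<m. d i j * W ^ i)" using j by (simp add: code_def)
  have cap: "cap n W ?t = (if j = 0 then W ^ s else W ^ m)" using tN j by (auto simp: cap_def N_def)
  have bounds: "\<bar>\<Sum>i<m. d i j * W ^ i\<bar> \<le> 2 ^ L" "\<bar>cx k j\<bar> \<le> 2 ^ L" "\<bar>slack k j\<bar> \<le> 2 ^ L" "\<bar>start k j\<bar> \<le> 2 ^ L"
    using code_fit[OF tN] pow_fit[of m] aval_cost(2)[OF b(2,1,3) k] start_fit[OF tN] j unfolding code by (auto simp: slack_def)
  define T where "T = int ?t"
  define m1 where "m1 = update m' ''E'' T (\<Sum>i<m. d i j * W ^ i)"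
  define m2 where "m2 = update m1 ''P'' T (if j = 0 then W ^ s else W ^ m)"
  define m3 where "m3 = update m2 ''c'' T (cx k j)"
  define m4 where "m4 = update m3 ''h'' T (slack k j)"
  define m5 where "m5 = update m4 ''x'' T (start k j)"
  note defs = m1_def m2_def m3_def m4_def m5_def
  have inv: "base m1" "base m2" "base m3" "base m4" "base m5" "inputs m1" "inputs m2" "inputs m3" "inputs m4" "inputs m5"
    "m1 ''k'' 0 = int k" "m2 ''k'' 0 = int k" "m3 ''k'' 0 = int k" "m4 ''k'' 0 = int k" "m5 ''k'' 0 = int k"
    using b by (simp_all add: defs base_def inputs_def)
  have W: "m' ''W'' 0 = W" "m1 ''Ws'' 0 = W ^ s" "m1 ''Wm'' 0 = W ^ m" using b(1) inv(1) by (simp_all add: base_def)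
  have fin: "colok m5 t" if "t < k * Q + Suc j" for t
  proof (cases "t = ?t")
    case True
    then have "int t = T" by (simp add: T_def)
    then show ?thesis using code cap j unfolding colok_def True by (simp add: defs)
  next
    case False
    then have "int t \<noteq> T" unfolding T_def by linarith
    moreover have "colok m' t" using c that False by simp
    ultimately show ?thesis by (simp add: colok_def defs)
  qed
  have idx: "aval (Plus (Times (scal ''k'') (Const (int Q))) (Const (int j))) w = T" if "w ''k'' 0 = int k" for w
    using that by (simp add: T_def)
  have "okm L (1 + (1 + (1 + (1 + 1)))) (column_prog j) m'
      (\<lambda>m''. base m'' \<and> inputs m'' \<and> m'' ''k'' 0 = int k \<and> (\<forall>t<k * Q + Suc j. colok m'' t))"
    unfolding column_prog_def Let_def
  proof (rule okm_assign_seq[OF idx[of m', OF b(3)]])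
    let ?Q = "\<lambda>m''. base m'' \<and> inputs m'' \<and> m'' ''k'' 0 = int k \<and> (\<forall>t<k * Q + Suc j. colok m'' t)"
    let ?t = "Plus (Times (scal ''k'') (Const (int Q))) (Const (int j))"
    have x: "okm L 1 (Assign ''x'' ?t (start_exp j)) m4 ?Q"
    proof (rule okm_assign)
      note eq = idx[of m4, OF inv(14)] aval_start[OF inv(9,14) k j]
      show "\<bar>aval (start_exp j) m4\<bar> \<le> 2 ^ L" unfolding eq by (rule bounds)
      show "?Q (update m4 ''x'' (aval ?t m4) (aval (start_exp j) m4))"
        unfolding eq m5_def[symmetric] using inv fin by blast
    qed
    have h: "okm L (1 + 1) (Seq (Assign ''h'' ?t (Const (if j < q then 0 else 1))) (Assign ''x'' ?t (start_exp j))) m3 ?Q"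
      by (rule okm_assign_seq[OF idx[of m3, OF inv(13)] _ bounds(3)]) (use x in \<open>simp_all add: m4_def slack_def\<close>)
    have c: "okm L (1 + (1 + 1)) (Seq (Assign ''c'' ?t (cost_exp j)) (Seq (Assign ''h'' ?t (Const (if j < q then 0 else 1)))
        (Assign ''x'' ?t (start_exp j)))) m2 ?Q"
      by (rule okm_assign_seq[OF idx[of m2, OF inv(12)] aval_cost(1)[OF inv(7,2,12) k] bounds(2) h[unfolded m3_def]])
    have Pb: "\<bar>if j = 0 then W ^ s else W ^ m\<bar> \<le> 2 ^ L" using pow_fit[OF s_le] pow_fit[of m] by simp
    show "okm L (1 + (1 + (1 + 1))) (Seq (Assign ''P'' ?t (if j = 0 then scal ''Ws'' else scal ''Wm''))
        (Seq (Assign ''c'' ?t (cost_exp j)) (Seq (Assign ''h'' ?t (Const (if j < q then 0 else 1)))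
        (Assign ''x'' ?t (start_exp j))))) (update m' ''E'' T (\<Sum>i<m. d i j * W ^ i)) ?Q"
      unfolding m1_def[symmetric]
      by (rule okm_assign_seq[OF idx[of m1, OF inv(11)] _ _ c[unfolded m2_def]]) (use W Pb in auto)
  qed (use W bounds in auto)
  then show ?thesis by (simp add: eval_nat_numeral)
qed

lemma okm_columns:
  assumes b: "base m'" "inputs m'"
  shows "okm L (n * ((1 + Q * 5) + 2) + 2 + 1) columns_prog m'
    (\<lambda>m''. base m'' \<and> (\<forall>t<N. colok m'' t) \<and> m'' ''P'' (int N) = 1)"
  unfolding columns_prog_def
proof (rule okm_seq)
  have "okm L (nat (int n - 0) * ((1 + Q * 5) + 2) + 2) (For ''k'' (Const 0) (scal ''n'') (unroll column_prog Q)) m'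
    (\<lambda>m''. okm L 1 (Assign ''P'' (scal ''N'') (Const 1)) m''
       (\<lambda>m''. base m'' \<and> (\<forall>t<N. colok m'' t) \<and> m'' ''P'' (int N) = 1))"
  proof (rule okm_for[where I = "\<lambda>i m''. base m'' \<and> inputs m'' \<and> (\<forall>t<nat i * Q. colok m'' t)"])
    show "0 \<le> int n" "\<bar>0\<bar> \<le> (2::int) ^ L" "\<bar>int n\<bar> \<le> 2 ^ L" using fit(1) by auto
    show "base (update m' ''k'' 0 0) \<and> inputs (update m' ''k'' 0 0) \<and> (\<forall>t<nat 0 * Q. colok (update m' ''k'' 0 0) t)"
      using b by (simp add: base_def inputs_def)
  next
    fix i m'' assume I: "base m'' \<and> inputs m'' \<and> (\<forall>t<nat i * Q. colok m'' t)"
    then show "aval (scal ''n'') m'' = int n" by (simp add: base_def)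
    assume i: "m'' ''k'' 0 = i" "0 \<le> i" "i < int n"
    define k where "k = nat i"
    have k: "i = int k" "k < n" using i by (auto simp: k_def)
    have "okm L (1 + Q * 5) (unroll column_prog Q) m''
      (\<lambda>w. base w \<and> inputs w \<and> w ''k'' 0 = int k \<and> (\<forall>t<k * Q + Q. colok w t))"
      by (rule okm_unroll[where I = "\<lambda>j w. base w \<and> inputs w \<and> w ''k'' 0 = int k \<and> (\<forall>t<k * Q + j. colok w t)"])
        (use I i k okm_column in auto)
    moreover have "nat (int k + 1) * Q = k * Q + Q" by (simp add: nat_add_distrib)
    ultimately show "okm L (1 + Q * 5) (unroll column_prog Q) m'' (\<lambda>w. w ''k'' 0 = i \<and>
       base (update w ''k'' 0 (i + 1)) \<and> inputs (update w ''k'' 0 (i + 1)) \<and>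
       (\<forall>t<nat (i + 1) * Q. colok (update w ''k'' 0 (i + 1)) t))"
      unfolding k by (elim okm_mono) (simp_all add: base_def inputs_def colok_def)
  next
    fix m'' assume I: "base m'' \<and> inputs m'' \<and> (\<forall>t<nat (int n) * Q. colok m'' t)"
    then show "okm L 1 (Assign ''P'' (scal ''N'') (Const 1)) m''
       (\<lambda>m''. base m'' \<and> (\<forall>t<N. colok m'' t) \<and> m'' ''P'' (int N) = 1)"
      by (intro okm_assign) (auto simp: base_def colok_def simp flip: N_def)
  qed simp_all
  then show "okm L (n * ((1 + Q * 5) + 2) + 2) (For ''k'' (Const 0) (scal ''n'') (unroll column_prog Q)) m'
    (\<lambda>m''. okm L 1 (Assign ''P'' (scal ''N'') (Const 1)) m''
       (\<lambda>m''. base m'' \<and> (\<forall>t<N. colok m'' t) \<and> m'' ''P'' (int N) = 1))" by simp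
qed

definition cols :: "mem \<Rightarrow> bool" where
  "cols m' \<longleftrightarrow> base m' \<and> (\<forall>t<N. colok m' t) \<and> m' ''P'' (int N) = 1"

lemma sums_mono:
  assumes "t \<le> N"
  shows "0 \<le> (\<Sum>u<t. unflat Q cx u * unflat Q cx u)" "(\<Sum>u<t. unflat Q cx u * unflat Q cx u) \<le> sc"
    "0 \<le> (\<Sum>u<t. unflat Q start u)" "(\<Sum>u<t. unflat Q start u) \<le> sx"
proof -
  show "0 \<le> (\<Sum>u<t. unflat Q cx u * unflat Q cx u)" by (auto intro: sum_nonneg)
  show "0 \<le> (\<Sum>u<t. unflat Q start u)" unfolding unflat_def using start_nonneg by (auto intro: sum_nonneg)
  show "(\<Sum>u<t. unflat Q cx u * unflat Q cx u) \<le> sc" unfolding sc_def using assms by (intro sum_mono2) auto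
  show "(\<Sum>u<t. unflat Q start u) \<le> sx" unfolding sx_def unflat_def using assms start_nonneg by (intro sum_mono2) auto
qed

lemma okm_sums:
  assumes b: "cols m'"
  shows "okm L (1 + (1 + (N * (2 + 2) + 2))) sums_prog m' (\<lambda>m''. cols m'' \<and> m'' ''sc'' 0 = sc \<and> m'' ''sx'' 0 = sx)"
proof -
  define m1 where "m1 = update (update m' ''sc'' 0 0) ''sx'' 0 0"
  have c1: "cols m1" using b by (simp add: m1_def cols_def base_def colok_def)
  let ?body = "Seq (put ''sc'' (Plus (scal ''sc'') (Times (Cell ''c'' (scal ''t'')) (Cell ''c'' (scal ''t'')))))
            (put ''sx'' (Plus (scal ''sx'') (Cell ''x'' (scal ''t''))))"
  have "okm L (nat (int N - 0) * ((1 + 1) + 2) + 2) (For ''t'' (Const 0) (scal ''N'') ?body) m1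
     (\<lambda>m''. cols m'' \<and> m'' ''sc'' 0 = sc \<and> m'' ''sx'' 0 = sx)"
  proof (rule okm_for[where I = "\<lambda>i m''. m'' ''sc'' 0 = (\<Sum>u<nat i. unflat Q cx u * unflat Q cx u) \<and>
      m'' ''sx'' 0 = (\<Sum>u<nat i. unflat Q start u)"])
    show "0 \<le> int N" "\<bar>0\<bar> \<le> (2::int) ^ L" "\<bar>int N\<bar> \<le> 2 ^ L" using fit(4) by auto
  next
    fix i m'' assume fr: "\<And>w. w \<notin> insert ''t'' (mods ?body) \<Longrightarrow> m'' w = m1 w"
    then have c: "cols m''" using c1 by (simp add: cols_def base_def colok_def)
    then show "aval (scal ''N'') m'' = int N" by (simp add: cols_def base_def)
    assume i: "m'' ''t'' 0 = i" "0 \<le> i" "i < int N"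
      "m'' ''sc'' 0 = (\<Sum>u<nat i. unflat Q cx u * unflat Q cx u) \<and> m'' ''sx'' 0 = (\<Sum>u<nat i. unflat Q start u)"
    define t where "t = nat i"
    have t: "i = int t" "t < N" "nat (int t + 1) = Suc t" using i by (auto simp: t_def)
    have vals: "m'' ''c'' (int t) = unflat Q cx t" "m'' ''x'' (int t) = unflat Q start t"
      using c t by (auto simp: cols_def colok_def)
    have b1: "\<bar>(\<Sum>u<t. unflat Q cx u * unflat Q cx u) + unflat Q cx t * unflat Q cx t\<bar> \<le> 2 ^ L"
      using sums_mono(1,2)[of "Suc t"] t(2) fit(9) by simp
    have b2: "\<bar>(\<Sum>u<t. unflat Q start u) + unflat Q start t\<bar> \<le> 2 ^ L"
      using sums_mono(3,4)[of "Suc t"] t(2) top_ge(2) fit(12) by simp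
    show "okm L (1 + 1) ?body m'' (\<lambda>w. w ''t'' 0 = i \<and>
      update w ''t'' 0 (i + 1) ''sc'' 0 = (\<Sum>u<nat (i + 1). unflat Q cx u * unflat Q cx u) \<and>
      update w ''t'' 0 (i + 1) ''sx'' 0 = (\<Sum>u<nat (i + 1). unflat Q start u))"
      by (intro okm_seq okm_assign) (use i(1,4) t vals b1 b2 in simp_all)
  next
    fix m'' assume fr: "\<And>w. w \<notin> insert ''t'' (mods ?body) \<Longrightarrow> m'' w = m1 w"
      and I: "m'' ''sc'' 0 = (\<Sum>u<nat (int N). unflat Q cx u * unflat Q cx u) \<and>
      m'' ''sx'' 0 = (\<Sum>u<nat (int N). unflat Q start u)"
    from fr have "cols m''" using c1 by (simp add: cols_def base_def colok_def)
    then show "cols m'' \<and> m'' ''sc'' 0 = sc \<and> m'' ''sx'' 0 = sx" using I by (simp add: sc_def sx_def)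
  qed (simp_all add: m1_def)
  then have "okm L (N * (2 + 2) + 2) (For ''t'' (Const 0) (scal ''N'') ?body) m1
     (\<lambda>m''. cols m'' \<and> m'' ''sc'' 0 = sc \<and> m'' ''sx'' 0 = sx)" by (simp add: numeral_2_eq_2)
  then show ?thesis unfolding sums_prog_def
    by (intro okm_assign_seq[where a = 0 and b = 0]) (simp_all add: m1_def)
qed

definition ready :: "mem \<Rightarrow> bool" where
  "ready m' \<longleftrightarrow> cols m' \<and> m' ''sx'' 0 = sx \<and> m' ''M'' 0 = M \<and> m' ''inf'' 0 = inf"

lemma okm_penalty:
  assumes b: "cols m'" "m' ''sc'' 0 = sc" "m' ''sx'' 0 = sx"
  shows "okm L 4 penalty_prog m' (\<lambda>m''. ready m'' \<and> m'' ''f'' 0 = 1 \<and> m'' ''lam'' 0 = 1 \<and> m'' ''mu'' 0 = m' ''mu'' 0)"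
proof -
  have sc0: "sc \<ge> 0" using sums_mono(1)[of N] by (simp add: sc_def)
  have M0: "M \<ge> 0" unfolding M_def using K_pos sc0 by simp
  have B0: "B \<ge> 0" unfolding B_def using K_pos sc0 M0 by simp
  have inf0: "inf \<ge> 0" unfolding inf_def using B0 by simp
  have bb: "\<bar>M\<bar> \<le> 2 ^ L" "\<bar>inf\<bar> \<le> 2 ^ L" using M0 inf0 fit(10,11) by auto
  have K: "m' ''K'' 0 = K" "m' ''N'' 0 = int N" using b by (auto simp: cols_def base_def)
  have eqs: "K * sc + 1 = M" "int N * (K * (sc + M)) + 1 = inf" by (simp_all add: M_def inf_def B_def)
  have "okm L (1 + (1 + (1 + 1))) penalty_prog m'
      (\<lambda>m''. ready m'' \<and> m'' ''f'' 0 = 1 \<and> m'' ''lam'' 0 = 1 \<and> m'' ''mu'' 0 = m' ''mu'' 0)"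
    unfolding penalty_prog_def
    by (intro okm_seq okm_assign)
      (use b in \<open>simp_all add: K eqs bb ready_def cols_def base_def colok_def\<close>)
  then show ?thesis by (simp add: eval_nat_numeral)
qed

definition T_setup :: nat where
  "T_setup = 1 + (6 + (len * 3 + 2 + (n * (Q * 5 + 3) + 3 + (N * 4 + 4 + 4))))"

lemma ok_setup:
  "ok L T_setup setup_prog (\<lambda>_ _. 0) (int n # map iv [0..<len]) []
    (\<lambda>m' xs ys. ready m' \<and> m' ''f'' 0 = 1 \<and> m' ''lam'' 0 = 1 \<and> m' ''mu'' 0 = 0 \<and> ys = [])"
proof -
  define m0 :: mem where "m0 = update (\<lambda>_ _. 0) ''n'' 0 (int n)"
  let ?T5 = "((1 + (1 + (N * (2 + 2) + 2))) + 4)"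
  let ?T4 = "((n * ((1 + Q * 5) + 2) + 2 + 1) + ?T5)"
  let ?T3 = "((len * (1 + 2) + 2) + ?T4)"
  let ?T2 = "(6 + ?T3)"
  let ?P5 = "(Seq sums_prog penalty_prog)"
  let ?P4 = "(Seq columns_prog ?P5)"
  let ?P3 = "(Seq read_prog ?P4)"
  let ?P2 = "(Seq scalars_prog ?P3)"
  let ?R = "\<lambda>m' xs ys. ready m' \<and> m' ''f'' 0 = 1 \<and> m' ''lam'' 0 = 1 \<and> m' ''mu'' 0 = 0 \<and> ys = []"
  have pen: "ok L 4 penalty_prog m' xs [] ?R" if "cols m' \<and> m' ''sc'' 0 = sc \<and> m' ''sx'' 0 = sx" "m' ''mu'' 0 = 0" for m' xs
    by (rule ok_mono[OF okmD[OF okm_penalty]]) (use that in auto)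
  \<comment> \<open>The setup never assigns \<open>mu\<close>, so it keeps the initial value 0 on
    which the unboundedness test relies.\<close>
  have mu: "''mu'' \<notin> mods sums_prog" "''mu'' \<notin> mods columns_prog" "''mu'' \<notin> mods read_prog" "''mu'' \<notin> mods scalars_prog"
    by (simp_all add: sums_prog_def columns_prog_def read_prog_def scalars_prog_def mods_unroll column_prog_def Let_def)
  have sums: "ok L ?T5 ?P5 m' xs [] ?R"
    if "cols m'" "m' ''mu'' 0 = 0" for m' xs
  proof (rule ok_seq, rule ok_mono[OF okmD[OF okm_frame[OF okm_sums[OF that(1)]]] order_refl])
    fix w xs' and ys' :: "int list"
    assume w: "((cols w \<and> w ''sc'' 0 = sc \<and> w ''sx'' 0 = sx) \<and> (\<forall>v. v \<notin> mods sums_prog \<longrightarrow> w v = m' v)) \<and> xs' = xs \<and> ys' = []"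
    then have "w ''mu'' 0 = 0" using mu(1) that(2) by simp
    with w show "ok L 4 penalty_prog w xs' ys' ?R" using pen by blast
  qed
  have columns: "ok L ?T4
      ?P4 m' xs [] ?R"
    if "base m'" "inputs m'" "m' ''mu'' 0 = 0" for m' xs
  proof (rule ok_seq, rule ok_mono[OF okmD[OF okm_frame[OF okm_columns[OF that(1,2)]]] order_refl])
    fix w xs' and ys' :: "int list"
    assume w: "((base w \<and> (\<forall>t<N. colok w t) \<and> w ''P'' (int N) = 1) \<and>
      (\<forall>v. v \<notin> mods columns_prog \<longrightarrow> w v = m' v)) \<and> xs' = xs \<and> ys' = []"
    then have "w ''mu'' 0 = 0" "cols w" using mu(2) that(3) by (simp_all add: cols_def)
    with w show "ok L ?T5 ?P5 w xs' ys' ?R"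
      using sums by blast
  qed
  have read: "ok L ?T3
      ?P3 m' (map iv [0..<len]) [] ?R"
    if "base m'" "m' ''mu'' 0 = 0" for m'
  proof (rule ok_seq, rule ok_mono[OF ok_frame[OF ok_read_prog[OF that(1)]] order_refl])
    fix w xs' and ys' :: "int list"
    assume w: "(base w \<and> (\<forall>i<len. w ''in'' (int i) = iv i) \<and> ys' = []) \<and> (\<forall>v. v \<notin> mods read_prog \<longrightarrow> w v = m' v)"
    then have "w ''mu'' 0 = 0" "inputs w" using mu(3) that(2) by (simp_all add: inputs_def)
    with w show "ok L ?T4
      ?P4 w xs' ys' ?R" using columns by blast
  qed
  have scalars: "ok L ?T2
      ?P2 m0 (map iv [0..<len]) [] ?R"
  proof (rule ok_seq, rule ok_mono[OF okmD[OF okm_frame[OF okm_scalars]] order_refl])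
    show "m0 ''n'' 0 = int n" by (simp add: m0_def)
    fix w xs' and ys' :: "int list"
    assume w: "(base w \<and> (\<forall>v. v \<notin> mods scalars_prog \<longrightarrow> w v = m0 v)) \<and> xs' = map iv [0..<len] \<and> ys' = []"
    then have "w ''mu'' 0 = 0" using mu(4) by (simp add: m0_def)
    with w show "ok L ?T3
      ?P3 w xs' ys' ?R" using read by blast
  qed
  have "ok L (1 + ?T2)
     setup_prog (\<lambda>_ _. 0) (int n # map iv [0..<len]) [] ?R"
    unfolding setup_prog_def
  proof (rule ok_seq, rule ok_read)
    have "update (\<lambda>_ _. 0) ''n'' (aval (Const 0) (\<lambda>_ _. 0)) (int n) = m0" by (simp add: m0_def)
    then show "ok L ?T2
      ?P2
      (update (\<lambda>_ _. 0) ''n'' (aval (Const 0) (\<lambda>_ _. 0)) (int n)) (map iv [0..<len]) [] ?R"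
      using scalars by simp
  qed (use fit(1) in simp)
  then show ?thesis by (rule ok_mono) (auto simp: T_setup_def algebra_simps)
qed

end

section \<open>Scaling\<close>

context dp
begin

text \<open>The path traced by \<open>forward\<close> exists independently of the machine. The
  unboundedness test runs \<open>backward\<close> alone and needs this to interpret its
  value.\<close>

lemma table_attained:
  assumes f: "filled V G 0"
  shows "\<exists>g. valid g \<and> wdot g = V 0"
proof -
  have "\<exists>g. upto g t \<and> V (adr t (pre g t)) = V 0 - (\<Sum>u<t. w u * g u)" if "t \<le> N" for t
    using that
  proof (induction t)
    case 0
    show ?case by (intro exI[of _ "\<lambda>_. 0"]) (simp add: upto_def adr_def pre_def)
  next
    case (Suc t)
    then obtain g where g: "upto g t" "V (adr t (pre g t)) = V 0 - (\<Sum>u<t. w u * g u)" by auto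
    have "t < N" using Suc.prems by simp
    from follow(1,3)[OF f g(1) this g(2)] show ?case by blast
  qed
  then obtain g where g: "upto g N" "V (adr N (pre g N)) = V 0 - (\<Sum>u<N. w u * g u)" by blast
  have v: "valid g" using g(1) by (simp add: upto_def valid_def)
  have "pre g N = 0" by (rule valid_end[OF v])
  then show ?thesis using g(2) f v by (auto simp: filled_def wdot_def)
qed

end

context nfold_rows
begin

text \<open>The flags \<open>mu\<close> and \<open>f\<close> switch the iterate and the objective on; with \<open>mu = 0\<close> the dynamic
  program searches for improving directions in the nonnegative orthant, that is, for unboundedness.\<close>

definition test_prog :: com where
  "test_prog = Seq backward (Seq (Cond (Less (Cell ''V'' (Const 0)) (Const 0)) (put ''f'' (Const 0)) Skip)
     (put ''mu'' (Const 1)))"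

definition double_prog :: com where
  "double_prog = While (Not (Less (scal ''sx'') (scal ''lam''))) (put ''lam'' (Times (Const 2) (scal ''lam'')))"

text \<open>Halving comes first: at the initial scale, above all entries, the starting point is
  already optimal.\<close>

definition scale_prog :: com where
  "scale_prog = While (Less (Const 1) (scal ''lam''))
     (Seq (put ''lam'' (Quot (scal ''lam'') (Const 2))) (Seq backward forward))"

definition slack_prog :: com where
  "slack_prog = Seq (put ''sl'' (Const 0)) (For ''t'' (Const 0) (scal ''N'')
     (put ''sl'' (Plus (scal ''sl'') (Times (Cell ''h'' (scal ''t'')) (Cell ''x'' (scal ''t''))))))"

definition write_prog :: com where
  "write_prog = Seq (Write (Const 2)) (For ''k'' (Const 0) (scal ''n'')
     (unroll (\<lambda>j. Write (Cell ''x'' (Plus (Times (scal ''k'') (Const (int Q))) (Const (int j))))) q))"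

text \<open>Remaining slack is examined first, because an improving direction proves unboundedness
  only if a feasible point exists.\<close>

definition output_prog :: com where
  "output_prog = Cond (Less (Const 0) (scal ''sl'')) (Write (Const 0))
     (Cond (Less (scal ''f'') (Const 1)) (Write (Const 1)) write_prog)"

definition nfold_prog :: com where
  "nfold_prog = Seq setup_prog (Seq test_prog (Seq double_prog (Seq scale_prog (Seq slack_prog output_prog))))"

end

context nfold_run
begin

definition solution_list :: "(nat \<Rightarrow> nat \<Rightarrow> int) \<Rightarrow> nat \<Rightarrow> int list" where
  "solution_list x k = concat (map (\<lambda>k. map (x k) [0..<q]) [0..<k])"

definition correct_output :: "int list \<Rightarrow> bool" where
  "correct_output ys \<longleftrightarrow> ys = [0] \<and> \<not> (\<exists>z. feasible z) \<or>
     ys = [1] \<and> (\<forall>b. \<exists>z. feasible z \<and> cost z < b) \<or>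
     (\<exists>x. ys = 2 # solution_list x n \<and> feasible x \<and> (\<forall>z. feasible z \<longrightarrow> cost x \<le> cost z))"

end

section \<open>Verification of test, scaling and output\<close>

context nfold_fits
begin

text \<open>The data that stay unchanged from the end of the setup on; the iterate \<open>x\<close>,
  the scale \<open>lam\<close> and the two flags are left out.\<close>

definition fixed :: "mem \<Rightarrow> bool" where
  "fixed m' \<longleftrightarrow> base m' \<and> m' ''sx'' 0 = sx \<and> m' ''M'' 0 = M \<and> m' ''inf'' 0 = inf \<and>
     (\<forall>t<N. m' ''E'' (int t) = code W t \<and> m' ''c'' (int t) = unflat Q cx t \<and> m' ''h'' (int t) = unflat Q slack t) \<and>
     (\<forall>t\<le>N. m' ''P'' (int t) = cap n W t)"

definition fixed_vars :: "string set" where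
  "fixed_vars = {''n'', ''N'', ''K'', ''W'', ''Ws'', ''Wm'', ''D'', ''sx'', ''M'', ''inf'', ''E'', ''c'', ''h'', ''P''}"

lemma fixed_frame:
  assumes "fixed m'" "\<And>v. v \<notin> F \<Longrightarrow> m'' v = m' v" "\<forall>v\<in>F. v \<notin> fixed_vars"
  shows "fixed m''"
proof -
  have "\<forall>v\<in>fixed_vars. m'' v = m' v" using assms(2,3) by blast
  then show ?thesis using assms(1) unfolding fixed_def base_def fixed_vars_def by simp
qed

lemma ready_fixed: "ready m' \<Longrightarrow> fixed m'" "ready m' \<Longrightarrow> t < N \<Longrightarrow> m' ''x'' (int t) = unflat Q start t"
  by (auto simp: ready_def cols_def colok_def fixed_def cap_def N_def le_less)

lemma sc_nonneg: "sc \<ge> 0" using sums_mono(1)[of N] by (simp add: sc_def)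
lemma M_pos: "M \<ge> 1" unfolding M_def using K_pos sc_nonneg by simp
lemma B_nonneg: "B \<ge> 0" unfolding B_def using K_pos sc_nonneg M_pos by simp

lemma abs_le_square: "\<bar>x\<bar> \<le> x * x" for x :: int
proof (cases "x = 0")
  case False
  then have "\<bar>x\<bar> * 1 \<le> \<bar>x\<bar> * \<bar>x\<bar>" by (intro mult_left_mono) auto
  then show ?thesis by (simp flip: abs_mult)
qed simp

lemma nrm_cx_le: "nrm n cx \<le> sc"
proof -
  have "sc = (\<Sum>k<n. \<Sum>j<Q. cx k j * cx k j)"
    unfolding sc_def N_def sum_flat by (intro sum.cong refl) (simp add: flat_def unflat_def)
  moreover have "nrm n cx \<le> (\<Sum>k<n. \<Sum>j<Q. cx k j * cx k j)"
    unfolding nrm_def by (intro sum_mono abs_le_square)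
  ultimately show ?thesis by simp
qed

lemma M_gt: "M > K * nrm n cx"
proof -
  have "K * nrm n cx \<le> K * sc" using K_pos nrm_cx_le by (intro mult_left_mono) auto
  then show ?thesis by (simp add: M_def)
qed

lemma G_le_K: "G \<le> K" "int (n * Q) * G \<le> K"
proof -
  have K: "K = int (n * Q) * G + int n * G + int n" unfolding K_def kappa_def by (simp add: algebra_simps)
  have "int (n * Q) * G \<ge> 0" "int n * G \<ge> 0" using G(1) by simp_all
  then show "int (n * Q) * G \<le> K" unfolding K by linarith
  have "1 * G \<le> int n * G" using n G(1) by (intro mult_right_mono) auto
  then show "G \<le> K" unfolding K using \<open>int (n * Q) * G \<ge> 0\<close> by linarith
qed

lemma weight_bound:
  assumes "f \<in> {0, 1}" "t < N"
  shows "K * \<bar>unflat Q (weight M f) t\<bar> \<le> B"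
proof -
  have "unflat Q cx t * unflat Q cx t \<le> sc" unfolding sc_def using assms(2)
    by (intro member_le_sum[of t _ "\<lambda>t. unflat Q cx t * unflat Q cx t"]) auto
  then have "\<bar>unflat Q cx t\<bar> \<le> sc" using abs_le_square[of "unflat Q cx t"] by linarith
  then have "\<bar>unflat Q (weight M f) t\<bar> \<le> sc + M"
    using assms(1) M_pos sc_nonneg by (auto simp: weight_def unflat_def slack_def)
  then show ?thesis unfolding B_def using K_pos by (intro mult_left_mono) auto
qed

lemma cap_bounds: "cap n W t \<ge> 1" "cap n W t \<le> 2 * W ^ m"
  unfolding cap_def using pow_pos[of s] pow_pos[of m] pow_le[OF s_le] by auto

lemma dp_machine:
  assumes "f \<in> {0, 1}" "\<And>t. t < N \<Longrightarrow> X t \<ge> 0"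
  shows "dp_machine N K (W ^ m) inf B X (unflat Q (weight M f)) (code W) (cap n W) L"
proof unfold_locales
  show "K \<ge> 0" "W ^ m \<ge> 1" using K_pos pow_pos by auto
  show "cap n W N = 1" by (simp add: cap_def N_def)
  show "int N * B < inf" by (simp add: inf_def)
  have "int N * B + 1 \<le> 2 ^ L" using fit(11) by (simp add: inf_def)
  then show "int N * B \<le> 2 ^ L" by simp
  show "W ^ m \<le> 2 ^ L" using pow_fit[of m] by simp
  show "W ^ m + K * \<bar>code W t\<bar> \<le> 2 ^ L" if "t < N" for t
  proof -
    have "K * \<bar>code W t\<bar> \<le> K * W ^ m" using code_fit[OF that] K_pos by (intro mult_left_mono) auto
    then have "W ^ m + K * \<bar>code W t\<bar> \<le> (K + 1) * W ^ m" by (simp add: algebra_simps)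
    then show ?thesis using fit(8) by linarith
  qed
qed (use assms weight_bound cap_bounds B_nonneg fit in auto)

lemma flat_unflat: "j < Q \<Longrightarrow> flat Q (unflat Q y) k j = y k j"
  by (simp add: flat_def)

lemma dot_unflat: "dot n (flat Q (unflat Q w)) g = dot n w g"
  by (simp add: dot_def flat_unflat)

text \<open>The state conditions of a path are the caps on encoded partial sums, so paths are the
  feasible steps inside the box.\<close>

lemma valid_iff:
  assumes X: "\<And>t. t < N \<Longrightarrow> X t \<ge> 0"
  shows "dp.valid N K lam X (code W) (cap n W) g \<longleftrightarrow>
    (\<forall>t<N. \<bar>g t\<bar> \<le> K) \<and> feas n (flat Q X) lam (flat Q g)"
proof -
  interpret dp_machine N K "W ^ m" inf B lam X "unflat Q (weight M 1)" "code W" "cap n W" L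
    by (rule dp_machine[OF _ X]) simp
  have 0: "cap n W 0 > 0" using cap_bounds(1)[of 0] by simp
  \<comment> \<open>States are checked after each move, while \<open>ker_iff_capped\<close> also
    speaks of \<open>t = 0\<close>; there the sum is 0 and the cap is positive.\<close>
  have "(\<forall>t<N. \<bar>2 * pre g (Suc t)\<bar> < cap n W (Suc t)) \<longleftrightarrow> (\<forall>t\<le>N. 2 * \<bar>pre g t\<bar> < cap n W t)"
  proof
    assume a: "\<forall>t<N. \<bar>2 * pre g (Suc t)\<bar> < cap n W (Suc t)"
    show "\<forall>t\<le>N. 2 * \<bar>pre g t\<bar> < cap n W t"
    proof (intro allI impI)
      fix t assume "t \<le> N"
      then show "2 * \<bar>pre g t\<bar> < cap n W t"
      proof (cases t)
        case 0
        then show ?thesis using \<open>cap n W 0 > 0\<close> by (simp add: pre_def)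
      next
        case (Suc u)
        then show ?thesis using a \<open>t \<le> N\<close> by (simp add: abs_mult del: pre_Suc)
      qed
    qed
  qed (simp add: abs_mult del: pre_Suc)
  moreover have "(\<forall>t\<le>N. 2 * \<bar>pre g t\<bar> < cap n W t) \<longleftrightarrow> ker n (flat Q g)" if "\<forall>t<N. \<bar>g t\<bar> \<le> K"
  proof -
    have "pre g t = (\<Sum>u<t. g u * code W u)" for t by (simp add: pre_def)
    then show ?thesis using ker_iff_capped[OF d_le_amax, of n g K] amax_pos K_pos that
      unfolding N_def W_def by simp
  qed
  moreover have "(\<forall>t<N. X t + lam * g t \<ge> 0) \<longleftrightarrow> (\<forall>k<n. \<forall>j<Q. flat Q X k j + lam * flat Q g k j \<ge> 0)"
    unfolding N_def flat_def using flat_index flat_index_ex by (metis (no_types, lifting))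
  ultimately show ?thesis unfolding valid_def move_def feas_def by (auto simp: algebra_simps)
qed

definition box :: "(nat \<Rightarrow> nat \<Rightarrow> int) \<Rightarrow> bool" where
  "box h \<longleftrightarrow> (\<forall>k<n. \<forall>j<Q. \<bar>h k j\<bar> \<le> K)"

definition best :: "(nat \<Rightarrow> int) \<Rightarrow> int \<Rightarrow> int \<Rightarrow> (nat \<Rightarrow> int) \<Rightarrow> bool" where
  "best X lam f g \<longleftrightarrow> feas n (flat Q X) lam (flat Q g) \<and> (\<forall>t<N. \<bar>g t\<bar> \<le> K) \<and>
     (\<forall>h. feas n (flat Q X) lam h \<and> box h \<longrightarrow> dot n (weight M f) (flat Q g) \<le> dot n (weight M f) h)"

definition T_try :: nat where "T_try = 1 + ((1 + 1) + 1)"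

text \<open>Iterate, scale and flag change between rounds; the step count of the backward pass is
  spelled out in the quantities that do not.\<close>

definition T_back :: nat where
  "T_back = 1 + (N * ((1 + (nat (W ^ m - (- (W ^ m))) * ((1 + (1 + ((nat (K + 1 - (- K)) * (T_try + 2) + 2) + (1 + 1)))) + 2) + 2)) + 2) + 2)"

definition T_forw :: nat where "T_forw = 1 + (N * (1 + (1 + 1) + 2) + 2)"

definition phase :: "mem \<Rightarrow> (nat \<Rightarrow> int) \<Rightarrow> int \<Rightarrow> int \<Rightarrow> bool" where
  "phase m' X lam f \<longleftrightarrow> fixed m' \<and> m' ''lam'' 0 = lam \<and> m' ''f'' 0 = f \<and> (\<forall>t<N. m' ''mu'' 0 * m' ''x'' (int t) = X t)"

context
  fixes X :: "nat \<Rightarrow> int" and lam f :: int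
  assumes f: "f \<in> {0, 1}" and X: "\<And>t. t < N \<Longrightarrow> X t \<ge> 0"
begin

interpretation dp_machine N K "W ^ m" inf B lam X "unflat Q (weight M f)" "code W" "cap n W" L
  by (rule dp_machine[OF f X])

lemma phase_env: "phase m' X lam f \<Longrightarrow> env m'"
  by (auto simp: phase_def fixed_def base_def env_def unflat_def weight_def)

lemma T_back_eq: "T_backward = T_back"
  unfolding T_backward_def T_back_def T_row_def T_entry_def T_try_def ..

lemma T_forw_eq: "T_forward = T_forw"
  unfolding T_forward_def T_forw_def ..

lemma wdot_eq: "wdot g = dot n (weight M f) (flat Q g)"
  using wdot_def[of g] dot_flat[where w = "unflat Q (weight M f)" and g = g and n = n] by (simp add: dot_unflat N_def)

lemma valid_X: "valid g \<longleftrightarrow> (\<forall>t<N. \<bar>g t\<bar> \<le> K) \<and> feas n (flat Q X) lam (flat Q g)"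
  by (rule valid_iff) (rule X)

lemma best_iff:
  assumes fl: "filled V V' 0" and g: "valid g" "wdot g = V 0"
  shows "best X lam f g"
  unfolding best_def
proof (intro conjI allI impI)
  show "feas n (flat Q X) lam (flat Q g)" "\<And>t. t < N \<Longrightarrow> \<bar>g t\<bar> \<le> K"
    using g(1) unfolding valid_X by auto
  fix h assume h: "feas n (flat Q X) lam h \<and> box h"
  have eq: "flat Q (unflat Q h) k j = h k j" if "j < Q" for k j using that by (rule flat_unflat)
  have "feas n (flat Q X) lam (flat Q (unflat Q h))"
    using h ker_cong[of n h "flat Q (unflat Q h)"] eq by (simp add: feas_def)
  moreover have "\<bar>unflat Q h t\<bar> \<le> K" if "t < N" for t
    using h flat_index_ex[of t n Q] that unfolding N_def box_def by auto
  ultimately have "valid (unflat Q h)" unfolding valid_X by blast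
  from table_le_0[OF fl this] have "V 0 \<le> dot n (weight M f) (flat Q (unflat Q h))" by (simp add: wdot_eq)
  also have "\<dots> = dot n (weight M f) h" using eq by (intro dot_cong) auto
  finally show "dot n (weight M f) (flat Q g) \<le> dot n (weight M f) h" using g(2) by (simp add: wdot_eq)
qed

lemma okm_search:
  assumes "phase m' X lam f"
  shows "okm L T_back backward m' (\<lambda>m''. \<exists>g. best X lam f g \<and> m'' ''V'' 0 = dot n (weight M f) (flat Q g))"
proof -
  have "okm L T_backward backward m' (\<lambda>m''. filled (m'' ''V'') (m'' ''G'') 0)"
    by (rule okm_backward[OF phase_env[OF assms]])
  then show ?thesis unfolding T_back_eq
  proof (rule okm_mono[OF _ order_refl])
    fix m'' :: mem assume fl: "filled (m'' ''V'') (m'' ''G'') 0"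
    from table_attained[OF fl] obtain g where g: "valid g" "wdot g = m'' ''V'' 0" by blast
    with best_iff[OF fl g] show "\<exists>g. best X lam f g \<and> m'' ''V'' 0 = dot n (weight M f) (flat Q g)"
      by (intro exI[of _ g]) (simp add: wdot_eq)
  qed
qed

lemma okm_improve:
  assumes p: "phase m' X lam f" and fitx: "\<And>t. t < N \<Longrightarrow> \<bar>m' ''x'' (int t)\<bar> + \<bar>lam\<bar> * K \<le> 2 ^ L"
  shows "okm L (T_back + T_forw) (Seq backward forward) m'
    (\<lambda>m''. \<exists>g. best X lam f g \<and> (\<forall>t<N. m'' ''x'' (int t) = m' ''x'' (int t) + lam * g t))"
proof (rule okm_seq)
  have "okm L T_backward backward m' (\<lambda>m''. filled (m'' ''V'') (m'' ''G'') 0)"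
    by (rule okm_backward[OF phase_env[OF p]])
  from okm_frame[OF this] show "okm L T_back backward m' (\<lambda>m''. okm L T_forw forward m''
    (\<lambda>m''. \<exists>g. best X lam f g \<and> (\<forall>t<N. m'' ''x'' (int t) = m' ''x'' (int t) + lam * g t)))"
    unfolding T_back_eq
  proof (rule okm_mono[OF _ order_refl])
    fix m1 :: mem assume m1: "filled (m1 ''V'') (m1 ''G'') 0 \<and> (\<forall>v. v \<notin> mods backward \<longrightarrow> m1 v = m' v)"
    have e: "env m1"
    proof (rule env_frame[OF phase_env[OF p]])
      show "m1 v = m' v" if "v \<notin> mods backward" for v using m1 that by blast
      show "\<forall>v\<in>mods backward. v \<notin> env_vars" by (simp add: env_vars_def)
    qed
    have x: "m1 ''x'' = m' ''x''" using m1 by simp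
    have "okm L T_forward forward m1 (\<lambda>m''. \<exists>g. valid g \<and> wdot g = m1 ''V'' 0 \<and>
      (\<forall>t<N. m'' ''x'' (int t) = m1 ''x'' (int t) + lam * g t))"
      by (rule okm_forward[OF e]) (use m1 fitx x in auto)
    then show "okm L T_forw forward m1
      (\<lambda>m''. \<exists>g. best X lam f g \<and> (\<forall>t<N. m'' ''x'' (int t) = m' ''x'' (int t) + lam * g t))"
      unfolding T_forw_eq x
    proof (rule okm_mono[OF _ order_refl])
      fix m2 :: mem
      assume "\<exists>g. valid g \<and> wdot g = m1 ''V'' 0 \<and> (\<forall>t<N. m2 ''x'' (int t) = m' ''x'' (int t) + lam * g t)"
      then obtain g where g: "valid g" "wdot g = m1 ''V'' 0" "\<forall>t<N. m2 ''x'' (int t) = m' ''x'' (int t) + lam * g t"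
        by (elim exE conjE)
      have "best X lam f g" by (rule best_iff[where V = "m1 ''V''", OF _ g(1,2)]) (use m1 in blast)
      then show "\<exists>g. best X lam f g \<and> (\<forall>t<N. m2 ''x'' (int t) = m' ''x'' (int t) + lam * g t)"
        using g(3) by (intro exI[of _ g] conjI)
    qed
  qed
qed

end

definition recession_nonneg :: "int \<Rightarrow> bool" where
  "recession_nonneg f \<longleftrightarrow> (\<forall>g. feas n (\<lambda>_ _. 0) 1 g \<longrightarrow> dot n (weight M f) g \<ge> 0)"

definition unbounded_dir :: "(nat \<Rightarrow> nat \<Rightarrow> int) \<Rightarrow> bool" where
  "unbounded_dir g \<longleftrightarrow> feas n (\<lambda>_ _. 0) 1 g \<and> box g \<and> dot n (weight M 1) g < 0"

text \<open>With the objective switched off, the weight is \<open>M\<close> times the slack, which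
  is nonnegative on the orthant. Scaling thus remains sound after an improving direction was found
  and decides feasibility alone.\<close>

lemma recession_nonneg_0: "recession_nonneg 0"
  unfolding recession_nonneg_def
proof (intro allI impI)
  fix g assume g: "feas n (\<lambda>_ _. 0) 1 g"
  have "dot n slack g \<ge> 0" unfolding dot_def slack_def using g
    by (auto intro!: sum_nonneg simp: feas_def)
  then show "dot n (weight M 0) g \<ge> 0" using M_pos by (simp add: dot_weight)
qed

definition tested :: "mem \<Rightarrow> bool" where
  "tested m' \<longleftrightarrow> fixed m' \<and> m' ''lam'' 0 = 1 \<and> m' ''mu'' 0 = 1 \<and>
     (\<forall>t<N. m' ''x'' (int t) = unflat Q start t) \<and>
     (m' ''f'' 0 = 1 \<and> recession_nonneg 1 \<or> m' ''f'' 0 = 0 \<and> (\<exists>g. unbounded_dir g))"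

lemma okm_test:
  assumes r: "ready m'" "m' ''f'' 0 = 1" "m' ''lam'' 0 = 1" "m' ''mu'' 0 = 0"
  shows "okm L (T_back + ((1 + 1) + 1)) test_prog m' tested"
  unfolding test_prog_def
proof (rule okm_seq)
  have z: "flat Q (\<lambda>_. 0) = (\<lambda>_ _. 0)" by (simp add: flat_def fun_eq_iff)
  have "phase m' (\<lambda>_. 0) 1 1" using r ready_fixed by (simp add: phase_def)
  then have "okm L T_back backward m' (\<lambda>m''. \<exists>g. best (\<lambda>_. 0) 1 1 g \<and> m'' ''V'' 0 = dot n (weight M 1) (flat Q g))"
    by (intro okm_search) auto
  from okm_frame[OF this]
  show "okm L T_back backward m' (\<lambda>m''. okm L ((1 + 1) + 1)
    (Seq (Cond (Less (Cell ''V'' (Const 0)) (Const 0)) (put ''f'' (Const 0)) Skip) (put ''mu'' (Const 1))) m'' tested)"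
  proof (rule okm_mono[OF _ order_refl])
    fix m1 :: mem
    assume "(\<exists>g. best (\<lambda>_. 0) 1 1 g \<and> m1 ''V'' 0 = dot n (weight M 1) (flat Q g)) \<and> (\<forall>v. v \<notin> mods backward \<longrightarrow> m1 v = m' v)"
    then obtain g where g: "best (\<lambda>_. 0) 1 1 g" "m1 ''V'' 0 = dot n (weight M 1) (flat Q g)"
      and fr: "\<And>v. v \<notin> mods backward \<Longrightarrow> m1 v = m' v" by blast
    have fx: "fixed m1" by (rule fixed_frame[OF ready_fixed(1)[OF r(1)], of "mods backward"]) (simp_all add: fixed_vars_def fr)
    have x: "m1 ''x'' (int t) = unflat Q start t" if "t < N" for t
      using ready_fixed(2)[OF r(1) that] fr[of "''x''"] by simp
    have vals: "m1 ''lam'' 0 = 1" "m1 ''f'' 0 = 1" using r fr[of "''lam''"] fr[of "''f''"] by simp_all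
    have upd: "tested w" if "w = update (update m1 ''f'' 0 a) ''mu'' 0 1 \<or> w = update m1 ''mu'' 0 1 \<and> a = 1"
      "a = 1 \<and> recession_nonneg 1 \<or> a = 0 \<and> (\<exists>g. unbounded_dir g)" for w a
    proof -
      have "fixed w" by (rule fixed_frame[OF fx, of "{''f'', ''mu''}"]) (use that(1) in \<open>auto simp: fixed_vars_def\<close>)
      moreover have "w ''f'' 0 = a" "w ''lam'' 0 = 1" "w ''mu'' 0 = 1" "w ''x'' = m1 ''x''" using that(1) vals by auto
      ultimately show ?thesis using that(2) x unfolding tested_def by simp
    qed
    show "okm L ((1 + 1) + 1) (Seq (Cond (Less (Cell ''V'' (Const 0)) (Const 0)) (put ''f'' (Const 0)) Skip) (put ''mu'' (Const 1))) m1 tested"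
    proof (rule okm_seq, rule okm_cond)
      assume "bval (Less (Cell ''V'' (Const 0)) (Const 0)) m1"
      then have "dot n (weight M 1) (flat Q g) < 0" using g(2) by simp
      moreover have "box (flat Q g)" using g(1) flat_index by (auto simp: best_def box_def flat_def N_def)
      ultimately have "unbounded_dir (flat Q g)" using g(1) unfolding unbounded_dir_def best_def z by blast
      then show "okm L 1 (put ''f'' (Const 0)) m1 (\<lambda>m''. okm L 1 (put ''mu'' (Const 1)) m'' tested)"
        by (intro okm_assign upd[of _ 0]) auto
    next
      assume "\<not> bval (Less (Cell ''V'' (Const 0)) (Const 0)) m1"
      then have nn: "dot n (weight M 1) (flat Q g) \<ge> 0" using g(2) by simp
      have "recession_nonneg 1" unfolding recession_nonneg_def
      proof (intro allI impI)
        fix h assume "feas n (\<lambda>_ _. 0) 1 h"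
        then show "dot n (weight M 1) h \<ge> 0"
        \<comment> \<open>The search has seen all directions inside the box only; the decomposition
          into pieces extends the conclusion to all directions.\<close>
        proof (rule recession[OF G_le_K(1), rotated])
          fix h' assume "feas n (\<lambda>_ _. 0) 1 h'" "\<forall>k<n. \<forall>j<Q. \<bar>h' k j\<bar> \<le> K"
          then have "dot n (weight M 1) (flat Q g) \<le> dot n (weight M 1) h'" using g(1) unfolding best_def box_def z by blast
          then show "dot n (weight M 1) h' \<ge> 0" using nn by simp
        qed
      qed
      then show "okm L 1 Skip m1 (\<lambda>m''. okm L 1 (put ''mu'' (Const 1)) m'' tested)"
        by (intro okm_skip okm_assign upd[of _ 1]) auto
    qed
  qed
qed

text \<open>The first power of two above \<open>sx\<close> is at most \<open>2 * sx + 1\<close>;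
  hence the number of rounds is at most the bit bound \<open>L\<close>.\<close>

definition top_exp :: nat where "top_exp = (LEAST p. sx < 2 ^ p)"

lemma top_exp: "sx < 2 ^ top_exp" "p < top_exp \<Longrightarrow> 2 ^ p \<le> sx" "2 ^ top_exp \<le> 2 * sx + 1" "top_exp \<le> L"
proof -
  have "sx < 2 ^ nat sx"
    using sx_ge(2) less_exp[of "nat sx"] by (metis nat_less_numeral_power_cancel_iff)
  then show 1: "sx < 2 ^ top_exp" unfolding top_exp_def by (rule LeastI)
  show 2: "2 ^ p \<le> sx" if "p < top_exp" for p using not_less_Least[OF that[unfolded top_exp_def]] by simp
  show 3: "2 ^ top_exp \<le> 2 * sx + 1"
  proof (cases top_exp)
    case 0
    then show ?thesis using sx_ge(2) by simp
  next
    case (Suc p)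
    then show ?thesis using 2[of p] by simp
  qed
  have "(2::int) ^ top_exp < 2 ^ L" using 3 fit(13) by linarith
  then show "top_exp \<le> L" by simp
qed

text \<open>For \<open>f = 0\<close> the improving direction is kept as the evidence for a later
  answer that the problem is unbounded.\<close>

definition scaled :: "mem \<Rightarrow> int \<Rightarrow> bool" where
  "scaled m' f \<longleftrightarrow> fixed m' \<and> m' ''mu'' 0 = 1 \<and> m' ''f'' 0 = f \<and> f \<in> {0, 1} \<and> recession_nonneg f \<and>
    (f = 0 \<longrightarrow> (\<exists>g. unbounded_dir g))"

lemma scaled_frame:
  assumes "scaled m' f" "\<And>v. v \<notin> F \<Longrightarrow> m'' v = m' v" "\<forall>v\<in>F. v \<notin> fixed_vars \<and> v \<noteq> ''mu'' \<and> v \<noteq> ''f''"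
  shows "scaled m'' f"
proof -
  have "fixed m''" by (rule fixed_frame[of m' F]) (use assms in \<open>auto simp: scaled_def\<close>)
  moreover have "m'' ''mu'' = m' ''mu''" "m'' ''f'' = m' ''f''" using assms(2,3) by metis+
  ultimately show ?thesis using assms(1) by (simp add: scaled_def)
qed

lemma okm_double:
  assumes t: "tested m'"
  shows "okm L (top_exp * (1 + 1) + 1) double_prog m' (\<lambda>m''. (\<exists>f. scaled m'' f) \<and>
    m'' ''lam'' 0 = 2 ^ top_exp \<and> (\<forall>t<N. m'' ''x'' (int t) = unflat Q start t))"
proof -
  let ?I = "\<lambda>k m''. k \<le> top_exp \<and> m'' ''lam'' 0 = 2 ^ (top_exp - k) \<and> m'' ''sx'' 0 = sx"
  have "okm L (top_exp * (1 + 1) + 1) double_prog m' (?I 0)"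
    unfolding double_prog_def
  proof (rule okm_while[where I = ?I])
    fix k and m'' :: mem assume I: "Suc k \<le> top_exp \<and> m'' ''lam'' 0 = 2 ^ (top_exp - Suc k) \<and> m'' ''sx'' 0 = sx"
    then have le: "2 ^ (top_exp - Suc k) \<le> sx" by (intro top_exp(2)) auto
    have "Suc (top_exp - Suc k) = top_exp - k" by (rule Suc_diff_Suc) (use I in auto)
    then have eq: "2 * 2 ^ (top_exp - Suc k) = (2::int) ^ (top_exp - k)" by (metis power_Suc)
    have "\<bar>(2::int) ^ (top_exp - k)\<bar> \<le> 2 ^ L" using le fit(13) unfolding eq[symmetric] by simp
    then have "okm L 1 (put ''lam'' (Times (Const 2) (scal ''lam''))) m'' (?I k)"
      by (intro okm_assign) (use I eq in simp_all)
    then show "bval (Not (Less (scal ''sx'') (scal ''lam''))) m'' \<and>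
      okm L 1 (put ''lam'' (Times (Const 2) (scal ''lam''))) m'' (?I k)"
      using I le by simp
  qed (use t top_exp(1) in \<open>auto simp: tested_def fixed_def\<close>)
  from okm_frame[OF this] show ?thesis
  proof (rule okm_mono[OF _ order_refl])
    fix w :: mem assume w: "?I 0 w \<and> (\<forall>v. v \<notin> mods double_prog \<longrightarrow> w v = m' v)"
    then have fr: "w v = m' v" if "v \<notin> {''lam''}" for v using that by (simp add: double_prog_def)
    have "scaled m' (m' ''f'' 0)" using t recession_nonneg_0 by (auto simp: tested_def scaled_def)
    then have "scaled w (m' ''f'' 0)" by (rule scaled_frame[of m' _ "{''lam''}"]) (simp_all add: fixed_vars_def fr)
    then show "(\<exists>f. scaled w f) \<and> w ''lam'' 0 = 2 ^ top_exp \<and> (\<forall>t<N. w ''x'' (int t) = unflat Q start t)"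
      using w t fr[of "''x''"] by (auto simp: tested_def)
  qed
qed

text \<open>The invariant at scale \<open>2 ^ k\<close>. The round that halves the scale to
  \<open>2 ^ k\<close> adds at most \<open>2 ^ k * K\<close> to a coordinate; these increments sum
  to \<open>K * (2 ^ top_exp - 2 ^ k)\<close>.\<close>

definition level :: "nat \<Rightarrow> int \<Rightarrow> (nat \<Rightarrow> int) \<Rightarrow> bool" where
  "level k f x \<longleftrightarrow> (\<forall>t<N. 0 \<le> x t \<and> x t \<le> sx + K * (2 ^ top_exp - 2 ^ k)) \<and>
     ker n (\<lambda>k j. flat Q x k j - start k j) \<and>
     (\<forall>h. feas n (flat Q x) (2 ^ k) h \<longrightarrow> dot n (weight M f) h \<ge> 0)"

lemma level_start:
  assumes d: "recession_nonneg f" and x: "\<And>t. t < N \<Longrightarrow> x t = unflat Q start t"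
  shows "level top_exp f x"
  unfolding level_def
proof (intro conjI allI impI)
  have fx: "flat Q x k j = start k j" if "k < n" "j < Q" for k j
    using x[of "k * Q + j"] flat_index[OF that] that by (simp add: flat_def N_def)
  show "0 \<le> x t" "x t \<le> sx + K * (2 ^ top_exp - 2 ^ top_exp)" if "t < N" for t
    using x[OF that] sx_ge(1)[OF that] start_nonneg by (simp_all add: unflat_def)
  have "ker n (\<lambda>k j. flat Q x k j - start k j) \<longleftrightarrow> ker n (\<lambda>_ _. 0)" using fx by (intro ker_cong) simp
  then show "ker n (\<lambda>k j. flat Q x k j - start k j)" by (simp add: ker_def)
  fix h assume h: "feas n (flat Q x) (2 ^ top_exp) h"
  show "dot n (weight M f) h \<ge> 0"
  proof (rule initial_optimal[OF _ _ h])
    show "dot n (weight M f) g \<ge> 0" if "feas n (\<lambda>_ _. 0) 1 g" for g using d that by (simp add: recession_nonneg_def)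
    show "flat Q x k j < 2 ^ top_exp" if "k < n" "j < Q" for k j
      using x[of "k * Q + j"] sx_ge(1)[of "k * Q + j"] flat_index[OF that] top_exp(1)
      by (simp add: flat_def N_def)
  qed simp
qed

lemma level_step:
  assumes l: "level (Suc k) f x" and b: "best x (2 ^ k) f g" and x': "\<And>t. t < N \<Longrightarrow> x' t = x t + 2 ^ k * g t"
  shows "level k f x'"
  unfolding level_def
proof (intro conjI allI impI)
  have fx: "flat Q x' k' j = flat Q x k' j + 2 ^ k * flat Q g k' j" if "k' < n" "j < Q" for k' j
    using x'[of "k' * Q + j"] flat_index[OF that] by (simp add: flat_def N_def)
  have fe: "feas n (flat Q x) (2 ^ k) (flat Q g)" using b by (simp add: best_def)
  have "x t + 2 ^ k * g t \<ge> 0" if t: "t < N" for t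
    using fe flat_index_ex[OF t[unfolded N_def]] by (auto simp: feas_def flat_def)
  then show "0 \<le> x' t" if "t < N" for t using x'[OF that] that by simp
  show "x' t \<le> sx + K * (2 ^ top_exp - 2 ^ k)" if t: "t < N" for t
  proof -
    have "x t \<le> sx + K * (2 ^ top_exp - 2 ^ Suc k)" using l t by (simp add: level_def)
    moreover have "2 ^ k * g t \<le> 2 ^ k * K" using b t by (intro mult_left_mono) (auto simp: best_def abs_le_iff)
    moreover have "K * (2 ^ top_exp - 2 ^ Suc k) + 2 ^ k * K = K * (2 ^ top_exp - 2 ^ k)" by (simp add: algebra_simps)
    ultimately show ?thesis using x'[OF t] by linarith
  qed
  \<comment> \<open>The addition of the step is written as subtraction of its negative to fit
    \<open>ker_diff\<close>.\<close>
  have "ker n (\<lambda>k' j. (flat Q x k' j - start k' j) - (0 - 2 ^ k * flat Q g k' j))"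
  proof (rule ker_diff)
    show "ker n (\<lambda>k' j. flat Q x k' j - start k' j)" using l by (simp add: level_def)
    have "ker n (flat Q g)" using fe by (simp add: feas_def)
    then show "ker n (\<lambda>k' j. 0 - 2 ^ k * flat Q g k' j)"
      by (simp add: ker_def sum_negf mult.left_commute flip: sum_distrib_left)
  qed
  then show "ker n (\<lambda>k' j. flat Q x' k' j - start k' j)"
    by (rule iffD1[OF ker_cong, rotated]) (simp add: fx)
  fix h assume h: "feas n (flat Q x') (2 ^ k) h"
  show "dot n (weight M f) h \<ge> 0"
  proof (rule scaling_step[OF _ _ _ G_le_K(2) fe])
    show "flat Q x k' j \<ge> 0" if "k' < n" "j < Q" for k' j
      using l flat_index[OF that] by (simp add: level_def flat_def N_def)
    show "dot n (weight M f) h' \<ge> 0" if "feas n (flat Q x) (2 * 2 ^ k) h'" for h'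
      using l that by (simp add: level_def)
    show "dot n (weight M f) (flat Q g) \<le> dot n (weight M f) g'"
      if "feas n (flat Q x) (2 ^ k) g'" "\<forall>k<n. \<forall>j<Q. \<bar>g' k j\<bar> \<le> K" for g'
      using b that by (simp add: best_def box_def)
    show "feas n (\<lambda>k' j. flat Q x k' j + 2 ^ k * flat Q g k' j) (2 ^ k) h"
      using h fx by (simp add: feas_def)
  qed simp
qed

lemma okm_scale:
  assumes s: "scaled m' f" "m' ''lam'' 0 = 2 ^ top_exp" "\<And>t. t < N \<Longrightarrow> m' ''x'' (int t) = unflat Q start t"
  shows "okm L (top_exp * ((1 + (T_back + T_forw)) + 1) + 1) scale_prog m'
    (\<lambda>m''. scaled m'' f \<and> level 0 f (\<lambda>t. m'' ''x'' (int t)))"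
proof -
  let ?I = "\<lambda>k m''. k \<le> top_exp \<and> scaled m'' f \<and> m'' ''lam'' 0 = 2 ^ k \<and> level k f (\<lambda>t. m'' ''x'' (int t))"
  have "okm L (top_exp * ((1 + (T_back + T_forw)) + 1) + 1) scale_prog m' (?I 0)"
    unfolding scale_prog_def
  proof (rule okm_while[where I = ?I])
    fix k and m'' :: mem assume I: "Suc k \<le> top_exp \<and> scaled m'' f \<and> m'' ''lam'' 0 = 2 ^ Suc k \<and>
      level (Suc k) f (\<lambda>t. m'' ''x'' (int t))"
    let ?x = "\<lambda>t. m'' ''x'' (int t)"
    define m1 where "m1 = update m'' ''lam'' 0 (2 ^ k)"
    have s1: "scaled m1 f" by (rule scaled_frame[of m'' f "{''lam''}"]) (use I in \<open>simp_all add: m1_def fixed_vars_def\<close>)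
    then have p: "phase m1 ?x (2 ^ k) f" by (simp add: phase_def scaled_def m1_def)
    have f: "f \<in> {0, 1}" using s1 by (simp add: scaled_def)
    have x0: "?x t \<ge> 0" if "t < N" for t using I that by (simp add: level_def)
    have fitx: "\<bar>m1 ''x'' (int t)\<bar> + \<bar>2 ^ k\<bar> * K \<le> 2 ^ L" if t: "t < N" for t
    proof -
      have "?x t \<le> sx + K * (2 ^ top_exp - 2 ^ Suc k)" using I t by (simp add: level_def)
      moreover have "K * (2 ^ top_exp - 2 ^ Suc k) + 2 ^ k * K = K * (2 ^ top_exp - 2 ^ k)" by (simp add: algebra_simps)
      moreover have "K * (2 ^ top_exp - 2 ^ k) \<le> K * (2 * sx + 1)"
      proof (rule mult_left_mono)
        have "(2::int) ^ k \<ge> 0" by simp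
        then show "2 ^ top_exp - 2 ^ k \<le> 2 * sx + 1" using top_exp(3) by linarith
      qed (use K_pos in simp)
      ultimately show ?thesis using x0[OF t] fit(12) by (simp add: m1_def top_def)
    qed
    have "okm L (T_back + T_forw) (Seq backward forward) m1
      (\<lambda>w. \<exists>g. best ?x (2 ^ k) f g \<and> (\<forall>t<N. w ''x'' (int t) = m1 ''x'' (int t) + 2 ^ k * g t))"
      by (rule okm_improve[OF f x0 p fitx])
    from okm_frame[OF this] have body: "okm L (T_back + T_forw) (Seq backward forward) m1 (?I k)"
    proof (rule okm_mono[OF _ order_refl])
      fix w :: mem
      assume w: "(\<exists>g. best ?x (2 ^ k) f g \<and> (\<forall>t<N. w ''x'' (int t) = m1 ''x'' (int t) + 2 ^ k * g t)) \<and>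
        (\<forall>v. v \<notin> mods (Seq backward forward) \<longrightarrow> w v = m1 v)"
      then obtain g where g: "best ?x (2 ^ k) f g" "\<And>t. t < N \<Longrightarrow> w ''x'' (int t) = ?x t + 2 ^ k * g t"
        and fr: "\<And>v. v \<notin> mods (Seq backward forward) \<Longrightarrow> w v = m1 v" by (auto simp: m1_def)
      have "scaled w f" by (rule scaled_frame[OF s1, of "mods (Seq backward forward)"]) (simp_all add: fixed_vars_def fr)
      moreover have "w ''lam'' 0 = 2 ^ k" using fr[of "''lam''"] by (simp add: m1_def)
      moreover have "level k f (\<lambda>t. w ''x'' (int t))" by (rule level_step[OF _ g]) (use I in simp)
      ultimately show "?I k w" using I by simp
    qed
    have k2: "(2::int) ^ Suc k div 2 = 2 ^ k" by simp
    have kf: "\<bar>(2::int) ^ k\<bar> \<le> 2 ^ L"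
    proof -
      have "(2::int) ^ k \<le> 2 ^ L" using I top_exp(4) by (intro power_increasing) auto
      then show ?thesis by simp
    qed
    have "(1::int) < 2 ^ Suc k" by (rule one_less_power) auto
    then show "bval (Less (Const 1) (scal ''lam'')) m'' \<and>
      okm L (1 + (T_back + T_forw)) (Seq (put ''lam'' (Quot (scal ''lam'') (Const 2))) (Seq backward forward)) m'' (?I k)"
      using I by (intro conjI okm_assign_seq[OF _ _ kf body[unfolded m1_def]]) simp_all
  qed (use s level_start[of f "\<lambda>t. m' ''x'' (int t)"] in \<open>auto simp: scaled_def\<close>)
  then show ?thesis by (rule okm_mono) auto
qed

definition summed :: "mem \<Rightarrow> int \<Rightarrow> (nat \<Rightarrow> int) \<Rightarrow> bool" where
  "summed m' f x \<longleftrightarrow> scaled m' f \<and> level 0 f x \<and> (\<forall>t<N. m' ''x'' (int t) = x t) \<and>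
     m' ''sl'' 0 = dot n slack (flat Q x)"

lemma level_le_top: "level k f x \<Longrightarrow> t < N \<Longrightarrow> x t \<le> top"
proof -
  assume l: "level k f x" "t < N"
  have "(2::int) ^ k \<ge> 0" by simp
  then have "K * (2 ^ top_exp - 2 ^ k) \<le> K * (2 * sx + 1)"
    using top_exp(3) K_pos by (intro mult_left_mono) (linarith, simp)
  then show ?thesis using l unfolding level_def top_def by fastforce
qed

lemma okm_slack:
  assumes s: "scaled m' f" and l: "level 0 f x" and x: "\<And>t. t < N \<Longrightarrow> m' ''x'' (int t) = x t"
  shows "okm L (1 + (N * (1 + 2) + 2)) slack_prog m' (\<lambda>m''. summed m'' f x)"
proof -
  define m1 where "m1 = update m' ''sl'' 0 0"
  have s1: "scaled m1 f" by (rule scaled_frame[OF s, of "{''sl''}"]) (simp_all add: m1_def fixed_vars_def)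
  let ?h = "unflat Q slack"
  let ?body = "put ''sl'' (Plus (scal ''sl'') (Times (Cell ''h'' (scal ''t'')) (Cell ''x'' (scal ''t''))))"
  have hx: "0 \<le> ?h t * x t \<and> ?h t * x t \<le> top" if "t < N" for t
    using l level_le_top[OF l that] that sx_ge(2) top_ge(2) by (auto simp: level_def unflat_def slack_def)
  have part: "\<bar>\<Sum>u<t. ?h u * x u\<bar> \<le> 2 ^ L" if "t \<le> N" for t
  proof -
    have "(\<Sum>u<t. ?h u * x u) \<le> (\<Sum>u<t. top)" using hx that by (intro sum_mono) auto
    also have "\<dots> \<le> int N * top" using that sx_ge(2) top_ge(2) by (auto intro!: mult_right_mono)
    finally have "(\<Sum>u<t. ?h u * x u) \<le> 2 ^ L" using fit(14) by linarith
    moreover have "(\<Sum>u<t. ?h u * x u) \<ge> 0" using hx that by (intro sum_nonneg) auto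
    ultimately show ?thesis by simp
  qed
  have "okm L (nat (int N - 0) * (1 + 2) + 2) (For ''t'' (Const 0) (scal ''N'') ?body) m1 (\<lambda>m''. summed m'' f x)"
  proof (rule okm_for[where I = "\<lambda>i m''. m'' ''sl'' 0 = (\<Sum>u<nat i. ?h u * x u)"])
    show "0 \<le> int N" "\<bar>0\<bar> \<le> (2::int) ^ L" "\<bar>int N\<bar> \<le> 2 ^ L" using fit(4) by auto
  next
    fix i and m'' :: mem assume fr: "\<And>w. w \<notin> insert ''t'' (mods ?body) \<Longrightarrow> m'' w = m1 w"
    then have vars: "m'' ''N'' = m' ''N''" "m'' ''h'' = m' ''h''" "m'' ''x'' = m' ''x''" by (simp_all add: m1_def)
    have fx: "fixed m'" using s by (simp add: scaled_def)
    show "aval (scal ''N'') m'' = int N" using vars fx by (simp add: fixed_def base_def)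
    assume i: "m'' ''t'' 0 = i" "0 \<le> i" "i < int N" "m'' ''sl'' 0 = (\<Sum>u<nat i. ?h u * x u)"
    define t where "t = nat i"
    have t: "i = int t" "t < N" "nat (int t + 1) = Suc t" using i by (auto simp: t_def)
    have hx': "m'' ''h'' (int t) = ?h t" "m'' ''x'' (int t) = x t" using vars fx x t by (simp_all add: fixed_def)
    have "\<bar>(\<Sum>u<t. ?h u * x u) + ?h t * x t\<bar> \<le> 2 ^ L" using part[of "Suc t"] t(2) by simp
    then show "okm L 1 ?body m'' (\<lambda>w. w ''t'' 0 = i \<and> update w ''t'' 0 (i + 1) ''sl'' 0 = (\<Sum>u<nat (i + 1). ?h u * x u))"
      by (intro okm_assign) (use i(1,4) t hx' in simp_all)
  next
    fix m'' :: mem assume fr: "\<And>w. w \<notin> insert ''t'' (mods ?body) \<Longrightarrow> m'' w = m1 w"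
      and I: "m'' ''sl'' 0 = (\<Sum>u<nat (int N). ?h u * x u)"
    have "scaled m'' f"
    proof (rule scaled_frame[OF s1])
      show "m'' v = m1 v" if "v \<notin> insert ''t'' (mods ?body)" for v using fr[OF that] .
    qed (simp add: fixed_vars_def)
    moreover have "m'' ''x'' = m' ''x''" using fr[of "''x''"] by (simp add: m1_def)
    moreover have "(\<Sum>u<N. ?h u * x u) = dot n slack (flat Q x)" unfolding N_def dot_flat dot_unflat ..
    ultimately show "summed m'' f x" using I x l by (simp add: summed_def)
  qed (simp_all add: m1_def)
  then show ?thesis unfolding slack_prog_def
    by (intro okm_assign_seq[where a = 0 and b = 0]) (simp_all add: m1_def)
qed

lemma ok_write_prog:
  assumes b: "base m'" and x: "\<And>k j. k < n \<Longrightarrow> j < q \<Longrightarrow> m' ''x'' (int (k * Q + j)) = x k j"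
  shows "ok L (1 + (n * ((1 + q * 1) + 2) + 2)) write_prog m' xs [] (\<lambda>m'' xs' ys'. ys' = 2 # solution_list x n)"
  unfolding write_prog_def
proof (rule ok_seq, rule ok_write)
  let ?wr = "\<lambda>j. Write (Cell ''x'' (Plus (Times (scal ''k'') (Const (int Q))) (Const (int j))))"
  have "ok L (nat (int n - 0) * ((1 + q * 1) + 2) + 2) (For ''k'' (Const 0) (scal ''n'') (unroll ?wr q)) m' xs
     ([] @ [aval (Const 2) m']) (\<lambda>m'' xs' ys'. ys' = 2 # solution_list x n)"
  proof (rule ok_for[where I = "\<lambda>i m'' xs' ys'. ys' = 2 # solution_list x (nat i)"])
    show "0 \<le> int n" "\<bar>0\<bar> \<le> (2::int) ^ L" "\<bar>int n\<bar> \<le> 2 ^ L" using fit(1) by auto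
  next
    fix i and m'' :: mem and xs' ys' :: "int list"
    assume fr: "\<And>w. w \<notin> insert ''k'' (mods (unroll ?wr q)) \<Longrightarrow> m'' w = m' w"
    then have vars: "m'' ''n'' = m' ''n''" "m'' ''x'' = m' ''x''" by (simp_all add: mods_unroll)
    show "aval (scal ''n'') m'' = int n" using vars b by (simp add: base_def)
    assume i: "m'' ''k'' 0 = i" "0 \<le> i" "i < int n" and ys: "ys' = 2 # solution_list x (nat i)"
    define k where "k = nat i"
    have k: "i = int k" "k < n" "nat (int k + 1) = Suc k" using i by (auto simp: k_def)
    have "ok L (1 + q * 1) (unroll ?wr q) m'' xs' ys'
      (\<lambda>m3 xs'' ys''. m3 = m'' \<and> ys'' = 2 # solution_list x k @ map (x k) [0..<q])"
    proof (rule ok_unroll[where I = "\<lambda>j m3 xs'' ys''. m3 = m'' \<and> ys'' = 2 # solution_list x k @ map (x k) [0..<j]"])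
      show "m'' = m'' \<and> ys' = 2 # solution_list x k @ map (x k) [0..<0]" using ys by (simp add: k_def)
      fix j m3 and xs'' ys'' :: "int list"
      assume j: "j < q" and I: "m3 = m'' \<and> ys'' = 2 # solution_list x k @ map (x k) [0..<j]"
      have "aval (Cell ''x'' (Plus (Times (scal ''k'') (Const (int Q))) (Const (int j)))) m3 = x k j"
        using I i(1) k x[OF k(2) j] vars by simp
      then show "ok L 1 (?wr j) m3 xs'' ys'' (\<lambda>m3 xs'' ys''. m3 = m'' \<and> ys'' = 2 # solution_list x k @ map (x k) [0..<Suc j])"
        using I by (intro ok_write) simp
    qed
    then show "ok L (1 + q * 1) (unroll ?wr q) m'' xs' ys'
      (\<lambda>m3 xs'' ys''. m3 ''k'' 0 = i \<and> ys'' = 2 # solution_list x (nat (i + 1)))"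
      by (rule ok_mono) (use i k in \<open>auto simp: solution_list_def\<close>)
  qed (simp_all add: solution_list_def)
  then show "ok L (n * ((1 + q * 1) + 2) + 2) (For ''k'' (Const 0) (scal ''n'') (unroll ?wr q)) m' xs
     ([] @ [aval (Const 2) m']) (\<lambda>m'' xs' ys'. ys' = 2 # solution_list x n)" by simp
qed

definition T_write :: nat where "T_write = 1 + (n * ((1 + q * 1) + 2) + 2)"

lemma ok_output:
  assumes s: "summed m' f x"
  shows "ok L ((T_write + 1) + 1) output_prog m' xs [] (\<lambda>m'' xs' ys'. correct_output ys')"
proof -
  let ?x = "flat Q x"
  have sc: "scaled m' f" and l: "level 0 f x" and mx: "\<And>t. t < N \<Longrightarrow> m' ''x'' (int t) = x t"
    and sl: "m' ''sl'' 0 = dot n slack ?x" using s by (auto simp: summed_def)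
  have f: "m' ''f'' 0 = f" "f \<in> {0, 1}" and b: "base m'" using sc by (auto simp: scaled_def fixed_def)
  have k: "ker n (\<lambda>k j. ?x k j - start k j)" using l by (simp add: level_def)
  have pos: "?x k j \<ge> 0" if "k < n" "j < Q" for k j
    using l flat_index[OF that] by (simp add: level_def flat_def N_def)
  have opt: "dot n (weight M f) h \<ge> 0" if "feas n ?x 1 h" for h using l that by (simp add: level_def)
  have T: "1 \<le> T_write" by (simp add: T_write_def)
  show ?thesis
    unfolding output_prog_def
  proof (rule ok_cond)
    assume "bval (Less (Const 0) (scal ''sl'')) m'"
    then have sp: "dot n slack ?x > 0" using sl by simp
    have "\<not> feasible z" for z by (rule infeasible[OF G_le_K(1) M_gt f(2) k pos opt sp])
    then have "ok L 1 (Write (Const 0)) m' xs [] (\<lambda>m'' xs' ys'. correct_output ys')"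
      by (intro ok_write) (simp add: correct_output_def)
    then show "ok L (T_write + 1) (Write (Const 0)) m' xs [] (\<lambda>m'' xs' ys'. correct_output ys')"
      by (rule ok_mono) (use T in auto)
  next
    assume "\<not> bval (Less (Const 0) (scal ''sl'')) m'"
    then have sl0: "dot n slack ?x \<le> 0" using sl by simp
    have feas: "feasible ?x" by (rule feasible_slackfree[OF k pos sl0])
    show "ok L (T_write + 1) (Cond (Less (scal ''f'') (Const 1)) (Write (Const 1)) write_prog) m' xs []
      (\<lambda>m'' xs' ys'. correct_output ys')"
    proof (rule ok_cond)
      assume "bval (Less (scal ''f'') (Const 1)) m'"
      then have "f = 0" using f by simp
      then obtain g where "unbounded_dir g" using sc by (auto simp: scaled_def)
      then have "\<exists>z. feasible z \<and> cost z < bd" for bd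
        using unbounded[OF _ M_gt feas, of g bd] K_pos by (simp add: unbounded_dir_def box_def)
      then have "ok L 1 (Write (Const 1)) m' xs [] (\<lambda>m'' xs' ys'. correct_output ys')"
        by (intro ok_write) (simp add: correct_output_def)
      then show "ok L T_write (Write (Const 1)) m' xs [] (\<lambda>m'' xs' ys'. correct_output ys')"
        by (rule ok_mono) (use T in auto)
    next
      assume "\<not> bval (Less (scal ''f'') (Const 1)) m'"
      then have f1: "f = 1" using f by auto
      have "cost ?x \<le> cost z" if "feasible z" for z
        by (rule optimal[OF k pos _ sl0 that]) (use opt f1 in auto)
      then have c: "correct_output (2 # solution_list ?x n)" using feas by (auto simp: correct_output_def)
      have "m' ''x'' (int (k * Q + j)) = ?x k j" if "k < n" "j < q" for k j
        using mx[of "k * Q + j"] flat_index[of k n j Q] that by (simp add: flat_def N_def Q_def)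
      from ok_write_prog[OF b this]
      show "ok L T_write write_prog m' xs [] (\<lambda>m'' xs' ys'. correct_output ys')"
        unfolding T_write_def by (rule ok_mono) (use c in auto)
    qed
  qed
qed

definition T_total :: nat where
  "T_total = T_setup + ((T_back + ((1 + 1) + 1)) + ((L * (1 + 1) + 1) +
     ((L * ((1 + (T_back + T_forw)) + 1) + 1) + ((1 + (N * (1 + 2) + 2)) + ((T_write + 1) + 1)))))"

lemma ok_nfold_prog:
  "ok L T_total nfold_prog (\<lambda>_ _. 0) (int n # map iv [0..<len]) [] (\<lambda>m' xs ys. correct_output ys)"
proof -
  let ?Q = "\<lambda>m' xs ys. correct_output ys"
  let ?T5 = "((1 + (N * (1 + 2) + 2)) + ((T_write + 1) + 1))"
  let ?T4 = "((L * ((1 + (T_back + T_forw)) + 1) + 1) + ?T5)"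
  let ?T3 = "((L * (1 + 1) + 1) + ?T4)"
  let ?T2 = "((T_back + ((1 + 1) + 1)) + ?T3)"
  let ?P5 = "(Seq slack_prog output_prog)"
  let ?P4 = "(Seq scale_prog ?P5)"
  let ?P3 = "(Seq double_prog ?P4)"
  let ?P2 = "(Seq test_prog ?P3)"
  have "ok L ?T5 ?P5 m' xs [] ?Q"
    if "scaled m' f \<and> level 0 f (\<lambda>t. m' ''x'' (int t))" for m' f xs
  proof (rule ok_seq, rule ok_mono[OF okmD[OF okm_slack] order_refl])
    show "scaled m' f" "level 0 f (\<lambda>t. m' ''x'' (int t))" using that by auto
    show "m' ''x'' (int t) = m' ''x'' (int t)" for t ..
    fix w xs' and ys' :: "int list"
    assume "summed w f (\<lambda>t. m' ''x'' (int t)) \<and> xs' = xs \<and> ys' = []"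
    then show "ok L ((T_write + 1) + 1) output_prog w xs' ys' ?Q" using ok_output by blast
  qed
  note slack = this
  have scale: "ok L ?T4
      ?P4 m' xs [] ?Q"
    if "(\<exists>f. scaled m' f) \<and> m' ''lam'' 0 = 2 ^ top_exp \<and> (\<forall>t<N. m' ''x'' (int t) = unflat Q start t)" for m' xs
  proof -
    from that obtain f where f: "scaled m' f" by blast
    have le: "top_exp * ((1 + (T_back + T_forw)) + 1) + 1 \<le> L * ((1 + (T_back + T_forw)) + 1) + 1"
      using top_exp(4) by (intro add_mono mult_le_mono1) auto
    show ?thesis
    proof (rule ok_seq, rule ok_mono[OF okmD[OF okm_scale[OF f]] le])
      show "m' ''lam'' 0 = 2 ^ top_exp" "t < N \<Longrightarrow> m' ''x'' (int t) = unflat Q start t" for t using that by auto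
      fix w xs' and ys' :: "int list"
      assume "(scaled w f \<and> level 0 f (\<lambda>t. w ''x'' (int t))) \<and> xs' = xs \<and> ys' = []"
      then show "ok L ?T5 ?P5 w xs' ys' ?Q"
        using slack by blast
    qed
  qed
  have double: "ok L ?T3
      ?P3 m' xs [] ?Q"
    if "tested m'" for m' xs
  proof (rule ok_seq, rule ok_mono[OF okmD[OF okm_double[OF that]]])
    show "top_exp * (1 + 1) + 1 \<le> L * (1 + 1) + 1" using top_exp(4) by simp
    fix w xs' and ys' :: "int list"
    assume "((\<exists>f. scaled w f) \<and> w ''lam'' 0 = 2 ^ top_exp \<and> (\<forall>t<N. w ''x'' (int t) = unflat Q start t)) \<and> xs' = xs \<and> ys' = []"
    then show "ok L ?T4
      ?P4 w xs' ys' ?Q" using scale by blast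
  qed
  have test: "ok L ?T2
      ?P2 m' xs [] ?Q"
    if "ready m'" "m' ''f'' 0 = 1" "m' ''lam'' 0 = 1" "m' ''mu'' 0 = 0" for m' xs
  proof (rule ok_seq, rule ok_mono[OF okmD[OF okm_test[OF that]] order_refl])
    fix w xs' and ys' :: "int list"
    assume "tested w \<and> xs' = xs \<and> ys' = []"
    then show "ok L ?T3
      ?P3 w xs' ys' ?Q" using double by blast
  qed
  show ?thesis
    unfolding T_total_def nfold_prog_def
  proof (rule ok_seq, rule ok_mono[OF ok_setup order_refl])
    fix w :: mem and xs' ys' :: "int list"
    assume "ready w \<and> w ''f'' 0 = 1 \<and> w ''lam'' 0 = 1 \<and> w ''mu'' 0 = 0 \<and> ys' = []"
    then show "ok L ?T2
      ?P2 w xs' ys' ?Q" using test by blast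
  qed
qed

end

section \<open>Polynomial bounds\<close>

definition poly_bounded :: "(nat \<Rightarrow> nat) \<Rightarrow> bool" where
  "poly_bounded f \<longleftrightarrow> (\<exists>p :: nat poly. \<forall>x. f x \<le> poly p x)"

text \<open>The class for values, in contrast to step counts: a bound of this form means polynomial
  bit length.\<close>

definition exp_bounded :: "(nat \<Rightarrow> nat) \<Rightarrow> bool" where
  "exp_bounded f \<longleftrightarrow> (\<exists>p :: nat poly. \<forall>x. f x \<le> 2 ^ poly p x)"

lemma poly_bounded_const: "poly_bounded (\<lambda>_. c)"
  unfolding poly_bounded_def by (intro exI[of _ "[:c:]"]) simp

lemma poly_bounded_id: "poly_bounded (\<lambda>x. x)"
  unfolding poly_bounded_def by (intro exI[of _ "[:0, 1:]"]) simp

lemma poly_bounded_poly: "poly_bounded (poly p)"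
  unfolding poly_bounded_def by blast

lemma poly_bounded_add: "poly_bounded f \<Longrightarrow> poly_bounded g \<Longrightarrow> poly_bounded (\<lambda>x. f x + g x)"
  unfolding poly_bounded_def by (metis add_mono poly_add)

lemma poly_bounded_mult: "poly_bounded f \<Longrightarrow> poly_bounded g \<Longrightarrow> poly_bounded (\<lambda>x. f x * g x)"
  unfolding poly_bounded_def by (metis mult_le_mono poly_mult)

lemma poly_bounded_power: "poly_bounded f \<Longrightarrow> poly_bounded (\<lambda>x. f x ^ k)"
  by (induction k) (simp_all add: poly_bounded_const poly_bounded_mult)

lemmas poly_bounded_intros = poly_bounded_add poly_bounded_mult poly_bounded_power poly_bounded_poly
  poly_bounded_const poly_bounded_id

lemma exp_bounded_poly:
  assumes "poly_bounded f"
  shows "exp_bounded f"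
proof -
  from assms obtain p :: "nat poly" where "\<And>x. f x \<le> poly p x" unfolding poly_bounded_def by blast
  then have "f x \<le> 2 ^ poly p x" for x using less_exp[of "poly p x"] by (meson less_imp_le order_trans)
  then show ?thesis unfolding exp_bounded_def by blast
qed

lemma exp_bounded_exp: "exp_bounded (\<lambda>x. 2 ^ x)"
  unfolding exp_bounded_def by (intro exI[of _ "[:0, 1:]"]) simp

lemma exp_bounded_add:
  assumes "exp_bounded f" "exp_bounded g"
  shows "exp_bounded (\<lambda>x. f x + g x)"
proof -
  from assms obtain p p' :: "nat poly" where p: "\<And>x. f x \<le> 2 ^ poly p x" "\<And>x. g x \<le> 2 ^ poly p' x"
    unfolding exp_bounded_def by blast
  have "f x + g x \<le> 2 ^ poly (p + p' + 1) x" for x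
  proof -
    have "f x \<le> 2 ^ (poly p x + poly p' x)" "g x \<le> 2 ^ (poly p x + poly p' x)"
      using p[of x] by (meson le_add1 le_add2 one_le_numeral order_trans power_increasing)+
    then show ?thesis by simp
  qed
  then show ?thesis unfolding exp_bounded_def by blast
qed

lemma exp_bounded_mult:
  assumes "exp_bounded f" "exp_bounded g"
  shows "exp_bounded (\<lambda>x. f x * g x)"
proof -
  from assms obtain p p' :: "nat poly" where p: "\<And>x. f x \<le> 2 ^ poly p x" "\<And>x. g x \<le> 2 ^ poly p' x"
    unfolding exp_bounded_def by blast
  have "f x * g x \<le> 2 ^ poly (p + p') x" for x
    using mult_le_mono[OF p(1)[of x] p(2)[of x]] by (simp add: power_add)
  then show ?thesis unfolding exp_bounded_def by blast
qed

lemma exp_bounded_power: "exp_bounded f \<Longrightarrow> exp_bounded (\<lambda>x. f x ^ k)"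
  by (induction k) (simp_all add: exp_bounded_mult exp_bounded_poly poly_bounded_const)

section \<open>Majorants in terms of the input size\<close>

context nfold_rows
begin

definition hN :: "nat \<Rightarrow> nat" where "hN x = Q * x"
definition hK :: "nat \<Rightarrow> nat" where "hK x = nat kappa * x"
definition hW :: "nat \<Rightarrow> nat" where "hW x = 2 * (hK x * hN x * nat amax) + 1"
definition hc :: "nat \<Rightarrow> nat" where "hc x = hN x * (2 ^ x * 2 ^ x)"
definition hx :: "nat \<Rightarrow> nat" where "hx x = hN x * (2 ^ x * 2 ^ x + 2 ^ x)"
definition hM :: "nat \<Rightarrow> nat" where "hM x = hK x * hc x + 1"
definition hinf :: "nat \<Rightarrow> nat" where "hinf x = hN x * (hK x * (hc x + hM x)) + 1"
definition htop :: "nat \<Rightarrow> nat" where "htop x = hx x + hK x * (2 * hx x + 1)"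

text \<open>The sum majorizes at once all numbers that \<open>nfold_fits\<close> bounds, so one
  polynomial \<open>bits\<close> yields the bit bound.\<close>

definition hZ :: "nat \<Rightarrow> nat" where
  "hZ x = x + (2 ^ x + (hN x + (hK x + 1 + (hW x + (2 * hW x ^ m + ((hK x + 1) * hW x ^ m +
     (hc x + (hM x + (hinf x + (htop x + (2 * hx x + 2 + hN x * htop x)))))))))))"

text \<open>This is why the table is small: the ranges of coordinates, moves and digits are
  polynomial, and with \<open>m\<close> fixed so is the number \<open>2 * W ^ m\<close> of
  states.\<close>

lemma hNKW_poly: "poly_bounded hN" "poly_bounded hK" "poly_bounded hW"
proof -
  show 1: "poly_bounded hN" unfolding hN_def[abs_def] by (intro poly_bounded_intros)
  show 2: "poly_bounded hK" unfolding hK_def[abs_def] by (intro poly_bounded_intros)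
  show "poly_bounded hW" unfolding hW_def[abs_def] by (intro poly_bounded_intros 1 2)
qed

lemma hZ_exp: "exp_bounded hZ"
proof -
  note i = exp_bounded_add exp_bounded_mult exp_bounded_power exp_bounded_exp
    exp_bounded_poly[OF poly_bounded_const] exp_bounded_poly[OF poly_bounded_id]
    hNKW_poly[THEN exp_bounded_poly]
  have c: "exp_bounded hc" unfolding hc_def[abs_def] by (intro i)
  have x: "exp_bounded hx" unfolding hx_def[abs_def] by (intro i)
  have M: "exp_bounded hM" unfolding hM_def[abs_def] by (intro i c)
  have f: "exp_bounded hinf" unfolding hinf_def[abs_def] by (intro i c M)
  have t: "exp_bounded htop" unfolding htop_def[abs_def] by (intro i x)
  show ?thesis unfolding hZ_def[abs_def] by (intro i c x M f t)
qed

definition bits :: "nat poly" where "bits = (SOME p. \<forall>x. hZ x \<le> 2 ^ poly p x)"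

lemma bits: "hZ x \<le> 2 ^ poly bits x"
  using someI_ex[OF hZ_exp[unfolded exp_bounded_def]] unfolding bits_def by blast

text \<open>\<open>T_back\<close> with \<open>N\<close>, \<open>K\<close> and \<open>W\<close>
  replaced by their majorants.\<close>

definition hT_back :: "nat \<Rightarrow> nat" where
  "hT_back x = 1 + (hN x * ((1 + (2 * hW x ^ m * ((1 + (1 + (((2 * hK x + 1) * (4 + 2) + 2) + 2))) + 2) + 2)) + 2) + 2)"

definition hT :: "nat \<Rightarrow> nat" where
  "hT x = (1 + (6 + (x * 3 + 2 + (x * (Q * 5 + 3) + 3 + (hN x * 4 + 4 + 4))))) +
    ((hT_back x + ((1 + 1) + 1)) + ((poly bits x * (1 + 1) + 1) +
     ((poly bits x * ((1 + (hT_back x + (1 + (hN x * (1 + (1 + 1) + 2) + 2)))) + 1) + 1) +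
      ((1 + (hN x * (1 + 2) + 2)) + (((1 + (x * ((1 + q * 1) + 2) + 2)) + 1) + 1)))))"

lemma hT_poly: "poly_bounded hT"
proof -
  have 1: "poly_bounded hT_back" unfolding hT_back_def[abs_def] by (intro poly_bounded_intros hNKW_poly)
  show ?thesis unfolding hT_def[abs_def] by (intro poly_bounded_intros hNKW_poly 1)
qed

end

lemma (in nfold_run) bounds_h:
  assumes x: "n \<le> x" and iv: "\<And>i. i < len \<Longrightarrow> \<bar>iv i\<bar> \<le> 2 ^ x"
  shows "int N \<le> int (hN x)" "K \<le> int (hK x)" "W \<le> int (hW x)" "sc \<le> int (hc x)" "sx \<le> int (hx x)"
    "M \<le> int (hM x)" "inf \<le> int (hinf x)" "top \<le> int (htop x)" "0 \<le> K" "0 \<le> W" "0 \<le> sc" "0 \<le> sx" "0 \<le> M" "0 \<le> top"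
proof -
  have "n * Q \<le> Q * x" using x by (simp add: mult.commute[of n])
  then show N: "int N \<le> int (hN x)" unfolding N_def hN_def by (rule of_nat_mono)
  have kap: "int (nat kappa) = kappa" "int (nat amax) = amax" using kappa_pos amax_pos by auto
  show K0: "0 \<le> K" unfolding K_def using kappa_pos by simp
  have "kappa * int n \<le> kappa * int x" using x kappa_pos by (intro mult_left_mono) auto
  then show K: "K \<le> int (hK x)" unfolding K_def hK_def of_nat_mult kap .
  show "0 \<le> W" unfolding W_def using K0 amax_pos by simp
  have "K * int N * amax \<le> int (hK x) * int (hN x) * amax"
    using K N K0 amax_pos by (intro mult_right_mono mult_mono) auto
  moreover have "int (hW x) = 2 * (int (hK x) * int (hN x) * amax) + 1"
    unfolding hW_def of_nat_add of_nat_mult kap by simp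
  ultimately show "W \<le> int (hW x)" unfolding W_def by linarith
  have obj: "\<bar>unflat Q cx t\<bar> \<le> 2 ^ x" if "t < N" for t
  proof -
    have "t < n * Q" using that by (simp add: N_def)
    then obtain k j where kj: "k < n" "j < Q" "t = k * Q + j" using flat_index_ex by blast
    have "s + n * (m - s) + k * q + j < len" if "j < q"
      using flat_index[of k n j q] kj that unfolding len_def by (simp add: distrib_left)
    then show ?thesis using kj iv by (auto simp: cx_def obj_def)
  qed
  have sq: "z * z \<le> 2 ^ x * 2 ^ x" if "\<bar>z\<bar> \<le> 2 ^ x" for z :: int
  proof -
    have "\<bar>z\<bar> * \<bar>z\<bar> \<le> 2 ^ x * 2 ^ x" using that by (intro mult_mono) auto
    then show ?thesis by (simp flip: abs_mult)
  qed
  have "sc \<le> (\<Sum>t<N. 2 ^ x * 2 ^ x)" unfolding sc_def using obj sq by (intro sum_mono) auto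
  also have "\<dots> = int N * (2 ^ x * 2 ^ x)" by simp
  also have "\<dots> \<le> int (hc x)" unfolding hc_def of_nat_mult using N by (intro mult_mono) auto
  finally show sc: "sc \<le> int (hc x)" .
  show sc0: "0 \<le> sc" unfolding sc_def by (auto intro: sum_nonneg)
  have rhs: "\<bar>rhs k i\<bar> \<le> 2 ^ x" if "k < n" "i < m" for k i
  proof (cases "i < s")
    case True
    then show ?thesis using iv[of i] by (simp add: rhs_def len_def)
  next
    case False
    have "k * (m - s) + (i - s) < n * (m - s)" using that False s_le by (intro flat_index) auto
    also have "\<dots> \<le> n * (m - s + q)" by simp
    finally have "s + k * (m - s) + (i - s) < len" unfolding len_def by simp
    then show ?thesis using iv False by (simp add: rhs_def)
  qed
  have st: "start k j \<le> 2 ^ x * 2 ^ x + 2 ^ x" if kj: "k < n" "j < Q" for k j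
  proof -
    have 1: "rhs k i * rhs k i \<le> 2 ^ x * 2 ^ x" "rhs k i \<le> 2 ^ x" if "i < m" for i
      using sq[OF rhs[OF kj(1) that]] rhs[OF kj(1) that] by auto
    consider "j < q" | "q \<le> j" "j < q + m" | "q + m \<le> j" by linarith
    then show ?thesis
    proof cases
      case 2
      then have "j - q < m" by auto
      from 1[OF this] show ?thesis using 2 by (simp add: start_def)
    next
      case 3
      then have "j - q - m < m" using kj(2) by (auto simp: Q_def)
      have "start k j = rhs k (j - q - m) * rhs k (j - q - m)" using 3 by (simp add: start_def)
      moreover have "(0::int) \<le> 2 ^ x" by simp
      ultimately show ?thesis using 1[OF \<open>j - q - m < m\<close>] by linarith
    qed (simp add: start_def)
  qed
  have "sx \<le> (\<Sum>t<N. 2 ^ x * 2 ^ x + 2 ^ x)" unfolding sx_def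
  proof (rule sum_mono)
    fix t assume "t \<in> {..<N}"
    then have "t < n * Q" by (simp add: N_def)
    then obtain k j where kj: "k < n" "j < Q" "t = k * Q + j" using flat_index_ex by blast
    then show "unflat Q start t \<le> 2 ^ x * 2 ^ x + 2 ^ x" using st by simp
  qed
  also have "\<dots> = int N * (2 ^ x * 2 ^ x + 2 ^ x)" by simp
  also have "\<dots> \<le> int (hN x) * (2 ^ x * 2 ^ x + 2 ^ x)" using N by (intro mult_right_mono) auto
  also have "\<dots> = int (hx x)" by (simp add: hx_def)
  finally show sx: "sx \<le> int (hx x)" .
  show sx0: "0 \<le> sx" unfolding sx_def unflat_def using start_nonneg by (auto intro: sum_nonneg)
  have "K * sc \<le> int (hK x) * int (hc x)" using K sc K0 sc0 by (intro mult_mono) auto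
  then show M: "M \<le> int (hM x)" unfolding M_def hM_def by simp
  show M0: "0 \<le> M" unfolding M_def using K0 sc0 by simp
  have "int N * (K * (sc + M)) \<le> int (hN x) * (int (hK x) * (int (hc x) + int (hM x)))"
    using N K sc M K0 sc0 M0 by (intro mult_mono add_mono) auto
  then show "inf \<le> int (hinf x)" unfolding inf_def B_def hinf_def by simp
  have "K * (2 * sx + 1) \<le> int (hK x) * (2 * int (hx x) + 1)" using K sx K0 sx0 by (intro mult_mono) auto
  moreover have "int (htop x) = int (hx x) + int (hK x) * (2 * int (hx x) + 1)"
    by (simp add: htop_def algebra_simps)
  ultimately show "top \<le> int (htop x)" unfolding top_def using sx by linarith
  show "0 \<le> top" unfolding top_def using K0 sx0 by simp
qed

lemma (in nfold_rows) fits_poly: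
  assumes nx: "n \<ge> 1" "n \<le> x" and len: "s + n * (m - s + q) \<le> x"
    and iv: "\<And>i. i < s + n * (m - s + q) \<Longrightarrow> \<bar>iv i\<bar> \<le> 2 ^ x"
  shows "nfold_fits e s m q n iv (poly bits x)"
proof -
  interpret nfold_run e s m q n iv "poly bits x" by unfold_locales (rule nx)
  have iv': "\<And>i. i < len \<Longrightarrow> \<bar>iv i\<bar> \<le> 2 ^ x" using iv by (simp add: len_def)
  note h = bounds_h[OF nx(2) iv']
  have Z: "int (hZ x) \<le> 2 ^ poly bits x" using bits[of x] by (simp add: nat_le_real_less flip: of_nat_power)
  have Wm: "W ^ m \<le> int (hW x) ^ m" using h(3,10) by (intro power_mono) auto
  have KW: "(K + 1) * W ^ m \<le> (int (hK x) + 1) * int (hW x) ^ m" using h(2,9,10) Wm by (intro mult_mono) auto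
  have NT: "int N * top \<le> int (hN x) * int (htop x)" using h(1,8,14) by (intro mult_mono) auto
  \<comment> \<open>With all summands nonnegative, each required bound follows from this sum by
    linear arithmetic.\<close>
  have Zsum: "int (hZ x) = int x + (2 ^ x + (int (hN x) + (int (hK x) + 1 + (int (hW x) + (2 * int (hW x) ^ m +
     ((int (hK x) + 1) * int (hW x) ^ m + (int (hc x) + (int (hM x) + (int (hinf x) + (int (htop x) +
     (2 * int (hx x) + 2 + int (hN x) * int (htop x))))))))))))"
    by (simp add: hZ_def algebra_simps)
  have nn: "0 \<le> int (hW x) ^ m" "0 \<le> (int (hK x) + 1) * int (hW x) ^ m" "0 \<le> int (hN x) * int (htop x)" "(0::int) \<le> 2 ^ x"
    by simp_all
  show ?thesis
  proof unfold_locales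
    show "\<bar>iv i\<bar> \<le> 2 ^ poly bits x" if "i < len" for i using iv'[OF that] nn Z unfolding Zsum by linarith
    show "int n \<le> 2 ^ poly bits x" "int len \<le> 2 ^ poly bits x" using nx(2) len nn Z unfolding Zsum len_def by linarith+
    show "int N \<le> 2 ^ poly bits x" using h(1) nn Z unfolding Zsum by linarith
    show "K + 1 \<le> 2 ^ poly bits x" using h(2) nn Z unfolding Zsum by linarith
    show "W \<le> 2 ^ poly bits x" using h(3) nn Z unfolding Zsum by linarith
    show "2 * W ^ m \<le> 2 ^ poly bits x" using Wm nn Z unfolding Zsum by linarith
    show "(K + 1) * W ^ m \<le> 2 ^ poly bits x" using KW nn Z unfolding Zsum by linarith
    show "sc \<le> 2 ^ poly bits x" using h(4) nn Z unfolding Zsum by linarith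
    show "M \<le> 2 ^ poly bits x" using h(6) nn Z unfolding Zsum by linarith
    show "inf \<le> 2 ^ poly bits x" using h(7) nn Z unfolding Zsum by linarith
    show "top \<le> 2 ^ poly bits x" using h(8) nn Z unfolding Zsum by linarith
    show "2 * sx + 2 \<le> 2 ^ poly bits x" using h(5) nn Z unfolding Zsum by linarith
    show "int N * top \<le> 2 ^ poly bits x" using NT nn Z unfolding Zsum by linarith
  qed
qed

lemma (in nfold_rows) runs_nfold_prog:
  assumes nx: "n \<ge> 1" "n \<le> x" and len: "s + n * (m - s + q) \<le> x"
    and iv: "\<And>i. i < s + n * (m - s + q) \<Longrightarrow> \<bar>iv i\<bar> \<le> 2 ^ x"
  shows "\<exists>t ys. runs nfold_prog (int n # map iv [0..<s + n * (m - s + q)]) t ys \<and>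
    t \<le> hT x * kap nfold_prog * poly bits x \<and>
    nfold_run.correct_output e s m q n iv ys"
proof -
  interpret nfold_fits e s m q n iv "poly bits x" by (rule fits_poly[OF assms])
  have iv': "\<And>i. i < len \<Longrightarrow> \<bar>iv i\<bar> \<le> 2 ^ x" using iv by (simp add: len_def)
  note h = bounds_h[OF nx(2) iv']
  have "(2::int) \<le> 2 ^ poly bits x" using fit(13) sx_ge(2) by linarith
  then have L: "poly bits x \<ge> 1" by (cases "poly bits x") auto
  have b: "bounded (poly bits x) (\<lambda>_ _. 0)" by (simp add: bounded_def)
  obtain t m' xs' ys where e: "exec nfold_prog (\<lambda>_ _. 0, int n # map iv [0..<len], []) t (m', xs', ys)"
    "t \<le> T_total * kap nfold_prog * poly bits x" "correct_output ys"
    using ok_nfold_prog b L unfolding ok_def by blast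
  have N: "N \<le> hN x" using h(1) by simp
  have K: "nat (K + 1 - (- K)) \<le> 2 * hK x + 1" using h(2) by linarith
  have Wm: "W ^ m \<le> int (hW x) ^ m" using h(3,10) by (intro power_mono) auto
  have W: "nat (W ^ m - (- (W ^ m))) \<le> 2 * hW x ^ m"
    using Wm by (simp add: nat_le_iff)
  have Tb: "T_back \<le> hT_back x"
    unfolding T_back_def hT_back_def T_try_def
    by (intro add_mono mult_le_mono N K W order_refl) simp_all
  have "T_total \<le> hT x"
    unfolding T_total_def hT_def T_setup_def T_forw_def T_write_def
    using nx(2) len unfolding len_def
    by (intro add_mono mult_le_mono N Tb order_refl) simp_all
  then have "t \<le> hT x * kap nfold_prog * poly bits x"
    using e(2) by (meson mult_le_mono1 order_trans)
  with e(1,3) show ?thesis unfolding runs_def len_def by blast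
qed

section \<open>Instances and outcomes\<close>

lemma length_concat_uniform:
  "(\<And>k. k < n \<Longrightarrow> length (f k) = d) \<Longrightarrow> length (concat (map f [0..<n])) = n * d"
  by (induction n) auto

lemma nth_concat_uniform:
  "(\<And>k. k < n \<Longrightarrow> length (f k) = d) \<Longrightarrow> k < n \<Longrightarrow> i < d \<Longrightarrow> concat (map f [0..<n]) ! (k * d + i) = f k ! i"
proof (induction n)
  case (Suc n)
  have len: "length (concat (map f [0..<n])) = n * d" using Suc.prems by (intro length_concat_uniform) auto
  show ?case
  proof (cases "k = n")
    case True
    then show ?thesis using len by (simp add: nth_append)
  next
    case False
    then have k: "k < n" using Suc.prems by simp
    then have "k * d + i < n * d" using flat_index Suc.prems(3) by blast
    then show ?thesis using Suc k len by (simp add: nth_append)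
  qed
qed simp

lemma blocks_from_1: "blocks v [1..<Suc n] = concat (map (\<lambda>k. list_of_vec (v (Suc k))) [0..<n])"
proof -
  have "[1..<Suc n] = map Suc [0..<n]" by (simp add: map_Suc_upt)
  then show ?thesis by (simp add: blocks_def comp_def del: upt_Suc)
qed

lemma blocks_from_0: "blocks v [0..<Suc n] = list_of_vec (v 0) @ blocks v [1..<Suc n]"
  by (simp add: blocks_def upt_conv_Cons del: upt_Suc)

locale nfold_instance_vec =
  fixes A B :: "int mat" and r s q n :: nat and b c :: "nat \<Rightarrow> int vec"
  assumes A: "A \<in> carrier_mat r q" and B: "B \<in> carrier_mat s q"
    and inst: "nfold_instance r s q n b c"
begin

definition inp :: "int list" where
  "inp = list_of_vec (b 0) @ concat (map (\<lambda>k. list_of_vec (b (Suc k))) [0..<n]) @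
     concat (map (\<lambda>k. list_of_vec (c (Suc k))) [0..<n])"

definition rows :: "nat \<Rightarrow> nat \<Rightarrow> int" where
  "rows i j = (if i < s then B $$ (i, j) else A $$ (i - s, j))"

lemma n1: "n \<ge> 1" and dims: "dim_vec (b 0) = s" "\<And>k. k < n \<Longrightarrow> dim_vec (b (Suc k)) = r"
  "\<And>k. k < n \<Longrightarrow> dim_vec (c (Suc k)) = q"
  using inst by (auto simp: nfold_instance_def)

lemma encode_eq: "encode_instance n b c = int n # inp"
  unfolding encode_instance_def inp_def blocks_from_0 blocks_from_1 append_assoc ..

lemma length_b: "length (concat (map (\<lambda>k. list_of_vec (b (Suc k))) [0..<n])) = n * r"
  using dims by (intro length_concat_uniform) auto

lemma length_c: "length (concat (map (\<lambda>k. list_of_vec (c (Suc k))) [0..<n])) = n * q"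
  using dims by (intro length_concat_uniform) auto

lemma length_inp: "length inp = s + n * (r + q)"
  using length_b length_c dims by (simp add: inp_def distrib_left)

lemma inp_b0: "i < s \<Longrightarrow> inp ! i = b 0 $ i"
  using dims by (simp add: inp_def nth_append)

lemma inp_b:
  assumes "k < n" "i < r"
  shows "inp ! (s + k * r + i) = b (Suc k) $ i"
proof -
  have "k * r + i < n * r" using assms by (rule flat_index)
  then have "inp ! (s + (k * r + i)) = concat (map (\<lambda>k. list_of_vec (b (Suc k))) [0..<n]) ! (k * r + i)"
    unfolding inp_def using dims(1) length_b by (simp add: nth_append)
  also have "\<dots> = b (Suc k) $ i" using assms dims(2) by (subst nth_concat_uniform[of n _ r]) auto
  finally show ?thesis by (simp add: add.assoc)
qed

lemma inp_c:
  assumes "k < n" "j < q"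
  shows "inp ! (s + n * r + k * q + j) = c (Suc k) $ j"
proof -
  have "inp ! (s + (n * r + (k * q + j))) = concat (map (\<lambda>k. list_of_vec (c (Suc k))) [0..<n]) ! (k * q + j)"
    unfolding inp_def using dims(1) length_b by (simp add: nth_append)
  also have "\<dots> = c (Suc k) $ j" using assms dims(3) by (subst nth_concat_uniform[of n _ q]) auto
  finally show ?thesis by (simp add: add.assoc)
qed

lemma input_size_eq: "input_size n b c = n + sum_list (map bit_size inp)"
  unfolding input_size_def inp_def blocks_from_0 blocks_from_1 by simp

lemma size_bounds: "n \<le> input_size n b c" "s + n * (r + q) \<le> input_size n b c"
  "i < s + n * (r + q) \<Longrightarrow> \<bar>inp ! i\<bar> \<le> 2 ^ input_size n b c"
proof -
  show "n \<le> input_size n b c" by (simp add: input_size_eq)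
  \<comment> \<open>Every integer has bit size at least 1, so the number of entries is bounded by
    the input size.\<close>
  have "length xs \<le> sum_list (map bit_size xs)" for xs
    by (induction xs) (auto simp: bit_size_def)
  then show "s + n * (r + q) \<le> input_size n b c"
    using length_inp unfolding input_size_eq by (metis trans_le_add2)
  assume "i < s + n * (r + q)"
  then have "bit_size (inp ! i) \<in> set (map bit_size inp)" using length_inp by simp
  then have "bit_size (inp ! i) \<le> input_size n b c"
    unfolding input_size_eq using member_le_sum_list[of "bit_size (inp ! i)" "map bit_size inp"]
    by linarith
  then have "(2::int) ^ bit_size (inp ! i) \<le> 2 ^ input_size n b c" by (intro power_increasing) auto
  then show "\<bar>inp ! i\<bar> \<le> 2 ^ input_size n b c" using abs_less_bit_size[of "inp ! i"] by linarith
qed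

sublocale run: nfold_run rows s "s + r" q n "\<lambda>i. inp ! i" 0
  by unfold_locales (use n1 in auto)

lemma rhs_b0: "i < s \<Longrightarrow> (\<Sum>k<n. run.rhs k i) = b 0 $ i"
  using n1 by (simp add: run.rhs_def inp_b0 sum.If_cases lessThan_def Int_def)

lemma rhs_b: "k < n \<Longrightarrow> i \<in> {s..<s + r} \<Longrightarrow> run.rhs k i = b (Suc k) $ (i - s)"
  using inp_b[of k "i - s"] by (auto simp: run.rhs_def)

lemma obj_c: "k < n \<Longrightarrow> j < q \<Longrightarrow> run.obj k j = c (Suc k) $ j"
  using inp_c[of k j] by (simp add: run.obj_def)

text \<open>Instances number the blocks from 1, the program from 0; hence the shift by one.\<close>

definition to_vec :: "(nat \<Rightarrow> nat \<Rightarrow> int) \<Rightarrow> nat \<Rightarrow> int vec" where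
  "to_vec z k = vec q (z (k - 1))"

definition of_vec :: "(nat \<Rightarrow> int vec) \<Rightarrow> nat \<Rightarrow> nat \<Rightarrow> int" where
  "of_vec x k j = x (Suc k) $ j"

lemma all_blocks: "(\<forall>k\<in>{1..n}. P k) \<longleftrightarrow> (\<forall>k<n. P (Suc k))"
  unfolding image_Suc_lessThan[symmetric] by auto

lemma mult_index:
  "x \<in> carrier_vec q \<Longrightarrow> i < r \<Longrightarrow> (A *\<^sub>v x) $ i = (\<Sum>j<q. A $$ (i, j) * x $ j)"
  "x \<in> carrier_vec q \<Longrightarrow> i < s \<Longrightarrow> (B *\<^sub>v x) $ i = (\<Sum>j<q. B $$ (i, j) * x $ j)"
  using A B by (simp_all add: scalar_prod_def atLeast0LessThan)

lemma shift_all: "(\<forall>i<r. P i) \<longleftrightarrow> (\<forall>i\<in>{s..<s + r}. P (i - s))"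
proof
  assume a: "\<forall>i\<in>{s..<s + r}. P (i - s)"
  show "\<forall>i<r. P i"
  proof (intro allI impI)
    fix i assume "i < r"
    then show "P i" using bspec[OF a, of "s + i"] by simp
  qed
qed auto

lemma feasible_iff:
  assumes x: "\<And>k. k < n \<Longrightarrow> x (Suc k) \<in> carrier_vec q"
  shows "x \<in> nfold_feasible A B n b \<longleftrightarrow> run.feasible (of_vec x)"
proof -
  have dim: "dim_row B = s" "dim_col A = q" "dim_row A = r" using A B by auto
  have car: "(\<lambda>k. B *\<^sub>v x k) \<in> {1..n} \<rightarrow> carrier_vec s" by (rule funcsetI, rule carrier_vecI) (simp add: dim)
  have link: "finsum_vec TYPE(int) s (\<lambda>k. B *\<^sub>v x k) {1..n} $ i = (\<Sum>k<n. \<Sum>j<q. rows i j * of_vec x k j)"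
    if "i < s" for i
  proof -
    have "finsum_vec TYPE(int) s (\<lambda>k. B *\<^sub>v x k) {1..n} $ i = (\<Sum>k\<in>{1..n}. (B *\<^sub>v x k) $ i)"
      using that car by (intro index_finsum_vec) auto
    also have "\<dots> = (\<Sum>k<n. (B *\<^sub>v x (Suc k)) $ i)"
      by (simp add: sum.atLeast1_atMost_eq)
    also have "\<dots> = (\<Sum>k<n. \<Sum>j<q. rows i j * of_vec x k j)"
      using that mult_index(2)[OF x] by (intro sum.cong) (auto simp: rows_def of_vec_def)
    finally show ?thesis .
  qed
  have "finsum_vec TYPE(int) s (\<lambda>k. B *\<^sub>v x k) {1..n} \<in> carrier_vec s"
    using car by (rule finsum_vec_closed)
  from carrier_vecD[OF this] have 1: "finsum_vec TYPE(int) s (\<lambda>k. B *\<^sub>v x k) {1..n} = b 0 \<longleftrightarrow>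
      (\<forall>i<s. (\<Sum>k<n. \<Sum>j<q. rows i j * of_vec x k j) = (\<Sum>k<n. run.rhs k i))"
    unfolding vec_eq_iff using link rhs_b0 by (simp add: dims(1))
  have 2: "A *\<^sub>v x (Suc k) = b (Suc k) \<longleftrightarrow>
      (\<forall>i\<in>{s..<s + r}. (\<Sum>j<q. rows i j * of_vec x k j) = run.rhs k i)" if k: "k < n" for k
  proof -
    have "A *\<^sub>v x (Suc k) = b (Suc k) \<longleftrightarrow> (\<forall>i<r. (\<Sum>j<q. A $$ (i, j) * x (Suc k) $ j) = b (Suc k) $ i)"
      unfolding vec_eq_iff using mult_index(1)[OF x[OF k]]
      by (simp add: dims(2)[OF k] dim del: index_mult_mat_vec)
    also have "\<dots> \<longleftrightarrow> (\<forall>i\<in>{s..<s + r}. (\<Sum>j<q. A $$ (i - s, j) * x (Suc k) $ j) = b (Suc k) $ (i - s))"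
      by (rule shift_all)
    also have "\<dots> \<longleftrightarrow> (\<forall>i\<in>{s..<s + r}. (\<Sum>j<q. rows i j * of_vec x k j) = run.rhs k i)"
      using rhs_b[OF k] by (simp add: rows_def of_vec_def)
    finally show ?thesis .
  qed
  show ?thesis
    unfolding nfold_feasible_def run.feasible_def mem_Collect_eq dim all_blocks 1
    using x 2 by (auto simp: of_vec_def)
qed

lemma objective_eq:
  assumes x: "\<And>k. k < n \<Longrightarrow> x (Suc k) \<in> carrier_vec q"
  shows "nfold_objective n c x = run.cost (of_vec x)"
proof -
  have "nfold_objective n c x = (\<Sum>k<n. c (Suc k) \<bullet> x (Suc k))"
    by (simp add: nfold_objective_def sum.atLeast1_atMost_eq)
  also have "\<dots> = run.cost (of_vec x)"
    unfolding run.cost_def using obj_c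
  proof (intro sum.cong refl)
    fix k assume "k \<in> {..<n}"
    then have "k < n" by simp
    then show "c (Suc k) \<bullet> x (Suc k) = (\<Sum>j<q. run.obj k j * of_vec x k j)"
      using x[of k] obj_c[of k] by (simp add: scalar_prod_def of_vec_def atLeast0LessThan)
  qed
  finally show ?thesis .
qed

lemma to_vec_carrier: "to_vec z k \<in> carrier_vec q" by (simp add: to_vec_def)

lemma of_to_vec: "j < q \<Longrightarrow> of_vec (to_vec z) k j = z k j" by (simp add: to_vec_def of_vec_def)

lemma to_vec_feasible: "run.feasible z \<Longrightarrow> to_vec z \<in> nfold_feasible A B n b"
  using feasible_iff[of "to_vec z", OF to_vec_carrier] by (simp add: run.feasible_def of_to_vec)

lemma to_vec_objective: "nfold_objective n c (to_vec z) = run.cost z"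
  using objective_eq[of "to_vec z", OF to_vec_carrier] by (simp add: run.cost_def of_to_vec)

lemma feasible_of_vec:
  assumes "x \<in> nfold_feasible A B n b"
  shows "run.feasible (of_vec x)" "nfold_objective n c x = run.cost (of_vec x)"
proof -
  have x: "x (Suc k) \<in> carrier_vec q" if "k < n" for k
    using assms that A by (auto simp: nfold_feasible_def)
  show "run.feasible (of_vec x)" using feasible_iff[of x, OF x] assms by blast
  show "nfold_objective n c x = run.cost (of_vec x)" by (rule objective_eq) (rule x)
qed

lemma correct_output_outcome:
  assumes "run.correct_output ys"
  shows "\<exists>res. ys = encode_outcome n res \<and> correct_outcome A B n b c res"
  using assms unfolding run.correct_output_def
proof (elim disjE conjE exE)
  assume "ys = [0]" "\<not> (\<exists>z. run.feasible z)"
  then show ?thesis using feasible_of_vec(1) by (intro exI[of _ Infeasible]) auto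
next
  assume ys: "ys = [1]" and u: "\<forall>b. \<exists>z. run.feasible z \<and> run.cost z < b"
  have "\<exists>x\<in>nfold_feasible A B n b. nfold_objective n c x < M" for M
    using u to_vec_feasible to_vec_objective by metis
  then show ?thesis using ys by (intro exI[of _ Unbounded]) simp
next
  fix x assume ys: "ys = 2 # run.solution_list x n" and f: "run.feasible x"
    and o: "\<forall>z. run.feasible z \<longrightarrow> run.cost x \<le> run.cost z"
  have "blocks (to_vec x) [1..<Suc n] = run.solution_list x n"
    unfolding blocks_from_1 run.solution_list_def by (simp add: to_vec_def list_of_vec_vec)
  moreover have "correct_outcome A B n b c (Optimal (to_vec x))"
    using to_vec_feasible[OF f] o feasible_of_vec to_vec_objective by auto
  ultimately show ?thesis using ys by (intro exI[of _ "Optimal (to_vec x)"]) simp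
qed

end

theorem theorem1p2:
  fixes A B :: "int mat" and r s q :: nat
  assumes "A \<in> carrier_mat r q" and "B \<in> carrier_mat s q"
  shows "\<exists>(P :: com) (p :: nat poly).
    \<forall>(n :: nat) (b :: nat \<Rightarrow> int vec) (c :: nat \<Rightarrow> int vec).
      nfold_instance r s q n b c \<longrightarrow>
      (\<exists>t res. runs P (encode_instance n b c) t (encode_outcome n res) \<and>
        t \<le> poly p (input_size n b c) \<and>
        correct_outcome A B n b c res)"
proof -
  \<comment> \<open>\<open>B\<close> is stacked above \<open>A\<close>, so that the linking rows are
    the low digits of the encoded state.\<close>
  define e where "e i j = (if i < s then B $$ (i, j) else A $$ (i - s, j))" for i j
  interpret R: nfold_rows e s "s + r" q by unfold_locales simp
  have "poly_bounded (\<lambda>x. R.hT x * kap R.nfold_prog * poly R.bits x)"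
    by (intro poly_bounded_intros R.hT_poly)
  then obtain p :: "nat poly" where p: "\<And>x. R.hT x * kap R.nfold_prog * poly R.bits x \<le> poly p x"
    unfolding poly_bounded_def by blast
  show ?thesis
  proof (rule exI[of _ R.nfold_prog], rule exI[of _ p], intro allI impI)
    fix n and b c :: "nat \<Rightarrow> int vec" assume inst: "nfold_instance r s q n b c"
    interpret nfold_instance_vec A B r s q n b c by unfold_locales (use assms inst in auto)
    have e: "e = rows" by (simp add: e_def rows_def fun_eq_iff)
    have "inp = map (\<lambda>i. inp ! i) [0..<s + n * (r + q)]"
      using length_inp map_nth[of inp] by simp
    then have enc: "encode_instance n b c = int n # map (\<lambda>i. inp ! i) [0..<s + n * (r + q)]"
      using encode_eq by simp
    have "\<exists>t ys. runs R.nfold_prog (int n # map (\<lambda>i. inp ! i) [0..<s + n * (s + r - s + q)]) t ys \<and>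
      t \<le> R.hT (input_size n b c) * kap R.nfold_prog * poly R.bits (input_size n b c) \<and>
      nfold_run.correct_output e s (s + r) q n (\<lambda>i. inp ! i) ys"
      by (rule R.runs_nfold_prog) (use n1 size_bounds in auto)
    then obtain t ys where t: "runs R.nfold_prog (encode_instance n b c) t ys"
      "t \<le> R.hT (input_size n b c) * kap R.nfold_prog * poly R.bits (input_size n b c)"
      "run.correct_output ys" unfolding enc e by auto
    from correct_output_outcome[OF t(3)] obtain res where
      "ys = encode_outcome n res" "correct_outcome A B n b c res" by blast
    then show "\<exists>t res. runs R.nfold_prog (encode_instance n b c) t (encode_outcome n res) \<and>
        t \<le> poly p (input_size n b c) \<and> correct_outcome A B n b c res"
      using t(1,2) p[of "input_size n b c"] by (meson order_trans)
  qed
qed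

end
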